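(* Let $f:\mathbb S^1\times\mathbb R\to\mathbb R$ be smooth and tame, and assume that $0$ is a regular value of $u\mapsto\int_{\mathbb S^1}D_2f(t,u(t))\,dt$ on $B^1$. Let $F:B^1\to B^0$, $F(u)(t)=u'(t)+f(t,u(t))$, and $\Phi:B^1\to\mathbb R$, $\Phi(u)=\int_{\mathbb S^1}f(t,u(t))\,dt$. Let $k\ge1$. A point $u\in B^1$ is a Morin singularity of order $k$ for $F$ if and only if: (a) $w\Phi(u)=\dots=w^k\Phi(u)=0$; (b) $w^{k+1}\Phi(u)\ne0$; (c) the derivative $D(w\Phi,\dots,w^{k-1}\Phi)(u):B^1\to\mathbb R^{k-1}$ is surjective.
   Context: $\mathbb S^1=\mathbb R/\mathbb Z$. The pair $(B^1,B^0)$ is either $(H^1(\mathbb S^1;\mathbb R),L^2(\mathbb S^1;\mathbb R))$ or $(C^1(\mathbb S^1;\mathbb R),C^0(\mathbb S^1;\mathbb R))$; the result is asserted in both cases. $D_2f$ is the partial derivative in the second variable. $\tilde B^0$ is the space of average-zero functions in $B^0$. $f$ is *wild at $+\infty$* (resp. $-\infty$) if both $\int_I\frac{ds}{\max(1,\sup_t f(t,s))}<\infty$ and $\int_I\frac{ds}{\max(1,\sup_t(-f(t,s)))}<\infty$ for $I=[0,+\infty)$ (resp. $(-\infty,0]$); $f$ is *tame* if wild neither at $+\infty$ nor at $-\infty$. The smooth vector field $w$ on $B^1$ is $w_u(t)=\exp\left(-\int_{\mathbb S^1}\kappa(s-t)D_2f(s,u(s))\,ds\right)$ with $\kappa(x)=x-\lfloor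 x\rfloor-1/2$. For smooth $\xi:B^1\to\mathbb R$, $w\xi$ is the Lie derivative $(w\xi)(u)=D\xi(u)\cdot w_u$, and $w^j\xi=w(w^{j-1}\xi)$. For tame $f$ the map $\Psi:B^1\to B^0$, $\Psi(u)=F(u)-\int F(u)+\int u$, is a diffeomorphism and $F\circ\Psi^{-1}(\tilde v,\overline u)=(\tilde v,\phi(\tilde v,\overline u))$ on $B^0=\tilde B^0\oplus\mathbb R$, with $\phi$ smooth. The point $u$ is a *Morin singularity of order $k$* of $F$ if at $\Psi(u)$: $D_2\phi=\dots=D_2^k\phi=0$; $D_2^{k+1}\phi\neq0$; and the derivative $D(D_2\phi,\dots,D_2^{k-1}\phi)$ is surjective onto $\mathbb R^{k-1}$. Here $D_2\phi$ is the derivative in the real variable $\overline u$. *)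

theory Defs
  imports "HOL-Analysis.Analysis"
begin

text \<open>
  Functions on \<open>\<real>/\<int>\<close> are represented by 1-periodic functions on \<open>\<real>\<close>, and integration over the
  circle by the measure \<open>circ\<close> on the fundamental domain \<open>[0,1)\<close>.  A square-integrable class is
  determined by its values on \<open>[0,1)\<close>, so the representatives used for \<open>L\<^sup>2\<close> carry no periodicity
  condition.
\<close>

definition circ :: "real measure" where
  "circ = restrict_space lborel {0..<1}"

lemma space_circ [simp]: "space circ = {0..<1}"
  by (simp add: circ_def space_restrict_space)

lemma sets_circ: "sets circ = sets (restrict_space borel {0..<1::real})"
  by (simp add: circ_def sets_restrict_space)

lemma emeasure_circ: "emeasure circ {0..<1} = 1"
  by (simp add: circ_def emeasure_restrict_space)

interpretation circ: finite_measure circ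
  by standard (simp add: emeasure_circ)

lemma measure_circ: "measure circ {0..<1} = 1"
  by (simp add: measure_def emeasure_circ)

lemma borel_measurable_circ: "g \<in> borel_measurable borel \<Longrightarrow> g \<in> borel_measurable circ"
  unfolding circ_def by (rule measurable_restrict_space1) simp

definition periodic :: "(real \<Rightarrow> 'a) \<Rightarrow> bool" where
  "periodic g \<longleftrightarrow> (\<forall>t. g (t + 1) = g t)"

lemma periodic_of_int:
  assumes "periodic g"
  shows "g (t + of_int n) = g t"
proof -
  have pos: "g (s + real j) = g s" for s j
  proof (induction j)
    case (Suc j)
    then show ?case
      using assms[unfolded periodic_def, rule_format, of "s + real j"]
      by (simp add: add_ac)
  qed simp
  show ?thesis
  proof (cases "n \<ge> 0")
    case True
    then show ?thesis using pos[of t "nat n"] by simp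
  next
    case False
    then show ?thesis using pos[of "t + of_int n" "nat (- n)"] by simp
  qed
qed


subsection \<open>The space \<open>L\<^sup>2\<close>\<close>

definition square_integrable :: "(real \<Rightarrow> real) \<Rightarrow> bool" where
  "square_integrable g \<longleftrightarrow> g \<in> borel_measurable circ \<and> integrable circ (\<lambda>t. (g t)\<^sup>2)"

definition l2rel :: "(real \<Rightarrow> real) \<Rightarrow> (real \<Rightarrow> real) \<Rightarrow> bool" where
  "l2rel g h \<longleftrightarrow> square_integrable g \<and> square_integrable h \<and> (AE t in circ. g t = h t)"

lemma square_integrable_measurable [measurable_dest]:
  "square_integrable g \<Longrightarrow> g \<in> borel_measurable circ"
  by (simp add: square_integrable_def)

lemma square_integrable_mult:
  assumes "square_integrable g" "square_integrable h"
  shows "integrable circ (\<lambda>t. g t * h t)"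
proof (rule Bochner_Integration.integrable_bound)
  show "integrable circ (\<lambda>t. (g t)\<^sup>2 + (h t)\<^sup>2)"
    using assms by (auto simp: square_integrable_def)
  show "(\<lambda>t. g t * h t) \<in> borel_measurable circ"
    using assms by (auto simp: square_integrable_def)
  have "\<bar>x * y\<bar> \<le> x\<^sup>2 + y\<^sup>2" for x y :: real
  proof -
    have "0 \<le> (\<bar>x\<bar> - \<bar>y\<bar>)\<^sup>2" by simp
    then have "2 * (\<bar>x\<bar> * \<bar>y\<bar>) \<le> x\<^sup>2 + y\<^sup>2" by (simp add: power2_diff)
    moreover have "0 \<le> \<bar>x\<bar> * \<bar>y\<bar>" by simp
    ultimately show ?thesis unfolding abs_mult by linarith
  qed
  then show "AE t in circ. norm (g t * h t) \<le> norm ((g t)\<^sup>2 + (h t)\<^sup>2)"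
    by simp
qed

lemma square_integrable_const: "square_integrable (\<lambda>t. c)"
  by (simp add: square_integrable_def)

lemma square_integrable_add:
  assumes "square_integrable g" "square_integrable h"
  shows "square_integrable (\<lambda>t. g t + h t)"
proof -
  have "integrable circ (\<lambda>t. (g t)\<^sup>2 + (h t)\<^sup>2 + 2 * (g t * h t))"
    using assms square_integrable_mult[OF assms] by (auto simp: square_integrable_def)
  then show ?thesis
    using assms by (auto simp: square_integrable_def power2_sum mult.assoc)
qed

lemma square_integrable_scale:
  "square_integrable g \<Longrightarrow> square_integrable (\<lambda>t. c * g t)"
  by (auto simp: square_integrable_def power_mult_distrib)

lemma square_integrable_uminus:
  "square_integrable g \<Longrightarrow> square_integrable (\<lambda>t. - g t)"
  using square_integrable_scale[of g "-1"] by simp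

lemma square_integrable_diff:
  "square_integrable g \<Longrightarrow> square_integrable h \<Longrightarrow> square_integrable (\<lambda>t. g t - h t)"
  using square_integrable_add[OF _ square_integrable_uminus, of g h] by simp

lemma square_integrable_integrable:
  "square_integrable g \<Longrightarrow> integrable circ g"
  using square_integrable_mult[OF _ square_integrable_const[of 1]] by simp

quotient_type l2 = "real \<Rightarrow> real" / partial: l2rel
proof (rule part_equivpI)
  show "\<exists>g. l2rel g g"
    by (rule exI[of _ "\<lambda>_. 0"]) (simp add: l2rel_def square_integrable_const)
  show "symp l2rel"
    by (rule sympI) (auto simp: l2rel_def)
  show "transp l2rel"
    by (rule transpI) (auto simp: l2rel_def elim: AE_mp)
qed

instantiation l2 :: real_inner
begin

lift_definition zero_l2 :: l2 is "\<lambda>_. 0"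
  by (simp add: l2rel_def square_integrable_const)

lift_definition plus_l2 :: "l2 \<Rightarrow> l2 \<Rightarrow> l2" is "\<lambda>g h t. g t + h t"
  by (auto simp: l2rel_def square_integrable_add elim: AE_mp)

lift_definition minus_l2 :: "l2 \<Rightarrow> l2 \<Rightarrow> l2" is "\<lambda>g h t. g t - h t"
  by (auto simp: l2rel_def square_integrable_diff elim: AE_mp)

lift_definition uminus_l2 :: "l2 \<Rightarrow> l2" is "\<lambda>g t. - g t"
  by (auto simp: l2rel_def square_integrable_uminus elim: AE_mp)

lift_definition scaleR_l2 :: "real \<Rightarrow> l2 \<Rightarrow> l2" is "\<lambda>c g t. c * g t"
  by (auto simp: l2rel_def square_integrable_scale elim: AE_mp)

lift_definition inner_l2 :: "l2 \<Rightarrow> l2 \<Rightarrow> real" is "\<lambda>g h. \<integral>t. g t * h t \<partial>circ"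
  by (rule integral_cong_AE) (auto simp: l2rel_def square_integrable_def elim: AE_mp)

definition norm_l2 :: "l2 \<Rightarrow> real" where "norm_l2 v = sqrt (inner v v)"
definition dist_l2 :: "l2 \<Rightarrow> l2 \<Rightarrow> real" where "dist_l2 v v' = norm (v - v')"
definition sgn_l2 :: "l2 \<Rightarrow> l2" where "sgn_l2 v = inverse (norm v) *\<^sub>R v"
definition uniformity_l2 :: "(l2 \<times> l2) filter" where
  "uniformity_l2 = (INF e\<in>{0<..}. principal {(v, v'). dist v v' < e})"
definition open_l2 :: "l2 set \<Rightarrow> bool" where
  "open_l2 S \<longleftrightarrow> (\<forall>v\<in>S. \<forall>\<^sub>F (v', w) in uniformity. v' = v \<longrightarrow> w \<in> S)"

instance
proof
  fix a b c :: l2 and r s :: real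
  show "a + b + c = a + (b + c)"
    by transfer (simp add: l2rel_def square_integrable_add add.assoc)
  show "a + b = b + a"
    by transfer (simp add: l2rel_def square_integrable_add add.commute)
  show "0 + a = a"
    by transfer (simp add: l2rel_def)
  show "- a + a = 0"
    by transfer (simp add: l2rel_def square_integrable_const)
  show "a - b = a + - b"
    by transfer (simp add: l2rel_def square_integrable_diff)
  show "r *\<^sub>R (a + b) = r *\<^sub>R a + r *\<^sub>R b"
    by transfer (simp add: l2rel_def square_integrable_add square_integrable_scale distrib_left)
  show "(r + s) *\<^sub>R a = r *\<^sub>R a + s *\<^sub>R a"
    by transfer (simp add: l2rel_def square_integrable_add square_integrable_scale distrib_right)
  show "r *\<^sub>R s *\<^sub>R a = (r * s) *\<^sub>R a"
    by transfer (simp add: l2rel_def square_integrable_scale mult.assoc)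
  show "1 *\<^sub>R a = a"
    by transfer (simp add: l2rel_def)
  show "inner a b = inner b a"
    by transfer (simp add: mult.commute)
  show "inner (a + b) c = inner a c + inner b c"
    by transfer (simp add: l2rel_def distrib_right square_integrable_mult)
  show "inner (r *\<^sub>R a) b = r * inner a b"
    by transfer (simp add: mult.assoc)
  show "0 \<le> inner a a"
    by transfer simp
  show "inner a a = 0 \<longleftrightarrow> a = 0"
  proof transfer
    fix g assume "l2rel g g"
    then have g: "square_integrable g" by (simp add: l2rel_def)
    have "(\<integral>t. g t * g t \<partial>circ) = 0 \<longleftrightarrow> (AE t in circ. g t * g t = 0)"
      by (rule integral_nonneg_eq_0_iff_AE) (simp_all add: square_integrable_mult g)
    then show "(\<integral>t. g t * g t \<partial>circ) = 0 \<longleftrightarrow> l2rel g (\<lambda>_. 0)"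
      by (simp add: l2rel_def g square_integrable_const)
  qed
qed (simp_all add: norm_l2_def dist_l2_def sgn_l2_def uniformity_l2_def open_l2_def)

end

lift_definition l2_mean :: "l2 \<Rightarrow> real" is "\<lambda>g. \<integral>t. g t \<partial>circ"
  by (rule integral_cong_AE) (auto simp: l2rel_def)

lift_definition l2_primitive :: "l2 \<Rightarrow> real \<Rightarrow> real" is
  "\<lambda>g t. \<integral>s. indicator {0..<t} s * g s \<partial>circ"
proof (rule ext, rule integral_cong_AE)
  fix g h :: "real \<Rightarrow> real" and t :: real
  assume *: "l2rel g h"
  have [measurable]: "(\<lambda>s. indicator {0..<t} s :: real) \<in> borel_measurable circ"
    by (rule borel_measurable_circ) simp
  have [measurable]: "g \<in> borel_measurable circ" "h \<in> borel_measurable circ"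
    using * by (auto simp: l2rel_def)
  show "(\<lambda>s. indicator {0..<t} s * g s) \<in> borel_measurable circ" by measurable
  show "(\<lambda>s. indicator {0..<t} s * h s) \<in> borel_measurable circ" by measurable
  show "AE s in circ. indicator {0..<t} s * g s = indicator {0..<t} s * h s"
    using * by (auto simp: l2rel_def elim: AE_mp)
qed

lemma integrable_indicator_circ:
  assumes "square_integrable g"
  shows "integrable circ (\<lambda>s. indicator {0..<t::real} s * g s)"
proof (rule Bochner_Integration.integrable_bound)
  show "integrable circ g" using assms by (rule square_integrable_integrable)
  have [measurable]: "(\<lambda>s. indicator {0..<t} s :: real) \<in> borel_measurable circ"
    by (rule borel_measurable_circ) simp
  have [measurable]: "g \<in> borel_measurable circ" using assms by auto
  show "(\<lambda>s. indicator {0..<t} s * g s) \<in> borel_measurable circ" by measurable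
qed (auto simp: indicator_def)

lemma l2_primitive_0: "l2_primitive v 0 = 0"
  by transfer simp

lemma l2_primitive_zero: "l2_primitive 0 t = 0"
  by transfer simp

lemma l2_primitive_add: "l2_primitive (v + w) t = l2_primitive v t + l2_primitive w t"
  by transfer (simp add: l2rel_def distrib_left integrable_indicator_circ)

lemma l2_primitive_scaleR: "l2_primitive (c *\<^sub>R v) t = c * l2_primitive v t"
  by transfer (simp add: mult.left_commute)

lemma l2_primitive_uminus: "l2_primitive (- v) t = - l2_primitive v t"
  using l2_primitive_scaleR[of "-1" v t] by simp

lemma l2_primitive_diff: "l2_primitive (v - w) t = l2_primitive v t - l2_primitive w t"
  using l2_primitive_add[of v "- w" t] by (simp add: l2_primitive_uminus)

lemma l2_primitive_eq_0:
  assumes "\<And>t. t \<in> {0..1} \<Longrightarrow> l2_primitive v t = 0"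
  shows "v = 0"
  using assms
proof transfer
  fix g assume "l2rel g g"
    and prim: "\<And>t. t \<in> {0..1} \<Longrightarrow> (\<integral>s. indicator {0..<t} s * g s \<partial>circ) = 0"
  then have g: "square_integrable g" by (simp add: l2rel_def)
  have int: "integrable circ g" using g by (rule square_integrable_integrable)
  let ?I = "\<lambda>A. \<integral>s. indicator A s * g s \<partial>circ"
  have Iint: "integrable circ (\<lambda>s. indicator A s * g s)" if "A \<in> sets borel" for A
  proof (rule Bochner_Integration.integrable_bound[OF int])
    have [measurable]: "(\<lambda>s. indicator A s :: real) \<in> borel_measurable circ"
      using that by (intro borel_measurable_circ) simp
    have [measurable]: "g \<in> borel_measurable circ" using g by auto
    show "(\<lambda>s. indicator A s * g s) \<in> borel_measurable circ" by measurable
  qed (auto simp: indicator_def)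
  have lt: "?I {..<t} = 0" for t
  proof -
    have "?I {..<t} = ?I {0..<max 0 (min t 1)}"
      by (rule Bochner_Integration.integral_cong) (auto simp: indicator_def)
    also have "\<dots> = 0" by (rule prim) auto
    finally show ?thesis .
  qed
  have tot: "(\<integral>s. g s \<partial>circ) = 0"
  proof -
    have "(\<integral>s. g s \<partial>circ) = ?I {..<1}"
      by (rule Bochner_Integration.integral_cong) (auto simp: indicator_def)
    then show ?thesis by (simp add: lt)
  qed
  have borel_gen: "sets borel = sigma_sets UNIV (range (\<lambda>a::real. {..<a}))"
    by (subst borel_Iio) simp
  have all: "?I A = 0" if A: "A \<in> sets borel" for A
  proof -
    have "Int_stable (range (\<lambda>a::real. {..<a}))"
    proof (rule Int_stableI_image)
      fix a b :: real
      have "{..<a} \<inter> {..<b} = {..<min a b}" by auto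
      then show "\<exists>c\<in>UNIV. {..<a} \<inter> {..<b} = {..<c}" by blast
    qed
    moreover have "range (\<lambda>a::real. {..<a}) \<subseteq> Pow UNIV" by simp
    moreover have "A \<in> sigma_sets UNIV (range (\<lambda>a::real. {..<a}))" using A borel_gen by simp
    ultimately show ?thesis
    proof (induction rule: sigma_sets_induct_disjoint[consumes 3])
      fix A assume "A \<in> range (\<lambda>a::real. {..<a})"
      then show "?I A = 0" using lt by auto
    next
      show "?I {} = 0" by simp
    next
      fix A assume "A \<in> sigma_sets UNIV (range (\<lambda>a::real. {..<a}))" and IA: "?I A = 0"
      then have A: "A \<in> sets borel" using borel_gen by simp
      have "?I (UNIV - A) = (\<integral>s. g s - indicator A s * g s \<partial>circ)"
        by (rule Bochner_Integration.integral_cong) (auto simp: indicator_def)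
      also have "\<dots> = 0" using IA tot int Iint[OF A] by simp
      finally show "?I (UNIV - A) = 0" .
    next
      fix B :: "nat \<Rightarrow> real set"
      assume disj: "disjoint_family B"
        and "range B \<subseteq> sigma_sets UNIV (range (\<lambda>a::real. {..<a}))" and IB: "\<And>i. ?I (B i) = 0"
      then have B: "B i \<in> sets borel" for i
        unfolding borel_gen by (intro range_subsetD)
      have sum_B: "?I (\<Union>i<n. B i) = 0" for n
      proof (induction n)
        case (Suc n)
        have dj: "(\<Union>i<n. B i) \<inter> B n = {}"
        proof -
          have "B i \<inter> B n = {}" if "i < n" for i
            using disj that by (intro disjoint_family_onD[where I = UNIV]) auto
          then show ?thesis by blast
        qed
        have "?I (\<Union>i<Suc n. B i) = (\<integral>s. indicator (\<Union>i<n. B i) s * g s + indicator (B n) s * g s \<partial>circ)"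
        proof (rule Bochner_Integration.integral_cong)
          fix s
          have "indicator (\<Union>i<Suc n. B i) s = (indicator (\<Union>i<n. B i) s + indicator (B n) s :: real)"
            using dj by (auto simp: indicator_def less_Suc_eq)
          then show "indicator (\<Union>i<Suc n. B i) s * g s
              = indicator (\<Union>i<n. B i) s * g s + indicator (B n) s * g s"
            by (simp add: distrib_right)
        qed simp
        also have "\<dots> = ?I (\<Union>i<n. B i) + ?I (B n)"
          using B by (intro Bochner_Integration.integral_add Iint) auto
        finally show ?case using Suc IB by simp
      qed simp
      have "(\<lambda>n. ?I (\<Union>i<n. B i)) \<longlonglongrightarrow> ?I (\<Union>i. B i)"
      proof (rule integral_dominated_convergence[where w = "\<lambda>s. \<bar>g s\<bar>"])
        show "(\<lambda>s. indicator (\<Union>i. B i) s * g s) \<in> borel_measurable circ"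
          using B by (intro borel_measurable_integrable Iint) auto
        show "(\<lambda>s. indicator (\<Union>i<n. B i) s * g s) \<in> borel_measurable circ" for n
          using B by (intro borel_measurable_integrable Iint) auto
        show "integrable circ (\<lambda>s. \<bar>g s\<bar>)" using int by simp
        show "AE s in circ. (\<lambda>n. indicator (\<Union>i<n. B i) s * g s) \<longlonglongrightarrow> indicator (\<Union>i. B i) s * g s"
          by (intro always_eventually allI tendsto_mult tendsto_const LIMSEQ_indicator_UN)
        show "AE s in circ. norm (indicator (\<Union>i<n. B i) s * g s) \<le> \<bar>g s\<bar>" for n
          by (auto simp: indicator_def)
      qed
      then have "(\<lambda>n. 0) \<longlonglongrightarrow> ?I (\<Union>i. B i)" unfolding sum_B .
      then show "?I (\<Union>i. B i) = 0"
        using LIMSEQ_unique tendsto_const by metis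
    qed
  qed
  have "AE s in circ. g s = 0"
  proof (rule circ.density_zero[OF int])
    fix A assume "A \<in> sets circ"
    then have "A \<in> sets borel"
      by (auto simp: sets_circ sets_restrict_space)
    then show "set_lebesgue_integral circ A g = 0"
      using all by (simp add: set_lebesgue_integral_def)
  qed
  then show "l2rel g (\<lambda>_. 0)" by (simp add: l2rel_def g square_integrable_const)
qed

lemma l2_primitive_inject:
  assumes "\<And>t. t \<in> {0..1} \<Longrightarrow> l2_primitive v t = l2_primitive w t"
  shows "v = w"
  using l2_primitive_eq_0[of "v - w"] assms by (simp add: l2_primitive_diff)

lemma square_integrable_primitive: "square_integrable (\<lambda>t. c + l2_primitive v t)"
proof -
  have "square_integrable (l2_primitive v)"
  proof transfer
    fix g assume "l2rel g g"
    then have g: "square_integrable g" by (simp add: l2rel_def)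
    then have [measurable]: "g \<in> borel_measurable circ" by auto
    have int: "integrable circ g" using g by (rule square_integrable_integrable)
    let ?p = "\<lambda>t. \<integral>s. indicator {0..<t} s * g s \<partial>circ"
    have id [measurable]: "(\<lambda>s::real. s) \<in> borel_measurable circ"
      by (rule borel_measurable_circ) simp
    have eq: "?p = (\<lambda>t. \<integral>s. (if s < t then g s else 0) \<partial>circ)"
      by (rule ext, rule Bochner_Integration.integral_cong) (auto simp: indicator_def)
    have "(\<lambda>t. \<integral>s. (if s < t then g s else 0) \<partial>circ) \<in> borel_measurable circ"
      by measurable
    then have [measurable]: "?p \<in> borel_measurable circ" using eq by simp
    have bd: "\<bar>?p t\<bar> \<le> (\<integral>s. \<bar>g s\<bar> \<partial>circ)" for t
    proof -
      have "\<bar>?p t\<bar> \<le> (\<integral>s. \<bar>indicator {0..<t} s * g s\<bar> \<partial>circ)"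
        by (rule integral_abs_bound)
      also have "\<dots> \<le> (\<integral>s. \<bar>g s\<bar> \<partial>circ)"
        using int integrable_indicator_circ[OF g]
        by (intro integral_mono) (auto simp: indicator_def)
      finally show ?thesis .
    qed
    have "integrable circ (\<lambda>t. (?p t)\<^sup>2)"
    proof (rule circ.integrable_const_bound[where B = "(\<integral>s. \<bar>g s\<bar> \<partial>circ)\<^sup>2"])
      show "AE t in circ. norm ((?p t)\<^sup>2) \<le> (\<integral>s. \<bar>g s\<bar> \<partial>circ)\<^sup>2"
        using bd by (auto intro!: always_eventually abs_le_square_iff[THEN iffD1] intro: order_trans abs_ge_self)
    qed measurable
    then show "square_integrable ?p" by (simp add: square_integrable_def)
  qed
  then show ?thesis by (intro square_integrable_add square_integrable_const)
qed


subsection \<open>The space \<open>H\<^sup>1\<close>\<close>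

text \<open>
  An element of \<open>H\<^sup>1\<close> is its continuous representative, i.e. a periodic primitive of an \<open>L\<^sup>2\<close> class;
  that class is the weak derivative.
\<close>

typedef h1 = "{u :: real \<Rightarrow> real. periodic u \<and>
    (\<exists>v::l2. \<forall>t\<in>{0..1}. u t = u 0 + l2_primitive v t)}"
proof (intro exI CollectI conjI ballI)
  show "periodic (\<lambda>_. 0::real)" by (simp add: periodic_def)
  show "(0::real) = 0 + l2_primitive 0 t" for t by (simp add: l2_primitive_zero)
qed

setup_lifting type_definition_h1

definition h1_deriv :: "h1 \<Rightarrow> l2" where
  "h1_deriv u = (THE v. \<forall>t\<in>{0..1}. Rep_h1 u t = Rep_h1 u 0 + l2_primitive v t)"

lemma h1_deriv_eqI:
  assumes "\<And>t. t \<in> {0..1} \<Longrightarrow> Rep_h1 u t = Rep_h1 u 0 + l2_primitive v t"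
  shows "h1_deriv u = v"
  unfolding h1_deriv_def
proof (rule the_equality)
  show "\<forall>t\<in>{0..1}. Rep_h1 u t = Rep_h1 u 0 + l2_primitive v t" using assms by blast
next
  fix w assume "\<forall>t\<in>{0..1}. Rep_h1 u t = Rep_h1 u 0 + l2_primitive w t"
  then show "w = v"
    using assms by (intro l2_primitive_inject) (metis add_left_cancel)
qed

lemma h1_deriv:
  assumes "t \<in> {0..1}"
  shows "Rep_h1 u t = Rep_h1 u 0 + l2_primitive (h1_deriv u) t"
proof -
  obtain v where v: "\<And>t. t \<in> {0..1} \<Longrightarrow> Rep_h1 u t = Rep_h1 u 0 + l2_primitive v t"
    using Rep_h1[of u] unfolding mem_Collect_eq by blast
  then have "h1_deriv u = v" by (rule h1_deriv_eqI)
  then show ?thesis using v[OF assms] by (simp only:)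
qed

lemma h1_square_integrable: "square_integrable (Rep_h1 u)"
proof -
  let ?p = "\<lambda>t. Rep_h1 u 0 + l2_primitive (h1_deriv u) t"
  have eq: "Rep_h1 u t = ?p t" if "t \<in> space circ" for t
    using that by (intro h1_deriv) auto
  have "square_integrable ?p" by (rule square_integrable_primitive)
  moreover have "Rep_h1 u \<in> borel_measurable circ \<longleftrightarrow> ?p \<in> borel_measurable circ"
    by (rule measurable_cong) (rule eq)
  moreover have "integrable circ (\<lambda>t. (Rep_h1 u t)\<^sup>2) \<longleftrightarrow> integrable circ (\<lambda>t. (?p t)\<^sup>2)"
    by (rule Bochner_Integration.integrable_cong[OF refl], rule arg_cong[where f = "\<lambda>x. x\<^sup>2"], rule eq)
  ultimately show ?thesis
    unfolding square_integrable_def by blast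
qed

lemma periodic_h1: "periodic (Rep_h1 u)"
  using Rep_h1[of u] by simp

instantiation h1 :: real_inner
begin

lift_definition zero_h1 :: h1 is "\<lambda>_. 0"
proof (intro conjI exI ballI)
  show "periodic (\<lambda>_. 0::real)" by (simp add: periodic_def)
  show "(0::real) = 0 + l2_primitive 0 t" for t by (simp add: l2_primitive_zero)
qed

lift_definition plus_h1 :: "h1 \<Rightarrow> h1 \<Rightarrow> h1" is "\<lambda>u v t. u t + v t"
proof (safe, goal_cases)
  case (1 u v p q) then show ?case by (simp add: periodic_def)
next
  case (2 u v p q)
  have "u t + v t = u 0 + v 0 + l2_primitive (p + q) t" if "t \<in> {0..1}" for t
  proof -
    have "u t = u 0 + l2_primitive p t" "v t = v 0 + l2_primitive q t"
      using 2 that by blast+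
    then show ?thesis unfolding l2_primitive_add by linarith
  qed
  then show ?case by blast
qed

lift_definition scaleR_h1 :: "real \<Rightarrow> h1 \<Rightarrow> h1" is "\<lambda>c u t. c * u t"
proof (safe, goal_cases)
  case (1 c u v) then show ?case by (simp add: periodic_def)
next
  case (2 c u v)
  have "c * u t = c * u 0 + l2_primitive (c *\<^sub>R v) t" if "t \<in> {0..1}" for t
  proof -
    have "u t = u 0 + l2_primitive v t"
      using 2 that by blast
    then show ?thesis unfolding l2_primitive_scaleR by (simp only: distrib_left)
  qed
  then show ?case by blast
qed

definition uminus_h1 :: "h1 \<Rightarrow> h1" where "uminus_h1 u = (-1) *\<^sub>R u"
definition minus_h1 :: "h1 \<Rightarrow> h1 \<Rightarrow> h1" where "minus_h1 u v = u + (-1) *\<^sub>R v"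

definition inner_h1 :: "h1 \<Rightarrow> h1 \<Rightarrow> real" where
  "inner_h1 u v = (\<integral>t. Rep_h1 u t * Rep_h1 v t \<partial>circ) + inner (h1_deriv u) (h1_deriv v)"

definition norm_h1 :: "h1 \<Rightarrow> real" where "norm_h1 u = sqrt (inner u u)"
definition dist_h1 :: "h1 \<Rightarrow> h1 \<Rightarrow> real" where "dist_h1 u v = norm (u - v)"
definition sgn_h1 :: "h1 \<Rightarrow> h1" where "sgn_h1 u = inverse (norm u) *\<^sub>R u"
definition uniformity_h1 :: "(h1 \<times> h1) filter" where
  "uniformity_h1 = (INF e\<in>{0<..}. principal {(u, v). dist u v < e})"
definition open_h1 :: "h1 set \<Rightarrow> bool" where
  "open_h1 S \<longleftrightarrow> (\<forall>u\<in>S. \<forall>\<^sub>F (u', v) in uniformity. u' = u \<longrightarrow> v \<in> S)"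

lemma h1_deriv_add: "h1_deriv (u + v) = h1_deriv u + h1_deriv v"
proof (rule h1_deriv_eqI)
  fix t :: real assume "t \<in> {0..1}"
  then show "Rep_h1 (u + v) t = Rep_h1 (u + v) 0 + l2_primitive (h1_deriv u + h1_deriv v) t"
    using h1_deriv[of t u] h1_deriv[of t v] by (simp add: plus_h1.rep_eq l2_primitive_add)
qed

lemma h1_deriv_scaleR: "h1_deriv (c *\<^sub>R u) = c *\<^sub>R h1_deriv u"
proof (rule h1_deriv_eqI)
  fix t :: real assume "t \<in> {0..1}"
  then show "Rep_h1 (c *\<^sub>R u) t = Rep_h1 (c *\<^sub>R u) 0 + l2_primitive (c *\<^sub>R h1_deriv u) t"
    using h1_deriv[of t u]
    by (simp add: scaleR_h1.rep_eq l2_primitive_scaleR flip: distrib_left)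
qed

instance
proof
  fix a b c :: h1 and r s :: real
  show "a + b + c = a + (b + c)" by transfer (simp add: add.assoc)
  show "a + b = b + a" by transfer (simp add: add.commute)
  show "0 + a = a" by transfer simp
  show "- a + a = 0" unfolding uminus_h1_def by transfer simp
  show "a - b = a + - b" by (simp add: minus_h1_def uminus_h1_def)
  show "r *\<^sub>R (a + b) = r *\<^sub>R a + r *\<^sub>R b" by transfer (simp add: distrib_left)
  show "(r + s) *\<^sub>R a = r *\<^sub>R a + s *\<^sub>R a" by transfer (simp add: distrib_right)
  show "r *\<^sub>R s *\<^sub>R a = (r * s) *\<^sub>R a" by transfer (simp add: mult.assoc)
  show "1 *\<^sub>R a = a" by transfer simp
  show "inner a b = inner b a"
    by (simp add: inner_h1_def mult.commute inner_commute)
  show "inner (a + b) c = inner a c + inner b c"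
    by (simp add: inner_h1_def plus_h1.rep_eq h1_deriv_add inner_add_left distrib_right
        square_integrable_mult h1_square_integrable)
  show "inner (r *\<^sub>R a) b = r * inner a b"
    by (simp add: inner_h1_def scaleR_h1.rep_eq h1_deriv_scaleR distrib_left mult.assoc)
  show "0 \<le> inner a a"
    by (simp add: inner_h1_def)
  show "inner a a = 0 \<longleftrightarrow> a = 0"
  proof
    assume "inner a a = 0"
    moreover have "0 \<le> (\<integral>t. Rep_h1 a t * Rep_h1 a t \<partial>circ)" by simp
    moreover have "0 \<le> inner (h1_deriv a) (h1_deriv a)" by simp
    ultimately have z: "(\<integral>t. Rep_h1 a t * Rep_h1 a t \<partial>circ) = 0"
      and "inner (h1_deriv a) (h1_deriv a) = 0"
      unfolding inner_h1_def by linarith+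
    then have d: "h1_deriv a = 0" by simp
    have const: "Rep_h1 a t = Rep_h1 a 0" if "t \<in> {0..1}" for t
      using h1_deriv[OF that, of a] by (simp add: d l2_primitive_zero)
    have "(\<integral>t. Rep_h1 a t * Rep_h1 a t \<partial>circ) = (\<integral>t. Rep_h1 a 0 * Rep_h1 a 0 \<partial>circ)"
      using const by (intro Bochner_Integration.integral_cong) (metis atLeastAtMost_iff atLeastLessThan_iff less_imp_le space_circ)+
    then have "Rep_h1 a 0 = 0"
      using z by (simp add: measure_circ)
    then have zero: "Rep_h1 a t = 0" if "t \<in> {0..1}" for t using const[OF that] by simp
    have "Rep_h1 a t = 0" for t
    proof -
      have "Rep_h1 a t = Rep_h1 a (frac t + of_int \<lfloor>t\<rfloor>)" by (simp add: frac_def)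
      also have "\<dots> = Rep_h1 a (frac t)" by (rule periodic_of_int[OF periodic_h1])
      also have "\<dots> = 0" using frac_lt_1[of t] by (intro zero) (simp add: less_imp_le)
      finally show ?thesis .
    qed
    then show "a = 0"
      by (simp add: Rep_h1_inject[symmetric] zero_h1.rep_eq fun_eq_iff)
  next
    assume "a = 0"
    moreover have "h1_deriv 0 = 0"
      by (rule h1_deriv_eqI) (simp add: zero_h1.rep_eq l2_primitive_zero)
    ultimately show "inner a a = 0" by (simp add: inner_h1_def zero_h1.rep_eq)
  qed
qed (simp_all add: norm_h1_def dist_h1_def sgn_h1_def uniformity_h1_def open_h1_def)

end


subsection \<open>The spaces \<open>C\<^sup>0\<close> and \<open>C\<^sup>1\<close>\<close>

typedef c0 = "{g :: real \<Rightarrow> real. periodic g \<and> continuous_on UNIV g}"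
  by (rule exI[of _ "\<lambda>_. 0"]) (simp add: periodic_def)

setup_lifting type_definition_c0

lemma periodic_range:
  assumes "periodic g"
  shows "range g = g ` {0..1::real}"
proof -
  have "g t \<in> g ` {0..1}" for t
  proof -
    have "g t = g (frac t)" using periodic_of_int[OF assms, of "frac t" "\<lfloor>t\<rfloor>"] by (simp add: frac_def)
    moreover have "frac t \<in> {0..1}" using frac_lt_1[of t] by (simp add: less_imp_le)
    ultimately show ?thesis by blast
  qed
  then show ?thesis by blast
qed

lemma c0_bdd: "bdd_above (range (\<lambda>t. \<bar>Rep_c0 g t\<bar>))"
proof -
  have "periodic (\<lambda>t. \<bar>Rep_c0 g t\<bar>)" using Rep_c0[of g] by (simp add: periodic_def)
  then have "range (\<lambda>t. \<bar>Rep_c0 g t\<bar>) = (\<lambda>t. \<bar>Rep_c0 g t\<bar>) ` {0..1}" by (rule periodic_range)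
  moreover have "continuous_on {0..1} (\<lambda>t. \<bar>Rep_c0 g t\<bar>)"
    using Rep_c0[of g] by (auto intro!: continuous_intros elim: continuous_on_subset)
  ultimately show ?thesis
    by (metis bounded_imp_bdd_above compact_Icc compact_continuous_image compact_imp_bounded)
qed

instantiation c0 :: real_normed_vector
begin

lift_definition zero_c0 :: c0 is "\<lambda>_. 0"
  by (simp add: periodic_def)
lift_definition plus_c0 :: "c0 \<Rightarrow> c0 \<Rightarrow> c0" is "\<lambda>g h t. g t + h t"
  by (auto simp: periodic_def intro!: continuous_intros)
lift_definition minus_c0 :: "c0 \<Rightarrow> c0 \<Rightarrow> c0" is "\<lambda>g h t. g t - h t"
  by (auto simp: periodic_def intro!: continuous_intros)
lift_definition uminus_c0 :: "c0 \<Rightarrow> c0" is "\<lambda>g t. - g t"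
  by (auto simp: periodic_def intro!: continuous_intros)
lift_definition scaleR_c0 :: "real \<Rightarrow> c0 \<Rightarrow> c0" is "\<lambda>c g t. c * g t"
  by (auto simp: periodic_def intro!: continuous_intros)
definition norm_c0 :: "c0 \<Rightarrow> real" where "norm_c0 g = (SUP t. \<bar>Rep_c0 g t\<bar>)"
definition dist_c0 :: "c0 \<Rightarrow> c0 \<Rightarrow> real" where "dist_c0 g h = norm (g - h)"
definition sgn_c0 :: "c0 \<Rightarrow> c0" where "sgn_c0 g = inverse (norm g) *\<^sub>R g"
definition uniformity_c0 :: "(c0 \<times> c0) filter" where
  "uniformity_c0 = (INF e\<in>{0<..}. principal {(g, h). dist g h < e})"
definition open_c0 :: "c0 set \<Rightarrow> bool" where
  "open_c0 S \<longleftrightarrow> (\<forall>g\<in>S. \<forall>\<^sub>F (g', h) in uniformity. g' = g \<longrightarrow> h \<in> S)"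

lemma c0_le_norm: "\<bar>Rep_c0 g t\<bar> \<le> norm g"
  unfolding norm_c0_def by (rule cSUP_upper[OF _ c0_bdd]) simp

lemma c0_norm_le: "(\<And>t. \<bar>Rep_c0 g t\<bar> \<le> b) \<Longrightarrow> norm g \<le> b"
  unfolding norm_c0_def by (rule cSUP_least) auto

instance
proof
  fix a b c :: c0 and r s :: real
  show "a + b + c = a + (b + c)" by transfer (simp add: add.assoc)
  show "a + b = b + a" by transfer (simp add: add.commute)
  show "0 + a = a" by transfer simp
  show "- a + a = 0" by transfer simp
  show "a - b = a + - b" by transfer simp
  show "r *\<^sub>R (a + b) = r *\<^sub>R a + r *\<^sub>R b" by transfer (simp add: distrib_left)
  show "(r + s) *\<^sub>R a = r *\<^sub>R a + s *\<^sub>R a" by transfer (simp add: distrib_right)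
  show "r *\<^sub>R s *\<^sub>R a = (r * s) *\<^sub>R a" by transfer (simp add: mult.assoc)
  show "1 *\<^sub>R a = a" by transfer simp
  show "norm a = 0 \<longleftrightarrow> a = 0"
  proof
    assume "norm a = 0"
    then have "Rep_c0 a t = 0" for t using c0_le_norm[of a t] by simp
    then show "a = 0" by (simp add: Rep_c0_inject[symmetric] zero_c0.rep_eq fun_eq_iff)
  next
    assume "a = 0"
    then show "norm a = 0" by (simp add: norm_c0_def zero_c0.rep_eq)
  qed
  show "norm (a + b) \<le> norm a + norm b"
  proof (rule c0_norm_le)
    fix t
    show "\<bar>Rep_c0 (a + b) t\<bar> \<le> norm a + norm b"
      using c0_le_norm[of a t] c0_le_norm[of b t] by (simp add: plus_c0.rep_eq)
  qed
  have le: "norm (r *\<^sub>R a) \<le> \<bar>r\<bar> * norm a" for r and a :: c0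
    by (rule c0_norm_le) (simp add: scaleR_c0.rep_eq abs_mult c0_le_norm mult_left_mono)
  show "norm (r *\<^sub>R a) = \<bar>r\<bar> * norm a"
  proof (cases "r = 0")
    case True
    have "0 *\<^sub>R a = 0" by transfer simp
    then show ?thesis using True by (simp add: norm_c0_def zero_c0.rep_eq)
  next
    case False
    have "inverse r *\<^sub>R (r *\<^sub>R a) = a" using False by transfer (simp flip: mult.assoc)
    then have "norm a \<le> \<bar>inverse r\<bar> * norm (r *\<^sub>R a)" using le[of "inverse r" "r *\<^sub>R a"] by simp
    then have "\<bar>r\<bar> * norm a \<le> norm (r *\<^sub>R a)"
      using False by (simp add: field_simps)
    then show ?thesis using le[of r a] by simp
  qed
qed (simp_all add: dist_c0_def sgn_c0_def uniformity_c0_def open_c0_def)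

end

typedef c1 = "{u :: real \<Rightarrow> real. periodic u \<and> (\<forall>t. u differentiable at t) \<and>
    continuous_on UNIV (deriv u)}"
  by (rule exI[of _ "\<lambda>_. 0"]) (simp add: periodic_def)

setup_lifting type_definition_c1

lemma periodic_deriv:
  assumes "periodic u" "\<And>t. u differentiable at t"
  shows "periodic (deriv u)"
proof -
  have "deriv u (t + 1) = deriv u t" for t
  proof -
    have "(u has_real_derivative deriv u (t + 1)) (at (t + 1))"
      using assms(2) by (simp add: DERIV_deriv_iff_real_differentiable)
    then have "((\<lambda>s. u (s + 1)) has_real_derivative deriv u (t + 1)) (at t)"
      by (simp add: DERIV_shift)
    then have "(u has_real_derivative deriv u (t + 1)) (at t)"
      using assms(1) by (simp add: periodic_def)
    then show ?thesis by (rule DERIV_imp_deriv[symmetric])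
  qed
  then show ?thesis by (simp add: periodic_def)
qed

lift_definition c1_c0 :: "c1 \<Rightarrow> c0" is "\<lambda>u. u"
  by (auto simp: continuous_on_eq_continuous_at intro!: differentiable_imp_continuous_within)

lift_definition c1_deriv :: "c1 \<Rightarrow> c0" is deriv
  by (auto intro: periodic_deriv)

lemma c1_has_deriv: "(Rep_c1 u has_real_derivative Rep_c0 (c1_deriv u) t) (at t)"
  using Rep_c1[of u] by (simp add: c1_deriv.rep_eq DERIV_deriv_iff_real_differentiable)

lemma c1I:
  assumes "periodic g" "\<And>t. (g has_real_derivative h t) (at t)" "continuous_on UNIV h"
  shows "periodic g \<and> (\<forall>t. g differentiable at t) \<and> continuous_on UNIV (deriv g)"
proof -
  have "deriv g = h" using assms(2) by (auto intro: DERIV_imp_deriv)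
  then show ?thesis using assms by (auto simp: real_differentiable_def)
qed

lemma c1_deriv_eqI:
  assumes "\<And>t. (Rep_c1 u has_real_derivative Rep_c0 g t) (at t)"
  shows "c1_deriv u = g"
  using assms by (simp add: Rep_c0_inject[symmetric] fun_eq_iff c1_deriv.rep_eq DERIV_imp_deriv)

instantiation c1 :: real_normed_vector
begin

lift_definition zero_c1 :: c1 is "\<lambda>_. 0"
  by (simp add: periodic_def)

lift_definition plus_c1 :: "c1 \<Rightarrow> c1 \<Rightarrow> c1" is "\<lambda>u v t. u t + v t"
proof (elim conjE)
  fix u v :: "real \<Rightarrow> real"
  assume *: "periodic u" "\<forall>t. u differentiable at t" "continuous_on UNIV (deriv u)"
    "periodic v" "\<forall>t. v differentiable at t" "continuous_on UNIV (deriv v)"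
  then show "periodic (\<lambda>t. u t + v t) \<and> (\<forall>t. (\<lambda>t. u t + v t) differentiable at t)
      \<and> continuous_on UNIV (deriv (\<lambda>t. u t + v t))"
    by (intro c1I[where h = "\<lambda>t. deriv u t + deriv v t"] derivative_intros continuous_intros)
       (auto simp: periodic_def DERIV_deriv_iff_real_differentiable)
qed

lift_definition scaleR_c1 :: "real \<Rightarrow> c1 \<Rightarrow> c1" is "\<lambda>c u t. c * u t"
proof (elim conjE)
  fix c and u :: "real \<Rightarrow> real"
  assume *: "periodic u" "\<forall>t. u differentiable at t" "continuous_on UNIV (deriv u)"
  then show "periodic (\<lambda>t. c * u t) \<and> (\<forall>t. (\<lambda>t. c * u t) differentiable at t)
      \<and> continuous_on UNIV (deriv (\<lambda>t. c * u t))"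
    by (intro c1I[where h = "\<lambda>t. c * deriv u t"] DERIV_cmult continuous_intros)
       (auto simp: periodic_def DERIV_deriv_iff_real_differentiable)
qed

definition uminus_c1 :: "c1 \<Rightarrow> c1" where "uminus_c1 u = (-1) *\<^sub>R u"
definition minus_c1 :: "c1 \<Rightarrow> c1 \<Rightarrow> c1" where "minus_c1 u v = u + (-1) *\<^sub>R v"
definition norm_c1 :: "c1 \<Rightarrow> real" where "norm_c1 u = norm (c1_c0 u) + norm (c1_deriv u)"
definition dist_c1 :: "c1 \<Rightarrow> c1 \<Rightarrow> real" where "dist_c1 u v = norm (u - v)"
definition sgn_c1 :: "c1 \<Rightarrow> c1" where "sgn_c1 u = inverse (norm u) *\<^sub>R u"
definition uniformity_c1 :: "(c1 \<times> c1) filter" where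
  "uniformity_c1 = (INF e\<in>{0<..}. principal {(u, v). dist u v < e})"
definition open_c1 :: "c1 set \<Rightarrow> bool" where
  "open_c1 S \<longleftrightarrow> (\<forall>u\<in>S. \<forall>\<^sub>F (u', v) in uniformity. u' = u \<longrightarrow> v \<in> S)"

lemma c1_deriv_add: "c1_deriv (u + v) = c1_deriv u + c1_deriv v"
  by (rule c1_deriv_eqI, unfold plus_c1.rep_eq plus_c0.rep_eq)
     (intro DERIV_add c1_has_deriv)

lemma c1_deriv_scaleR: "c1_deriv (c *\<^sub>R u) = c *\<^sub>R c1_deriv u"
  by (rule c1_deriv_eqI, unfold scaleR_c1.rep_eq scaleR_c0.rep_eq)
     (intro DERIV_cmult c1_has_deriv)

lemma c1_c0_add: "c1_c0 (u + v) = c1_c0 u + c1_c0 v"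
  by transfer simp

lemma c1_c0_scaleR: "c1_c0 (c *\<^sub>R u) = c *\<^sub>R c1_c0 u"
  by transfer simp

lemma c1_c0_eq_0: "c1_c0 u = 0 \<longleftrightarrow> u = 0"
  by transfer simp

instance
proof
  fix a b c :: c1 and r s :: real
  show "a + b + c = a + (b + c)" by transfer (simp add: add.assoc)
  show "a + b = b + a" by transfer (simp add: add.commute)
  show "0 + a = a" by transfer simp
  show "- a + a = 0" unfolding uminus_c1_def by transfer simp
  show "a - b = a + - b" by (simp add: minus_c1_def uminus_c1_def)
  show "r *\<^sub>R (a + b) = r *\<^sub>R a + r *\<^sub>R b" by transfer (simp add: distrib_left)
  show "(r + s) *\<^sub>R a = r *\<^sub>R a + s *\<^sub>R a" by transfer (simp add: distrib_right)
  show "r *\<^sub>R s *\<^sub>R a = (r * s) *\<^sub>R a" by transfer (simp add: mult.assoc)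
  show "1 *\<^sub>R a = a" by transfer simp
  have z: "c1_deriv 0 = 0"
    by (rule c1_deriv_eqI) (simp add: zero_c1.rep_eq zero_c0.rep_eq)
  show "norm a = 0 \<longleftrightarrow> a = 0"
    using c1_c0_eq_0[of a] z by (auto simp: norm_c1_def add_nonneg_eq_0_iff)
  show "norm (a + b) \<le> norm a + norm b"
    using norm_triangle_ineq[of "c1_c0 a" "c1_c0 b"] norm_triangle_ineq[of "c1_deriv a" "c1_deriv b"]
    by (simp add: norm_c1_def c1_deriv_add c1_c0_add)
  show "norm (r *\<^sub>R a) = \<bar>r\<bar> * norm a"
    by (simp add: norm_c1_def c1_deriv_scaleR c1_c0_scaleR distrib_left)
qed (simp_all add: dist_c1_def sgn_c1_def uniformity_c1_def open_c1_def)

end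


subsection \<open>The two pairs \<open>(B\<^sup>1, B\<^sup>0)\<close>\<close>

text \<open>
  The data of a pair \<open>(B\<^sup>1, B\<^sup>0)\<close>: pointwise values of elements of \<open>B\<^sup>1\<close>, the derivative
  \<open>B\<^sup>1 \<rightarrow> B\<^sup>0\<close>, the inclusion into \<open>B\<^sup>0\<close> of the continuous periodic functions (its value at any
  other function is irrelevant), and the average on \<open>B\<^sup>0\<close>.
\<close>

record ('b1, 'b0) circle_pair =
  val :: "'b1 \<Rightarrow> real \<Rightarrow> real"
  der :: "'b1 \<Rightarrow> 'b0"
  incl :: "(real \<Rightarrow> real) \<Rightarrow> 'b0"
  mean :: "'b0 \<Rightarrow> real"

definition sobolev_pair :: "(h1, l2) circle_pair" where
  "sobolev_pair = \<lparr>val = Rep_h1, der = h1_deriv, incl = abs_l2, mean = l2_mean\<rparr>"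

definition classical_pair :: "(c1, c0) circle_pair" where
  "classical_pair = \<lparr>val = Rep_c1, der = c1_deriv, incl = Abs_c0,
     mean = (\<lambda>g. \<integral>t. Rep_c0 g t \<partial>circ)\<rparr>"


subsection \<open>Hypotheses on the nonlinearity\<close>

text \<open>
  The domain is finite-dimensional, so continuity of \<open>x \<mapsto> Dg(x) h\<close> for each fixed \<open>h\<close> is
  continuity of \<open>Dg\<close> in operator norm, and \<open>Ck n\<close> is the usual class \<open>C\<^sup>n\<close>.
\<close>

primrec Ck :: "nat \<Rightarrow> ('a::euclidean_space \<Rightarrow> real) \<Rightarrow> bool" where
  "Ck 0 g \<longleftrightarrow> continuous_on UNIV g"
| "Ck (Suc n) g \<longleftrightarrow> (\<forall>x. g differentiable at x) \<and>
     (\<forall>h. Ck n (\<lambda>x. frechet_derivative g (at x) h))"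

definition smooth :: "('a::euclidean_space \<Rightarrow> real) \<Rightarrow> bool" where
  "smooth g \<longleftrightarrow> (\<forall>n. Ck n g)"

definition D2 :: "(real \<Rightarrow> real \<Rightarrow> real) \<Rightarrow> real \<Rightarrow> real \<Rightarrow> real" where
  "D2 f t x = deriv (\<lambda>y. f t y) x"

text \<open>The half-line \<open>I\<close> is \<open>{0..}\<close> for \<open>+\<infinity>\<close> and \<open>{..0}\<close> for \<open>-\<infinity>\<close>.\<close>

definition wild_on :: "real set \<Rightarrow> (real \<Rightarrow> real \<Rightarrow> real) \<Rightarrow> bool" where
  "wild_on I f \<longleftrightarrow>
     (\<integral>\<^sup>+s\<in>I. ennreal (1 / max 1 (SUP t. f t s)) \<partial>lborel) < \<infinity> \<and>
     (\<integral>\<^sup>+s\<in>I. ennreal (1 / max 1 (SUP t. - f t s)) \<partial>lborel) < \<infinity>"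

definition tame :: "(real \<Rightarrow> real \<Rightarrow> real) \<Rightarrow> bool" where
  "tame f \<longleftrightarrow> \<not> wild_on {0..} f \<and> \<not> wild_on {..0} f"


subsection \<open>Differential calculus on \<open>B\<^sup>1\<close> and \<open>B\<^sup>0\<close>\<close>

definition regular_value :: "('a::real_normed_vector \<Rightarrow> real) \<Rightarrow> real \<Rightarrow> bool" where
  "regular_value g c \<longleftrightarrow> (\<forall>x. g x = c \<longrightarrow> (\<exists>D. (g has_derivative D) (at x) \<and> surj D))"

text \<open>\<open>surj_deriv g n x\<close>: the derivative at \<open>x\<close> of \<open>(g 1, \<dots>, g n)\<close> is onto \<open>\<real>\<^sup>n\<close>.\<close>

definition surj_deriv :: "(nat \<Rightarrow> 'a::real_normed_vector \<Rightarrow> real) \<Rightarrow> nat \<Rightarrow> 'a \<Rightarrow> bool" where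
  "surj_deriv g n x \<longleftrightarrow>
     (\<exists>D. (\<forall>j\<in>{1..n}. (g j has_derivative D j) (at x)) \<and>
          (\<forall>y :: nat \<Rightarrow> real. \<exists>h. \<forall>j\<in>{1..n}. D j h = y j))"

definition lie :: "('a \<Rightarrow> 'a) \<Rightarrow> ('a::real_normed_vector \<Rightarrow> real) \<Rightarrow> 'a \<Rightarrow> real" where
  "lie X \<xi> u = frechet_derivative \<xi> (at u) (X u)"


subsection \<open>The maps \<open>F\<close>, \<open>\<Phi>\<close>, \<open>\<Psi>\<close>, \<open>\<phi>\<close> and the vector field \<open>w\<close>\<close>

definition kap :: "real \<Rightarrow> real" where
  "kap x = x - real_of_int \<lfloor>x\<rfloor> - 1 / 2"

definition wfield ::
    "('b1, 'b0) circle_pair \<Rightarrow> (real \<Rightarrow> real \<Rightarrow> real) \<Rightarrow> 'b1 \<Rightarrow> 'b1" where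
  "wfield P f u =
     inv (val P) (\<lambda>t. exp (- (\<integral>s. kap (s - t) * D2 f s (val P u s) \<partial>circ)))"

definition F_map :: "('b1, 'b0::plus) circle_pair \<Rightarrow> (real \<Rightarrow> real \<Rightarrow> real) \<Rightarrow> 'b1 \<Rightarrow> 'b0" where
  "F_map P f u = der P u + incl P (\<lambda>t. f t (val P u t))"

definition Phi_map :: "('b1, 'b0) circle_pair \<Rightarrow> (real \<Rightarrow> real \<Rightarrow> real) \<Rightarrow> 'b1 \<Rightarrow> real" where
  "Phi_map P f u = (\<integral>t. f t (val P u t) \<partial>circ)"

definition D2_integral :: "('b1, 'b0) circle_pair \<Rightarrow> (real \<Rightarrow> real \<Rightarrow> real) \<Rightarrow> 'b1 \<Rightarrow> real" where
  "D2_integral P f u = (\<integral>t. D2 f t (val P u t) \<partial>circ)"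

definition cst :: "('b1, 'b0) circle_pair \<Rightarrow> real \<Rightarrow> 'b0" where
  "cst P c = incl P (\<lambda>_. c)"

definition Psi_map ::
    "('b1, 'b0::real_normed_vector) circle_pair \<Rightarrow> (real \<Rightarrow> real \<Rightarrow> real) \<Rightarrow> 'b1 \<Rightarrow> 'b0" where
  "Psi_map P f u =
     F_map P f u - cst P (mean P (F_map P f u)) + cst P (\<integral>t. val P u t \<partial>circ)"

text \<open>
  \<open>B\<^sup>0\<close> is the sum of its average-zero subspace and the constants, \<open>x\<close> having components
  \<open>tilde P x\<close> and \<open>mean P x\<close>.  The second component of \<open>F \<circ> \<Psi>\<^sup>-\<^sup>1\<close> is \<open>phi P f v s\<close>, where \<open>v\<close> has
  average zero, and \<open>D2_phi P f j v s\<close> is its \<open>j\<close>-th derivative in \<open>s\<close>.  In \<open>morin\<close>, total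
  derivatives of functions of \<open>(v, s)\<close> are taken on \<open>B\<^sup>0\<close> via \<open>z \<mapsto> (tilde P z, mean P z)\<close>.
\<close>

definition tilde :: "('b1, 'b0::real_normed_vector) circle_pair \<Rightarrow> 'b0 \<Rightarrow> 'b0" where
  "tilde P x = x - cst P (mean P x)"

definition phi ::
    "('b1, 'b0::real_normed_vector) circle_pair \<Rightarrow> (real \<Rightarrow> real \<Rightarrow> real) \<Rightarrow> 'b0 \<Rightarrow> real \<Rightarrow> real" where
  "phi P f v s = mean P (F_map P f (inv (Psi_map P f) (v + cst P s)))"

definition D2_phi ::
    "('b1, 'b0::real_normed_vector) circle_pair \<Rightarrow> (real \<Rightarrow> real \<Rightarrow> real) \<Rightarrow> nat \<Rightarrow>
      'b0 \<Rightarrow> real \<Rightarrow> real" where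
  "D2_phi P f j v s = (deriv ^^ j) (phi P f v) s"

definition morin ::
    "('b1, 'b0::real_normed_vector) circle_pair \<Rightarrow> (real \<Rightarrow> real \<Rightarrow> real) \<Rightarrow> nat \<Rightarrow> 'b1 \<Rightarrow> bool" where
  "morin P f k u \<longleftrightarrow>
     (let x = Psi_map P f u in
       (\<forall>j\<in>{1..k}. D2_phi P f j (tilde P x) (mean P x) = 0) \<and>
       D2_phi P f (k + 1) (tilde P x) (mean P x) \<noteq> 0 \<and>
       surj_deriv (\<lambda>j z. D2_phi P f j (tilde P z) (mean P z)) (k - 1) x)"

end

theory Submission
  imports Defs
begin

text \<open>
  Both pairs are reduced to the Banach algebra of continuous functions on the circle.  Let \<open>J\<close> embed
  \<open>B\<^sup>1\<close> into it, and let \<open>k\<^sub>1\<close> map a function to the zero-average primitive of its zero-average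
  part, which is the convolution with \<open>\<kappa>\<close> in the definition of \<open>w\<close>.  Inverting \<open>u \<mapsto> u' + \<integral>u\<close> turns
  \<open>\<Psi>\<close> into \<open>G(u) = u + k\<^sub>1(f(\<cdot>, u))\<close>, a perturbation of the identity with derivative
  \<open>h \<mapsto> h + k\<^sub>1(D\<^sub>2f(\<cdot>, u) h)\<close>.  This derivative is invertible by explicit solution of a linear
  periodic equation, so the contraction principle makes \<open>\<Psi>\<close> an injective local diffeomorphism.

  Let \<open>V\<close> be the field with \<open>D\<Psi>(u) V\<^sub>u = 1\<close>; then \<open>D\<^sub>2\<^sup>j\<phi> \<circ> \<Psi> = V\<^sup>j\<Phi>\<close>.  Both \<open>w\<Phi>\<close> and \<open>V\<Phi>\<close> are positive
  multiples of \<open>\<delta>(u) = \<integral>D\<^sub>2f(t, u(t)) dt\<close>, and \<open>w = m V + \<delta> Z\<close> with \<open>m > 0\<close> and \<open>Z\<close> smooth.  By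
  induction \<open>w\<^sup>j\<Phi>\<close> is a nonvanishing multiple of \<open>V\<^sup>j\<Phi>\<close> modulo the ideal generated by
  \<open>V\<Phi>, \<dots>, V\<^sup>j\<^sup>-\<^sup>1\<Phi>\<close>, and each of the three conditions in the definition of a Morin singularity
  passes between the two sequences.
\<close>

subsection \<open>The Banach algebra of continuous functions\<close>

text \<open>Two obstacles shape the reduction: superposition is in general not differentiable on
  L^2, and the image of \<open>J\<close> is not closed in the sup norm. So all calculus takes place
  in \<open>c0\<close>, and regularity is recovered afterwards: an equation h = J a - k1 c puts h
  back into the image of \<open>J\<close>. Condition (c) is therefore always tested on directions
  \<open>J h\<close>.

  The splitting of w comes from w' = (\<delta> - g) w with g = D_2 f(t, u(t)). In integral form, the
  derivative of \<open>G\<close> sends w to avg(w) + \<delta> k1(w), so its inverse yields w =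
  avg(w) V + \<delta> Z. The field V solves V' = c - g V with c = V\<Phi>. Averaging the first
  equation gives w\<Phi> = \<delta> avg(w); averaging the second against an integrating factor makes
  V\<Phi> a positive multiple of \<delta>.

  Positivity of V and injectivity of \<open>G\<close> and of its derivative rest on one fact: if d
  is periodic, has a zero and satisfies d' = c + O(d), then d = 0 and c = 0. It matters that c, an
  average of the unknown, is not prescribed.\<close>

lemma periodic_c0: "periodic (Rep_c0 g)"
  using Rep_c0[of g] by simp

lemma c0_plus_1: "Rep_c0 g (t + 1) = Rep_c0 g t"
  using periodic_c0[of g] by (simp add: periodic_def)

lemma continuous_on_c0:
  "continuous_on A (\<lambda>t. Rep_c0 g t)"
  using Rep_c0[of g] by (auto elim: continuous_on_subset)

lemma c0_eqI: "(\<And>t. Rep_c0 g t = Rep_c0 h t) \<Longrightarrow> g = h"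
  by (simp add: Rep_c0_inject[symmetric] fun_eq_iff)

lemma Rep_Abs_c0:
  "periodic g \<Longrightarrow> continuous_on UNIV g \<Longrightarrow> Rep_c0 (Abs_c0 g) = g"
  by (simp add: Abs_c0_inverse)

instantiation c0 :: "{comm_ring_1, real_normed_algebra_1}"
begin

lift_definition one_c0 :: c0 is "\<lambda>_. 1"
  by (simp add: periodic_def)
lift_definition times_c0 :: "c0 \<Rightarrow> c0 \<Rightarrow> c0" is "\<lambda>g h t. g t * h t"
  by (auto simp: periodic_def intro!: continuous_intros)

instance
proof
  fix a b c :: c0 and r :: real
  show "a * b * c = a * (b * c)" by transfer (simp add: mult.assoc)
  show "a * b = b * a" by transfer (simp add: mult.commute)
  show "1 * a = a" by transfer simp
  show "(a + b) * c = a * c + b * c" by transfer (simp add: distrib_right)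
  show "a * (b + c) = a * b + a * c" by transfer (simp add: distrib_left)
  show "a * 1 = a" by transfer simp
  show "(0::c0) \<noteq> 1" by transfer (simp add: fun_eq_iff)
  show "r *\<^sub>R a * b = r *\<^sub>R (a * b)" by transfer (simp add: mult.assoc)
  show "a * r *\<^sub>R b = r *\<^sub>R (a * b)" by transfer (simp add: mult.left_commute)
  show "norm (a * b) \<le> norm a * norm b"
    by (rule c0_norm_le) (simp add: times_c0.rep_eq abs_mult mult_mono c0_le_norm)
  show "norm (1::c0) = 1"
    by (simp add: norm_c0_def one_c0.rep_eq)
qed

end

lemma Rep_c0_of_real [simp]: "Rep_c0 (of_real c) t = c"
  by (simp add: of_real_def scaleR_c0.rep_eq one_c0.rep_eq)

lemmas Rep_c0_simps [simp] =
  zero_c0.rep_eq plus_c0.rep_eq minus_c0.rep_eq uminus_c0.rep_eq scaleR_c0.rep_eq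
  one_c0.rep_eq times_c0.rep_eq

text \<open>Completeness feeds the fixed point argument of
  \<open>local_surjectivity\<close>.\<close>

instance c0 :: banach
proof
  fix X :: "nat \<Rightarrow> c0"
  assume X: "Cauchy X"
  have bound: "dist (Rep_c0 g t) (Rep_c0 h t) \<le> dist g h" for g h t
    using c0_le_norm[of "g - h" t] by (simp add: dist_norm)
  have "uniformly_Cauchy_on UNIV (\<lambda>n. Rep_c0 (X n))"
    using X bound unfolding uniformly_Cauchy_on_def Cauchy_def by (meson le_less_trans)
  then obtain l where l: "uniform_limit UNIV (\<lambda>n. Rep_c0 (X n)) l sequentially"
    using Cauchy_uniformly_convergent unfolding uniformly_convergent_on_def by blast
  have lt: "(\<lambda>n. Rep_c0 (X n) t) \<longlonglongrightarrow> l t" for t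
    using tendsto_uniform_limitI[OF l, of t] by simp
  have "continuous_on UNIV l"
    by (rule uniform_limit_theorem[OF _ l]) (simp_all add: continuous_on_c0)
  moreover have "periodic l"
    unfolding periodic_def
  proof
    fix t
    show "l (t + 1) = l t"
      using lt[of "t + 1"] lt[of t] LIMSEQ_unique by (simp add: c0_plus_1)
  qed
  ultimately have rep: "Rep_c0 (Abs_c0 l) = l" by (intro Rep_Abs_c0)
  have "X \<longlonglongrightarrow> Abs_c0 l"
  proof (rule metric_LIMSEQ_I)
    fix r :: real assume "0 < r"
    then have "\<forall>\<^sub>F n in sequentially. \<forall>t\<in>UNIV. dist (Rep_c0 (X n) t) (l t) < r / 2"
      using l unfolding uniform_limit_iff by (meson half_gt_zero)
    then obtain N where N: "\<And>n t. n \<ge> N \<Longrightarrow> dist (Rep_c0 (X n) t) (l t) < r / 2"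
      by (auto simp: eventually_sequentially)
    have "dist (X n) (Abs_c0 l) < r" if "n \<ge> N" for n
    proof -
      have "norm (X n - Abs_c0 l) \<le> r / 2"
        using N[OF that] by (intro c0_norm_le) (simp add: rep dist_real_def less_imp_le)
      then show ?thesis using \<open>0 < r\<close> by (simp add: dist_norm)
    qed
    then show "\<exists>N. \<forall>n\<ge>N. dist (X n) (Abs_c0 l) < r" by blast
  qed
  then show "convergent X" by (rule convergentI)
qed

lemma c0_attains_sup: "\<exists>s\<in>{0..1}. \<forall>t. Rep_c0 g t \<le> Rep_c0 g s"
proof -
  have "\<exists>s\<in>{0..1}. \<forall>t\<in>{0..1}. Rep_c0 g t \<le> Rep_c0 g s"
    by (rule continuous_attains_sup) (auto intro: continuous_on_c0)
  then obtain s where s: "s \<in> {0..1}" "\<And>t. t \<in> {0..1} \<Longrightarrow> Rep_c0 g t \<le> Rep_c0 g s" by blast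
  have "Rep_c0 g t \<le> Rep_c0 g s" for t
  proof -
    have "Rep_c0 g t \<in> Rep_c0 g ` {0..1}"
      using periodic_range[OF periodic_c0, of g] by blast
    then show ?thesis using s(2) by auto
  qed
  then show ?thesis using s(1) by blast
qed

subsection \<open>Integration over the circle\<close>

text \<open>Only the null endpoint 1 separates \<open>circ\<close> from Lebesgue measure on [0,1];
  this opens the way to the fundamental theorem of calculus.\<close>

lemma has_bochner_integral_circ:
  fixes h :: "real \<Rightarrow> real"
  assumes "continuous_on {0..1} h"
  shows "has_bochner_integral circ h (integral {0..1} h)" 
proof -
  have "set_integrable lborel {0..1} h"
    using borel_integrable_compact[OF _ assms] by (simp add: set_integrable_def)
  then have int: "set_integrable lborel {0..<1} h"
    by (rule set_integrable_subset) auto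
  have "(LINT t:{0..<1}|lborel. h t) = (LINT t:{0..1}|lborel. h t)"
    unfolding set_lebesgue_integral_def
    by (rule integral_discrete_difference[where X = "{1}"]) (auto simp: indicator_def)
  also have "\<dots> = integral {0..1} h"
    by (rule set_borel_integral_eq_integral) fact
  finally have eq: "(LINT t:{0..<1}|lborel. h t) = integral {0..1} h" .
  have "integrable circ h"
    using int by (simp add: circ_def integrable_restrict_space set_integrable_def)
  moreover have "integral\<^sup>L circ h = integral {0..1} h"
    using eq by (simp add: circ_def integral_restrict_space set_lebesgue_integral_def)
  ultimately show ?thesis by (simp add: has_bochner_integral_iff)
qed

lemma continuous_integrable_circ:
  "continuous_on {0..1} h \<Longrightarrow> integrable circ (h :: real \<Rightarrow> real)"
  using has_bochner_integral_circ by (auto simp: has_bochner_integral_iff)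

lemma integral_circ_FTC:
  assumes "continuous_on {0..1} h"
    and "\<And>t. t \<in> {0..1} \<Longrightarrow> (H has_real_derivative h t) (at t within {0..1})"
  shows "integral\<^sup>L circ h = H 1 - H 0"
proof -
  have "(h has_integral H 1 - H 0) {0..1}"
    using assms(2) by (intro fundamental_theorem_of_calculus)
      (auto simp: has_real_derivative_iff_has_vector_derivative)
  then show ?thesis
    using has_bochner_integral_circ[OF assms(1)]
    by (auto simp: has_bochner_integral_iff integral_unique)
qed

lemma continuous_has_antiderivative:
  fixes h :: "real \<Rightarrow> real"
  assumes "continuous_on UNIV h"
  obtains H where "\<And>t. (H has_real_derivative h t) (at t)"
  using einterval_antiderivative[of "-\<infinity>" \<infinity> h] assms
  by (auto simp: continuous_on_eq_continuous_at has_real_derivative_iff_has_vector_derivative)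

definition avg :: "c0 \<Rightarrow> real" where
  "avg g = (\<integral>t. Rep_c0 g t \<partial>circ)"

lemma integrable_c0 [simp]: "integrable circ (Rep_c0 g)"
  by (rule continuous_integrable_circ) (rule continuous_on_c0)

lemma avg_abs_le: "\<bar>avg g\<bar> \<le> norm g"
proof -
  have "\<bar>avg g\<bar> \<le> (\<integral>t. \<bar>Rep_c0 g t\<bar> \<partial>circ)"
    unfolding avg_def by (rule integral_abs_bound)
  also have "\<dots> \<le> (\<integral>t. norm g \<partial>circ)"
    by (intro integral_mono) (auto simp: c0_le_norm)
  finally show ?thesis by (simp add: measure_circ)
qed

lemma bounded_linear_avg: "bounded_linear avg"
  by (rule bounded_linear_intro[where K = 1])
     (use avg_abs_le in \<open>auto simp: avg_def\<close>)

lemmas linear_avg = bounded_linear.linear[OF bounded_linear_avg]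
lemmas avg_add = linear_add[OF linear_avg]
lemmas avg_diff = linear_diff[OF linear_avg]
lemmas avg_minus = linear_neg[OF linear_avg]
lemmas avg_scaleR = linear_scale[OF linear_avg, simplified]

lemma avg_of_real [simp]: "avg (of_real c) = c"
  by (simp add: avg_def measure_circ)

lemma avg_1 [simp]: "avg 1 = 1"
  using avg_of_real[of 1] by simp

lemma avg_of_real_mult [simp]: "avg (of_real c * g) = c * avg g"
  by (simp add: of_real_def avg_scaleR)

lemma avg_pos:
  assumes "\<And>t. 0 < Rep_c0 g t"
  shows "0 < avg g"
proof -
  obtain s where s: "\<And>t. Rep_c0 (- g) t \<le> Rep_c0 (- g) s"
    using c0_attains_sup by blast
  have "(\<integral>t. Rep_c0 g s \<partial>circ) \<le> avg g"
    unfolding avg_def using s by (intro integral_mono) auto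
  then show ?thesis using assms[of s] by (simp add: measure_circ)
qed

text \<open>A function without zeros has constant sign by connectedness, hence a nonzero average.
  This supplies the starting zero that the crossing lemmas require.\<close>

lemma avg_0_has_zero:
  assumes "avg g = 0"
  obtains t where "Rep_c0 g t = 0"
proof -
  have "\<exists>t. Rep_c0 g t = 0"
  proof (rule ccontr)
    assume nz: "\<nexists>t. Rep_c0 g t = 0"
    have conn: "connected (range (Rep_c0 g))"
      by (intro connected_continuous_image continuous_on_c0 connected_UNIV)
    have "(\<forall>t. 0 < Rep_c0 g t) \<or> (\<forall>t. 0 < Rep_c0 (- g) t)"
    proof (rule ccontr)
      assume "\<not> ?thesis"
      then obtain s t where "Rep_c0 g s \<le> 0" "0 \<le> Rep_c0 g t" by (auto simp: not_less)
      then have "0 \<in> range (Rep_c0 g)"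
        using conn unfolding connected_iff_interval by blast
      then show False using nz by auto
    qed
    then have "0 < avg g \<or> 0 < avg (- g)" using avg_pos by blast
    then show False using assms by (auto simp: avg_minus)
  qed
  then show ?thesis using that by blast
qed

lemma avg_deriv_0:
  assumes "\<And>t. (Rep_c0 p has_real_derivative Rep_c0 q t) (at t)"
  shows "avg q = 0"
proof -
  have "avg q = Rep_c0 p 1 - Rep_c0 p 0"
    unfolding avg_def
    by (rule integral_circ_FTC) (auto intro: continuous_on_c0 DERIV_subset assms)
  then show ?thesis using c0_plus_1[of p 0] by simp
qed

lemma c0_eq_if_same_deriv:
  assumes "\<And>t. (Rep_c0 p has_real_derivative d t) (at t)"
    and "\<And>t. (Rep_c0 q has_real_derivative d t) (at t)"
    and "avg p = avg q"
  shows "p = q"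
proof -
  have "((\<lambda>t. Rep_c0 p t - Rep_c0 q t) has_real_derivative 0) (at t)" for t
    using DERIV_diff[OF assms(1)[of t] assms(2)[of t]] by simp
  then have const: "Rep_c0 (p - q) t = Rep_c0 (p - q) s" for s t
    using DERIV_isconst_all[of "\<lambda>t. Rep_c0 p t - Rep_c0 q t" t s] by simp
  obtain c where c: "p - q = of_real c"
  proof
    show "p - q = of_real (Rep_c0 (p - q) 0)"
      by (rule c0_eqI, subst Rep_c0_of_real, rule const)
  qed
  have "avg (p - q) = 0"
    using assms(3) by (simp add: avg_diff)
  then show ?thesis
    using c by simp
qed

lemma integral_circ_indicator_FTC:
  assumes t: "t \<in> {0..1}" and h: "continuous_on {0..1} h"
    and H: "\<And>s. s \<in> {0..1} \<Longrightarrow> (H has_real_derivative h s) (at s within {0..1})"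
  shows "(\<integral>s. indicator {0..<t} s * h s \<partial>circ) = H t - H 0"
proof -
  have ht: "continuous_on {0..t} h"
    using t by (intro continuous_on_subset[OF h]) auto
  have "(\<integral>s. indicator {0..<t} s * h s \<partial>circ) = (LINT s|lborel. indicator {0..<t} s * h s)"
    unfolding circ_def
    by (subst integral_restrict_space)
       (use t in \<open>auto intro!: Bochner_Integration.integral_cong simp: indicator_def\<close>)
  also have "\<dots> = (LINT s:{0..t}|lborel. h s)"
    unfolding set_lebesgue_integral_def
    by (rule integral_discrete_difference[where X = "{t}"]) (auto simp: indicator_def)
  also have "\<dots> = integral {0..t} h"
    using borel_integrable_compact[OF _ ht]
    by (intro set_borel_integral_eq_integral) (simp add: set_integrable_def)
  also have "(h has_integral H t - H 0) {0..t}"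
    using t H by (intro fundamental_theorem_of_calculus)
      (auto simp: has_real_derivative_iff_has_vector_derivative[symmetric]
        intro: DERIV_subset[where s = "{0..1}"])
  then have "integral {0..t} h = H t - H 0" by (rule integral_unique)
  finally show ?thesis .
qed

subsection \<open>The zero-average primitive\<close>

text \<open>The kernel is the periodic Green function of d/dt: in t it has slope -1, a unit jump at
  t = s and average zero, whence \<open>k1_deriv\<close> and \<open>avg_k1\<close>.\<close>

definition k1 :: "c0 \<Rightarrow> c0" where
  "k1 g = Abs_c0 (\<lambda>t. \<integral>s. kap (s - t) * Rep_c0 g s \<partial>circ)"

text \<open>On the fundamental domain the sawtooth is affine plus a unit jump, so the convolution
  splits into two elementary integrals.\<close>

lemma kap_cases:
  assumes "s \<in> {0..<1}" "t \<in> {0..<1}"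
  shows "kap (s - t) = s - t - 1 / 2 + indicator {0..<t} s"
proof (cases "s < t")
  case True
  then have "\<lfloor>s - t\<rfloor> = -1" using assms by (intro floor_unique) auto
  then show ?thesis using True assms by (simp add: kap_def)
next
  case False
  then have "\<lfloor>s - t\<rfloor> = 0" using assms by (intro floor_unique) auto
  then show ?thesis using False assms by (simp add: kap_def)
qed

lemma abs_kap_le: "\<bar>kap x\<bar> \<le> 1 / 2"
  unfolding kap_def by linarith

lemma kap_add_1: "kap (x - (t + 1)) = kap (x - t)"
proof -
  have "\<lfloor>x - (t + 1)\<rfloor> = \<lfloor>x - t\<rfloor> - 1" by linarith
  then show ?thesis by (simp add: kap_def)
qed

lemma kap_integrable: "integrable circ (\<lambda>s. kap (s - t) * Rep_c0 g s)"
proof (rule circ.integrable_const_bound[where B = "1 / 2 * norm g"])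
  have [measurable]: "(\<lambda>s. kap (s - t)) \<in> borel_measurable circ"
    unfolding kap_def by (rule borel_measurable_circ) measurable
  show "(\<lambda>s. kap (s - t) * Rep_c0 g s) \<in> borel_measurable circ"
    using borel_measurable_integrable[OF integrable_c0[of g]] by measurable
  show "AE s in circ. norm (kap (s - t) * Rep_c0 g s) \<le> 1 / 2 * norm g"
    unfolding real_norm_def abs_mult
    by (intro always_eventually allI mult_mono abs_kap_le c0_le_norm) auto
qed

text \<open>On [0,1) the affine part is integrated by parts and the jump part is a primitive;
  outside, both sides are periodic in t.\<close>

lemma kap_integral:
  assumes P: "\<And>t. (P has_real_derivative Rep_c0 g t) (at t)"
    and PP: "\<And>t. (PP has_real_derivative P t) (at t)"
  shows "(\<integral>s. kap (s - t) * Rep_c0 g s \<partial>circ)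
    = P t - t * avg g + avg g / 2 - (PP 1 - PP 0)"
proof -
  define I where "I t = (\<integral>s. kap (s - t) * Rep_c0 g s \<partial>circ)" for t
  define R where "R t = P t - t * avg g + avg g / 2 - (PP 1 - PP 0)" for t
  have avg: "avg g = P 1 - P 0"
    unfolding avg_def
    by (rule integral_circ_FTC) (auto intro: continuous_on_c0 DERIV_subset P)
  have fund: "I t = R t" if t: "t \<in> {0..<1}" for t
  proof -
    have "I t = (\<integral>s. (s - t - 1 / 2) * Rep_c0 g s + indicator {0..<t} s * Rep_c0 g s \<partial>circ)"
      unfolding I_def
    proof (rule Bochner_Integration.integral_cong[OF refl])
      fix s assume "s \<in> space circ"
      then have "kap (s - t) = s - t - 1 / 2 + indicator {0..<t} s"
        using t by (intro kap_cases) simp_all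
      then show "kap (s - t) * Rep_c0 g s = (s - t - 1 / 2) * Rep_c0 g s + indicator {0..<t} s * Rep_c0 g s"
        by (simp only: distrib_right)
    qed
    also have "\<dots> = (\<integral>s. (s - t - 1 / 2) * Rep_c0 g s \<partial>circ)
        + (\<integral>s. indicator {0..<t} s * Rep_c0 g s \<partial>circ)"
    proof (rule Bochner_Integration.integral_add)
      show "integrable circ (\<lambda>s. (s - t - 1 / 2) * Rep_c0 g s)"
        by (intro continuous_integrable_circ continuous_intros continuous_on_c0)
      show "integrable circ (\<lambda>s. indicator {0..<t} s * Rep_c0 g s)"
      proof (rule integrable_indicator_circ)
        have "integrable circ (\<lambda>t. (Rep_c0 g t)\<^sup>2)"
          by (intro continuous_integrable_circ continuous_intros continuous_on_c0)
        then show "square_integrable (Rep_c0 g)"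
          using borel_measurable_integrable[OF integrable_c0[of g]]
          by (simp add: square_integrable_def)
      qed
    qed
    also have "(\<integral>s. indicator {0..<t} s * Rep_c0 g s \<partial>circ) = P t - P 0"
      using t by (intro integral_circ_indicator_FTC continuous_on_c0 DERIV_subset[OF P]) auto
    also have "(\<integral>s. (s - t - 1 / 2) * Rep_c0 g s \<partial>circ)
        = ((1 - t - 1 / 2) * P 1 - PP 1) - ((0 - t - 1 / 2) * P 0 - PP 0)"
    proof (rule integral_circ_FTC)
      show "((\<lambda>s. (s - t - 1 / 2) * P s - PP s) has_real_derivative (s - t - 1 / 2) * Rep_c0 g s)
          (at s within {0..1})" for s
        by (rule DERIV_subset[of _ _ _ UNIV]) (auto intro!: derivative_eq_intros P PP)
    qed (intro continuous_intros continuous_on_c0)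
    finally show ?thesis by (simp add: R_def avg field_simps)
  qed
  have "periodic I" by (simp add: periodic_def I_def kap_add_1)
  moreover have "periodic R"
  proof -
    have "((\<lambda>t. P (t + 1) - P t) has_real_derivative Rep_c0 g (t + 1) - Rep_c0 g t) (at t)" for t
      by (intro DERIV_diff P) (use P[of "t + 1"] in \<open>simp add: DERIV_shift\<close>)
    then have "P (t + 1) - P t = P (0 + 1) - P 0" for t
      by (intro DERIV_isconst_all[of "\<lambda>t. P (t + 1) - P t"]) (simp add: c0_plus_1)
    \<comment> \<open>The gain of \<open>P\<close> over a period is exactly what
      \<open>- t * avg g\<close> removes.\<close>
    then have "P (t + 1) = P t + avg g" for t
      unfolding avg by (metis add_0 add.commute diff_add_cancel)
    then show ?thesis by (simp add: periodic_def R_def distrib_right)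
  qed
  moreover have "I (frac t) = R (frac t)"
    by (rule fund) (simp add: frac_lt_1)
  ultimately have "I t = R t"
    using periodic_of_int[of I "frac t" "\<lfloor>t\<rfloor>"] periodic_of_int[of R "frac t" "\<lfloor>t\<rfloor>"]
    by (simp add: frac_def)
  then show ?thesis by (simp add: I_def R_def)
qed

lemma
  shows Rep_c0_k1: "Rep_c0 (k1 g) t = (\<integral>s. kap (s - t) * Rep_c0 g s \<partial>circ)"
    and k1_deriv: "(Rep_c0 (k1 g) has_real_derivative Rep_c0 g t - avg g) (at t)"
    and avg_k1 [simp]: "avg (k1 g) = 0"
proof -
  obtain P where P: "\<And>t. (P has_real_derivative Rep_c0 g t) (at t)"
    using continuous_has_antiderivative[OF continuous_on_c0] by blast
  have "continuous_on UNIV P"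
    using P by (intro DERIV_continuous_on) auto
  then obtain PP where PP: "\<And>t. (PP has_real_derivative P t) (at t)"
    using continuous_has_antiderivative by blast
  obtain PPP where PPP: "\<And>t. (PPP has_real_derivative PP t) (at t)"
    using continuous_has_antiderivative[of PP] PP
    by (meson DERIV_continuous_on DERIV_subset top_greatest)
  define I where "I t = (\<integral>s. kap (s - t) * Rep_c0 g s \<partial>circ)" for t
  have I: "I = (\<lambda>t. P t - t * avg g + avg g / 2 - (PP 1 - PP 0))"
    unfolding I_def by (rule ext) (rule kap_integral[OF P PP])
  have dI: "(I has_real_derivative Rep_c0 g t - avg g) (at t)" for t
    unfolding I by (auto intro!: derivative_eq_intros P)
  have "periodic I" by (simp add: periodic_def I_def kap_add_1)
  moreover have contI: "continuous_on UNIV I"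
    using dI by (intro DERIV_continuous_on) auto
  ultimately have rep: "Rep_c0 (k1 g) = I"
    unfolding k1_def I_def by (intro Rep_Abs_c0)
  show "Rep_c0 (k1 g) t = (\<integral>s. kap (s - t) * Rep_c0 g s \<partial>circ)"
    by (simp add: rep I_def)
  show "(Rep_c0 (k1 g) has_real_derivative Rep_c0 g t - avg g) (at t)"
    unfolding rep by (rule dI)
  have avg: "avg g = P 1 - P 0"
    unfolding avg_def
    by (rule integral_circ_FTC) (auto intro: continuous_on_c0 DERIV_subset P)
  let ?H = "\<lambda>t. PP t - t\<^sup>2 / 2 * avg g + t * (avg g / 2 - (PP 1 - PP 0))"
  have "avg (k1 g) = ?H 1 - ?H 0"
    unfolding avg_def[of "k1 g"] rep
  proof (rule integral_circ_FTC[where H = ?H])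
    show "(?H has_real_derivative I t) (at t within {0..1})" for t
      by (rule DERIV_subset[of _ _ _ UNIV]) (auto intro!: derivative_eq_intros PP simp: I)
  qed (rule continuous_on_subset[OF contI], simp)
  then show "avg (k1 g) = 0" by simp
qed

lemma norm_k1_le: "norm (k1 g) \<le> norm g"
proof (rule c0_norm_le)
  fix t
  have "\<bar>Rep_c0 (k1 g) t\<bar> \<le> (\<integral>s. \<bar>kap (s - t) * Rep_c0 g s\<bar> \<partial>circ)"
    unfolding Rep_c0_k1 by (rule integral_abs_bound)
  also have "\<dots> \<le> (\<integral>s. norm g \<partial>circ)"
  proof (intro integral_mono)
    show "\<bar>kap (s - t) * Rep_c0 g s\<bar> \<le> norm g" for s
      using mult_mono[OF order_trans[OF abs_kap_le, of 1] c0_le_norm] by (simp add: abs_mult)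
  qed (auto simp: kap_integrable)
  finally show "\<bar>Rep_c0 (k1 g) t\<bar> \<le> norm g" by (simp add: measure_circ)
qed

lemma bounded_linear_k1: "bounded_linear k1"
proof (rule bounded_linear_intro[where K = 1])
  show "k1 (g + h) = k1 g + k1 h" for g h
    by (rule c0_eqI) (simp add: Rep_c0_k1 distrib_left kap_integrable)
  show "k1 (r *\<^sub>R g) = r *\<^sub>R k1 g" for r g
    by (rule c0_eqI) (simp add: Rep_c0_k1 mult.left_commute)
qed (simp add: norm_k1_le)

lemmas linear_k1 = bounded_linear.linear[OF bounded_linear_k1]
lemmas k1_add = linear_add[OF linear_k1]
lemmas k1_diff = linear_diff[OF linear_k1]
lemmas k1_minus = linear_neg[OF linear_k1]
lemmas k1_scaleR = linear_scale[OF linear_k1]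

lemma k1_of_real_mult: "k1 (of_real c * g) = of_real c * k1 g"
  by (simp add: of_real_def k1_scaleR)

text \<open>A periodic derivative has average zero, so \<open>k1\<close> integrates it without
  correction and only the constant is left to match.\<close>

lemma c0_eq_avg_plus_k1:
  assumes "\<And>t. (Rep_c0 p has_real_derivative Rep_c0 q t) (at t)"
  shows "p = of_real (avg p) + k1 q"
proof (rule c0_eq_if_same_deriv[OF assms])
  have "avg q = 0" by (rule avg_deriv_0) (rule assms)
  then show "(Rep_c0 (of_real (avg p) + k1 q) has_real_derivative Rep_c0 q t) (at t)" for t
    using DERIV_add[OF DERIV_const k1_deriv, of "avg p" q t] by (simp add: plus_c0.rep_eq[abs_def])
qed (simp add: avg_add)

lemma k1_of_real [simp]: "k1 (of_real c) = 0"
  using c0_eq_avg_plus_k1[of "k1 (of_real c)" 0] k1_deriv[of "of_real c"] bounded_linear_k1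
  by (simp add: linear_0 linear_k1)

subsection \<open>Periodic solutions of scalar equations\<close>

text \<open>If \<open>c \<noteq> 0\<close>, all zeros of \<open>d\<close> would be crossings in the same direction, which periodicity forbids.\<close>

lemma periodic_crossing_pos:
  fixes d \<eta> :: "real \<Rightarrow> real"
  assumes per: "periodic d" and d: "\<And>t. (d has_real_derivative \<eta> t) (at t)"
    and L: "\<And>t. \<bar>\<eta> t - c\<bar> \<le> L * \<bar>d t\<bar>" and t0: "d t0 = 0" and c: "0 < c"
  shows False
proof -
  have d1: "d (t0 + 1) = 0" using per t0 by (simp add: periodic_def)
  have cont: "continuous_on A d" for A
    using d by (meson DERIV_continuous_on DERIV_subset top_greatest)
  have nonneg: "0 \<le> d t" if "t0 \<le> t" for t
  proof (rule ccontr)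
    assume neg: "\<not> 0 \<le> d t"
    \<comment> \<open>The maximum \<open>s\<close> of \<open>S\<close> is the last time up to
      \<open>t\<close> with d nonnegative. There d vanishes with slope c > 0, yet d is negative
      right after.\<close>
    define S where "S = {t0..t} \<inter> {s. 0 \<le> d s}"
    have "compact S"
      unfolding S_def
      by (intro compact_Int_closed compact_Icc closed_Collect_le continuous_on_const cont)
    moreover have "t0 \<in> S" using that t0 by (simp add: S_def)
    ultimately obtain s where s: "s \<in> S" "\<And>r. r \<in> S \<Longrightarrow> r \<le> s"
      using compact_attains_sup[of S] by blast
    have "s < t" using s(1) neg unfolding S_def by (cases "s = t") auto
    have after: "d r < 0" if "s < r" "r \<le> t" for r
      using s(2)[of r] that s(1) by (force simp: S_def)
    have "d s \<le> 0"
    proof (rule ccontr)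
      assume "\<not> d s \<le> 0"
      then have "\<exists>r\<ge>s. r \<le> t \<and> d r = 0"
        using neg \<open>s < t\<close> by (intro IVT2' cont) auto
      then obtain r where "s \<le> r" "r \<le> t" "d r = 0" by blast
      with after[of r] \<open>\<not> d s \<le> 0\<close> show False by (cases "r = s") auto
    qed
    then have "d s = 0" using s(1) by (simp add: S_def)
    then have "0 < \<eta> s" using L[of s] c by simp
    then obtain e where e: "e > 0" "\<And>h. 0 < h \<Longrightarrow> h < e \<Longrightarrow> d s < d (s + h)"
      using DERIV_pos_inc_right[OF d] by blast
    define h where "h = min (e / 2) (t - s)"
    have "0 < h" "h < e" "s + h \<le> t" using e(1) \<open>s < t\<close> by (auto simp: h_def)
    with e(2)[of h] after[of "s + h"] \<open>d s = 0\<close> show False by simp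
  qed
  \<comment> \<open>As d is nonnegative from \<open>t0\<close> on, the slope is at least c - L d,
    and the weight turns this into strict growth over a period; but d vanishes at both ends.\<close>
  have "exp (L * t0) * d t0 < exp (L * (t0 + 1)) * d (t0 + 1)"
  proof (rule DERIV_pos_imp_increasing[where f = "\<lambda>t. exp (L * t) * d t"])
    fix t assume t: "t0 \<le> t" "t \<le> t0 + 1"
    have "((\<lambda>t. exp (L * t) * d t) has_real_derivative exp (L * t) * (\<eta> t + L * d t)) (at t)"
      by (auto intro!: derivative_eq_intros d simp: algebra_simps)
    moreover have "0 < \<eta> t + L * d t"
      using L[of t] nonneg[OF t(1)] c by (simp add: abs_le_iff)
    ultimately show "\<exists>y. ((\<lambda>t. exp (L * t) * d t) has_real_derivative y) (at t) \<and> 0 < y"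
      by (auto intro!: exI mult_pos_pos)
  qed simp
  then show False by (simp add: t0 d1)
qed

text \<open>Both signs of c are excluded by applying \<open>periodic_crossing_pos\<close> to d and
  to -d. For c = 0 a Gronwall estimate propagates the zero forward, and periodicity carries it
  everywhere.\<close>

lemma periodic_crossing:
  fixes d \<eta> :: "real \<Rightarrow> real"
  assumes per: "periodic d" and d: "\<And>t. (d has_real_derivative \<eta> t) (at t)"
    and L: "\<And>t. \<bar>\<eta> t - c\<bar> \<le> L * \<bar>d t\<bar>" and t0: "d t0 = 0"
  shows "d t = 0" and "c = 0"
proof -
  have "\<not> 0 < c" using periodic_crossing_pos[OF assms] by blast
  moreover have "\<not> 0 < - c"
  proof
    assume "0 < - c"
    moreover have "periodic (\<lambda>t. - d t)" using per by (simp add: periodic_def)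
    moreover have "((\<lambda>t. - d t) has_real_derivative - \<eta> t) (at t)" for t
      by (intro DERIV_minus d)
    moreover have "\<bar>- \<eta> t - (- c)\<bar> \<le> L * \<bar>- d t\<bar>" for t
      using L[of t] by (simp add: abs_le_iff)
    ultimately show False using t0 periodic_crossing_pos[of "\<lambda>t. - d t" "\<lambda>t. - \<eta> t" "- c" L t0] by simp
  qed
  ultimately show c: "c = 0" by simp
  have after: "d t = 0" if "t0 \<le> t" for t
  proof -
    \<comment> \<open>Gronwall for the square of d, which avoids any discussion of signs.\<close>
    have "exp (- 2 * L * t) * (d t)\<^sup>2 \<le> exp (- 2 * L * t0) * (d t0)\<^sup>2"
    proof (rule DERIV_nonpos_imp_nonincreasing[where f = "\<lambda>t. exp (- 2 * L * t) * (d t)\<^sup>2"])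
      fix s
      have "((\<lambda>t. exp (- 2 * L * t) * (d t)\<^sup>2) has_real_derivative
          exp (- 2 * L * s) * (2 * (d s * \<eta> s - L * (d s)\<^sup>2))) (at s)"
        by (auto intro!: derivative_eq_intros d simp: algebra_simps power2_eq_square)
      moreover have "d s * \<eta> s - L * (d s)\<^sup>2 \<le> 0"
      proof -
        have "d s * \<eta> s \<le> \<bar>d s\<bar> * \<bar>\<eta> s\<bar>" by (metis abs_ge_self abs_mult)
        also have "\<dots> \<le> \<bar>d s\<bar> * (L * \<bar>d s\<bar>)" using L[of s] c by (intro mult_left_mono) auto
        finally show ?thesis by (simp add: power2_eq_square algebra_simps)
      qed
      ultimately show "\<exists>y. ((\<lambda>t. exp (- 2 * L * t) * (d t)\<^sup>2) has_real_derivative y) (at s) \<and> y \<le> 0"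
        by (auto intro!: exI mult_nonneg_nonpos)
    qed (rule that)
    then have "exp (- 2 * L * t) * (d t)\<^sup>2 \<le> 0" by (simp add: t0)
    then have "(d t)\<^sup>2 \<le> 0" by (simp add: mult_le_0_iff not_le)
    then show ?thesis by simp
  qed
  have "t0 \<le> t + of_int \<lceil>t0 - t\<rceil>" by linarith
  then show "d t = 0"
    using after periodic_of_int[OF per, of t "\<lceil>t0 - t\<rceil>"] by simp
qed

subsection \<open>Superposition operators\<close>

definition circle_fun :: "(real \<Rightarrow> real \<Rightarrow> real) \<Rightarrow> bool" where
  "circle_fun q \<longleftrightarrow> periodic q \<and> continuous_on UNIV (\<lambda>(t, x). q t x)"

definition nemytskii :: "(real \<Rightarrow> real \<Rightarrow> real) \<Rightarrow> c0 \<Rightarrow> c0" where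
  "nemytskii q u = Abs_c0 (\<lambda>t. q t (Rep_c0 u t))"

lemma Rep_nemytskii:
  assumes "circle_fun q"
  shows "Rep_c0 (nemytskii q u) t = q t (Rep_c0 u t)"
proof -
  have "continuous_on UNIV (\<lambda>(t, x). q t x)" using assms by (simp add: circle_fun_def)
  then have "continuous_on UNIV (\<lambda>t. (\<lambda>(t, x). q t x) (t, Rep_c0 u t))"
    by (rule continuous_on_compose2) (auto intro!: continuous_intros continuous_on_c0)
  moreover have "periodic (\<lambda>t. q t (Rep_c0 u t))"
    using assms by (simp add: circle_fun_def periodic_def c0_plus_1)
  ultimately show ?thesis by (simp add: nemytskii_def Rep_Abs_c0)
qed

lemma circle_fun_equicontinuous:
  assumes "circle_fun q" and "0 < e"
  obtains d where "0 < d" and "\<And>t x y. \<bar>x\<bar> \<le> B \<Longrightarrow> \<bar>y - x\<bar> < d \<Longrightarrow> \<bar>q t y - q t x\<bar> < e"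
proof -
  \<comment> \<open>The margin 1 keeps y inside the compact strip once \<bar>y - x\<bar> < min d
    1.\<close>
  have "uniformly_continuous_on ({0..1} \<times> {-B-1..B+1}) (\<lambda>(t, x). q t x)"
    using assms by (intro compact_uniformly_continuous compact_Times compact_Icc)
      (auto simp: circle_fun_def elim: continuous_on_subset)
  then obtain d where d: "d > 0"
    "\<And>z z'. z \<in> {0..1} \<times> {-B-1..B+1} \<Longrightarrow> z' \<in> {0..1} \<times> {-B-1..B+1} \<Longrightarrow> dist z' z < d \<Longrightarrow>
      dist ((\<lambda>(t, x). q t x) z') ((\<lambda>(t, x). q t x) z) < e"
    using \<open>0 < e\<close> unfolding uniformly_continuous_on_def by blast
  show thesis
  proof
    show "0 < min d 1" using d(1) by simp
    fix t x y :: real assume x: "\<bar>x\<bar> \<le> B" and y: "\<bar>y - x\<bar> < min d 1"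
    have per: "q t = q (frac t)"
      using assms(1) periodic_of_int[of q "frac t" "\<lfloor>t\<rfloor>"] by (simp add: circle_fun_def frac_def)
    have "dist ((\<lambda>(t, x). q t x) (frac t, y)) ((\<lambda>(t, x). q t x) (frac t, x)) < e"
      using x y frac_lt_1[of t] by (intro d(2)) (auto simp: dist_Pair_Pair dist_real_def less_imp_le)
    then show "\<bar>q t y - q t x\<bar> < e" by (simp add: per dist_real_def)
  qed
qed

text \<open>For each t the mean value inequality is applied to y \<mapsto> q t y - q' t x * y;
  equicontinuity of \<open>q'\<close> makes the remainder uniform in t, as the sup norm
  demands.\<close>

lemma has_derivative_nemytskii:
  assumes q: "circle_fun q" and q': "circle_fun q'"
    and D: "\<And>t x. (q t has_real_derivative q' t x) (at x)"
  shows "(nemytskii q has_derivative (\<lambda>h. nemytskii q' u * h)) (at u)"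
  unfolding has_derivative_at_alt
proof (intro conjI allI impI)
  show "bounded_linear (\<lambda>h. nemytskii q' u * h)" by (rule bounded_linear_mult_right)
  fix e :: real assume "0 < e"
  then obtain d where d: "0 < d"
    "\<And>t x y. \<bar>x\<bar> \<le> norm u \<Longrightarrow> \<bar>y - x\<bar> < d \<Longrightarrow> \<bar>q' t y - q' t x\<bar> < e"
    using circle_fun_equicontinuous[OF q'] by metis
  show "\<exists>d>0. \<forall>v. norm (v - u) < d \<longrightarrow>
      norm (nemytskii q v - nemytskii q u - nemytskii q' u * (v - u)) \<le> e * norm (v - u)"
  proof (intro exI[of _ d] conjI allI impI c0_norm_le)
    fix v t assume v: "norm (v - u) < d"
    let ?x = "Rep_c0 u t" and ?y = "Rep_c0 v t"
    have xy: "\<bar>?y - ?x\<bar> \<le> norm (v - u)" using c0_le_norm[of "v - u" t] by simp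
    have "norm ((q t ?y - q' t ?x * ?y) - (q t ?x - q' t ?x * ?x)) \<le> e * norm (?y - ?x)"
    proof (rule field_differentiable_bound[of "ball ?x d"])
      show "((\<lambda>y. q t y - q' t ?x * y) has_field_derivative q' t z - q' t ?x) (at z within ball ?x d)" for z
        by (rule DERIV_subset[of _ _ _ UNIV]) (auto intro!: derivative_eq_intros D)
      show "norm (q' t z - q' t ?x) \<le> e" if "z \<in> ball ?x d" for z
        using that d(2)[of ?x z t] c0_le_norm[of u t] by (simp add: dist_real_def abs_minus_commute)
    qed (use xy v d(1) in \<open>auto simp: dist_real_def abs_minus_commute\<close>)
    also have "\<dots> \<le> e * norm (v - u)" using xy \<open>0 < e\<close> by simp
    finally show "\<bar>Rep_c0 (nemytskii q v - nemytskii q u - nemytskii q' u * (v - u)) t\<bar> \<le> e * norm (v - u)"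
      by (simp add: Rep_nemytskii q q' algebra_simps)
  qed (rule d(1))
qed

abbreviation c0_exp :: "c0 \<Rightarrow> c0" where
  "c0_exp \<equiv> nemytskii (\<lambda>t. exp)"

lemma circle_fun_exp: "circle_fun (\<lambda>t. exp)"
  by (auto simp: circle_fun_def periodic_def case_prod_beta intro!: continuous_intros)

lemma Rep_c0_exp [simp]: "Rep_c0 (c0_exp p) t = exp (Rep_c0 p t)"
  by (rule Rep_nemytskii[OF circle_fun_exp])

subsection \<open>The linearized equation\<close>

text \<open>The derivative of \<open>G\<close> at u when g = D_2 f(t, u(t)). The equation
  \<open>linz g h = y\<close> is the integral form of (h - y)' = avg(g h) - g h together with avg h
  = avg y.\<close>

definition linz :: "c0 \<Rightarrow> c0 \<Rightarrow> c0" where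
  "linz g h = h + k1 (g * h)"

lemma bounded_linear_linz: "bounded_linear (linz g)"
  unfolding linz_def[abs_def]
  by (intro bounded_linear_add bounded_linear_ident
      bounded_linear_compose[OF bounded_linear_k1 bounded_linear_mult_right])

text \<open>The constant disappears under differentiation; it lets one statement serve both the
  kernel (c = 0) and the field \<open>V\<close> (c = 1).\<close>

lemma linz_deriv:
  assumes "linz g h = y + of_real c"
  shows "(Rep_c0 (h - y) has_real_derivative avg (g * h) - Rep_c0 (g * h) t) (at t)"
proof -
  have "h - y = of_real c - k1 (g * h)" using assms by (simp add: linz_def algebra_simps)
  then have "Rep_c0 (h - y) = (\<lambda>t. c - Rep_c0 (k1 (g * h)) t)" by (simp add: fun_eq_iff)
  then show ?thesis
    using DERIV_diff[OF DERIV_const k1_deriv, of c "g * h" t] by simp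
qed

lemma avg_linz [simp]: "avg (linz g h) = avg h"
  by (simp add: linz_def avg_add)

lemma c0_crossing:
  assumes d: "\<And>t. (Rep_c0 h has_real_derivative c - Rep_c0 (g * h) t) (at t)"
    and t0: "Rep_c0 h t0 = 0"
  shows "h = 0" "c = 0"
proof -
  have *: "\<bar>c - Rep_c0 (g * h) t - c\<bar> \<le> norm g * \<bar>Rep_c0 h t\<bar>" for t
    by (simp add: abs_mult mult_right_mono c0_le_norm)
  show "h = 0"
    using periodic_crossing(1)[OF periodic_c0 d * t0] by (intro c0_eqI) simp
  show "c = 0" by (rule periodic_crossing(2)[OF periodic_c0 d * t0])
qed

text \<open>A kernel element has average zero, hence a zero, and \<open>c0_crossing\<close> then
  annihilates it.\<close>

lemma inj_linz: "inj (linz g)"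
proof -
  have "h = 0" if "linz g h = 0" for h
  proof -
    have "avg h = 0" using that avg_linz[of g h] linear_0[OF linear_avg] by simp
    then obtain t0 where "Rep_c0 h t0 = 0" by (rule avg_0_has_zero)
    moreover have "(Rep_c0 h has_real_derivative avg (g * h) - Rep_c0 (g * h) t) (at t)" for t
      using linz_deriv[of g h 0 0 t] that by simp
    ultimately show ?thesis by (rule c0_crossing(1)[rotated])
  qed
  then show ?thesis
    using bounded_linear_linz by (simp add: linear_injective_0 bounded_linear.linear)
qed

text \<open>Variation of constants gives the solution. The bound is a maximum principle: at an
  extremum r' = 0, so \<delta> r = h there.\<close>

lemma damped_solution:
  assumes "\<delta> \<noteq> 0"
  obtains r where "\<And>t. (Rep_c0 r has_real_derivative Rep_c0 h t - \<delta> * Rep_c0 r t) (at t)"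
    and "norm r \<le> norm h / \<bar>\<delta>\<bar>"
proof -
  have "continuous_on UNIV (\<lambda>t. exp (\<delta> * t) * Rep_c0 h t)"
    by (intro continuous_intros continuous_on_c0)
  then obtain H where H: "\<And>t. (H has_real_derivative exp (\<delta> * t) * Rep_c0 h t) (at t)"
    by (rule continuous_has_antiderivative) blast
  \<comment> \<open>The constant for which \<open>r 1 = r 0\<close>; the denominator is nonzero
    because \<delta> is.\<close>
  define C where "C = (H 0 - exp (- \<delta>) * H 1) / (exp (- \<delta>) - 1)"
  define r where "r t = exp (- \<delta> * t) * (H t + C)" for t
  have "exp (- \<delta>) - 1 \<noteq> 0" using assms by simp
  then have "C * (exp (- \<delta>) - 1) = H 0 - exp (- \<delta>) * H 1" by (simp add: C_def)
  then have r1: "r 1 = r 0" by (simp add: r_def algebra_simps)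
  have dr: "(r has_real_derivative Rep_c0 h t - \<delta> * r t) (at t)" for t
  proof -
    have "(r has_real_derivative - \<delta> * exp (- \<delta> * t) * (H t + C)
        + exp (\<delta> * t) * Rep_c0 h t * exp (- \<delta> * t)) (at t)"
      unfolding r_def
      by (intro DERIV_mult DERIV_fun_exp) (auto intro!: derivative_eq_intros H)
    moreover have "exp (\<delta> * t) * Rep_c0 h t * exp (- \<delta> * t) = Rep_c0 h t"
      by (simp add: exp_minus)
    ultimately have "(r has_real_derivative - \<delta> * exp (- \<delta> * t) * (H t + C) + Rep_c0 h t) (at t)"
      by (simp only:)
    then show ?thesis by (simp add: r_def mult.assoc)
  qed
  have "r (t + 1) = r t" for t
  proof -
    let ?d = "\<lambda>t. exp (\<delta> * t) * (r (t + 1) - r t)"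
    have "(?d has_real_derivative 0) (at t)" for t
    proof -
      have "((\<lambda>t. r (t + 1)) has_real_derivative Rep_c0 h t - \<delta> * r (t + 1)) (at t)"
        using dr[of "t + 1"] by (simp add: DERIV_shift c0_plus_1)
      then show ?thesis
        by (auto intro!: derivative_eq_intros dr simp: algebra_simps)
    qed
    then have "?d t = ?d 0" by (intro DERIV_isconst_all) blast
    then show ?thesis using r1 by simp
  qed
  then have "periodic r" by (simp add: periodic_def)
  moreover have "continuous_on UNIV r"
    using dr by (intro DERIV_continuous_on) auto
  ultimately have rep: "Rep_c0 (Abs_c0 r) = r" by (rule Rep_Abs_c0)
  show thesis
  proof
    show "(Rep_c0 (Abs_c0 r) has_real_derivative Rep_c0 h t - \<delta> * Rep_c0 (Abs_c0 r) t) (at t)" for t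
      unfolding rep by (rule dr)
    \<comment> \<open>General in p, to be used for r and for -r.\<close>
    have up: "Rep_c0 p t \<le> norm h / \<bar>\<delta>\<bar>"
      if p: "\<And>t. (Rep_c0 p has_real_derivative a t) (at t)" "\<And>t. \<bar>a t + \<delta> * Rep_c0 p t\<bar> \<le> norm h"
      for p a t
    proof -
      obtain s where s: "\<And>t. Rep_c0 p t \<le> Rep_c0 p s" using c0_attains_sup by blast
      have "a s = 0" by (rule DERIV_local_max[OF p(1), of 1]) (auto simp: s)
      then have "\<bar>\<delta>\<bar> * \<bar>Rep_c0 p s\<bar> \<le> norm h" using p(2)[of s] by (simp add: abs_mult)
      then have "\<bar>Rep_c0 p s\<bar> \<le> norm h / \<bar>\<delta>\<bar>" using assms by (simp add: field_simps)
      then show ?thesis using s[of t] by linarith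
    qed
    show "norm (Abs_c0 r) \<le> norm h / \<bar>\<delta>\<bar>"
    proof (rule c0_norm_le)
      fix t
      have "Rep_c0 (Abs_c0 r) t \<le> norm h / \<bar>\<delta>\<bar>"
        by (rule up[of _ "\<lambda>t. Rep_c0 h t - \<delta> * r t"]) (auto simp: rep dr c0_le_norm)
      moreover have "Rep_c0 (- Abs_c0 r) t \<le> norm h / \<bar>\<delta>\<bar>"
      proof (rule up)
        show "(Rep_c0 (- Abs_c0 r) has_real_derivative - (Rep_c0 h t - \<delta> * r t)) (at t)" for t
          unfolding uminus_c0.rep_eq[abs_def] rep by (rule DERIV_minus[OF dr])
      qed (simp add: rep c0_le_norm)
      ultimately show "\<bar>Rep_c0 (Abs_c0 r) t\<bar> \<le> norm h / \<bar>\<delta>\<bar>" by (simp add: abs_le_iff)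
    qed
  qed
qed

lemma c0_mult_deriv:
  assumes "(Rep_c0 p has_real_derivative a) (at t)" "(Rep_c0 q has_real_derivative b) (at t)"
  shows "(Rep_c0 (p * q) has_real_derivative a * Rep_c0 q t + b * Rep_c0 p t) (at t)"
  using DERIV_mult[OF assms] by (simp add: times_c0.rep_eq[abs_def])

lemma c0_add_scaled_deriv:
  assumes "(Rep_c0 p has_real_derivative a) (at t)" "(Rep_c0 q has_real_derivative b) (at t)"
  shows "(Rep_c0 (p + of_real c * q) has_real_derivative a + c * b) (at t)"
  using DERIV_add[OF assms(1) DERIV_cmult[OF assms(2), of c]]
  by (simp add: plus_c0.rep_eq[abs_def] times_c0.rep_eq[abs_def])

lemma c0_exp_deriv:
  assumes "(Rep_c0 p has_real_derivative a) (at t)"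
  shows "(Rep_c0 (c0_exp p) has_real_derivative a * Rep_c0 (c0_exp p) t) (at t)"
proof -
  have "Rep_c0 (c0_exp p) = (\<lambda>t. exp (Rep_c0 p t))" by (simp add: fun_eq_iff)
  then show ?thesis using DERIV_fun_exp[OF assms] by (simp add: mult.commute)
qed

lemma exp_k1_deriv:
  "(Rep_c0 (c0_exp (k1 g)) has_real_derivative
     (Rep_c0 g t - avg g) * Rep_c0 (c0_exp (k1 g)) t) (at t)"
  by (rule c0_exp_deriv) (rule k1_deriv)

text \<open>This exponential absorbs the oscillating part of g and leaves the constant damping
  \<open>avg g\<close>; for \<open>g u\<close> it is the field \<open>w\<close>.\<close>

lemma exp_minus_k1_deriv:
  "(Rep_c0 (c0_exp (- k1 g)) has_real_derivative
     (avg g - Rep_c0 g t) * Rep_c0 (c0_exp (- k1 g)) t) (at t)"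
  using c0_exp_deriv[OF k1_deriv, of "- g" t] by (simp add: k1_minus avg_minus del: Rep_c0_exp)

lemma exp_minus_k1_mult: "c0_exp (- k1 g) * c0_exp (k1 g) = 1"
  by (rule c0_eqI) (simp flip: exp_add)

text \<open>The substitution p = exp(- k1 g) r makes the damping constant. If \<open>avg g\<close>
  is nonzero, \<open>damped_solution\<close> applies with c = 0. At resonance the free constant c
  restores solvability.\<close>

lemma linear_ode_particular:
  obtains C where "0 \<le> C" and "\<And>q. \<exists>p c. norm p \<le> C * norm q \<and>
    (\<forall>t. (Rep_c0 p has_real_derivative Rep_c0 q t + c - Rep_c0 (g * p) t) (at t))"
proof -
  let ?w = "c0_exp (- k1 g)" and ?n = "c0_exp (k1 g)"
  have red: "(Rep_c0 (?w * r) has_real_derivative Rep_c0 q t + c - Rep_c0 (g * (?w * r)) t) (at t)"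
    if r: "(Rep_c0 r has_real_derivative Rep_c0 ((q + of_real c) * ?n) t - avg g * Rep_c0 r t) (at t)"
    for q r c t
    using c0_mult_deriv[OF exp_minus_k1_deriv r, of g] arg_cong[OF exp_minus_k1_mult[of g], of "\<lambda>z. Rep_c0 z t"]
    by (elim DERIV_cong) (simp add: algebra_simps del: Rep_c0_exp)
  have "\<exists>C\<ge>0. \<forall>q. \<exists>r c. norm r \<le> C * norm q \<and>
    (\<forall>t. (Rep_c0 r has_real_derivative Rep_c0 ((q + of_real c) * ?n) t - avg g * Rep_c0 r t) (at t))"
  proof (cases "avg g = 0")
    case True
    have n: "0 < avg ?n" by (rule avg_pos) simp
    \<comment> \<open>The source must have average zero, which determines c linearly in q.\<close>
    let ?c = "\<lambda>q. - inverse (avg ?n) * avg (q * ?n)"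
    let ?r = "\<lambda>q. k1 ((q + of_real (?c q)) * ?n)"
    have "bounded_linear ?r"
      by (intro bounded_linear_compose[OF bounded_linear_k1] bounded_linear_mult_const
          bounded_linear_add bounded_linear_ident bounded_linear_compose[OF bounded_linear_of_real]
          bounded_linear_const_mult bounded_linear_compose[OF bounded_linear_avg])
    then obtain C where C: "0 \<le> C" "\<And>q. norm (?r q) \<le> norm q * C"
      using bounded_linear.nonneg_bounded by blast
    have "(Rep_c0 (?r q) has_real_derivative
        Rep_c0 ((q + of_real (?c q)) * ?n) t - avg g * Rep_c0 (?r q) t) (at t)" for q t
    proof -
      have "avg ((q + of_real (?c q)) * ?n) = 0"
        using n by (simp add: distrib_right avg_add del: of_real_mult of_real_minus)
      then show ?thesis using k1_deriv[of "(q + of_real (?c q)) * ?n" t] by (simp add: True)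
    qed
    then show ?thesis using C by (metis mult.commute)
  next
    case False
    show ?thesis
    proof (intro exI[of _ "norm ?n / \<bar>avg g\<bar>"] conjI allI)
      fix q
      obtain r where r: "\<And>t. (Rep_c0 r has_real_derivative
          Rep_c0 (q * ?n) t - avg g * Rep_c0 r t) (at t)" "norm r \<le> norm (q * ?n) / \<bar>avg g\<bar>"
        using damped_solution[OF False] by blast
      have "norm r \<le> norm ?n / \<bar>avg g\<bar> * norm q"
        using r(2) divide_right_mono[OF norm_mult_ineq[of q ?n], of "\<bar>avg g\<bar>"]
        by (simp add: mult.commute)
      then show "\<exists>r c. norm r \<le> norm ?n / \<bar>avg g\<bar> * norm q \<and>
          (\<forall>t. (Rep_c0 r has_real_derivative
            Rep_c0 ((q + of_real c) * ?n) t - avg g * Rep_c0 r t) (at t))"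
        using r(1) by (intro exI[of _ r] exI[of _ 0]) auto
    qed simp
  qed
  then obtain C where C: "C \<ge> 0" "\<And>q. \<exists>r c. norm r \<le> C * norm q \<and>
    (\<forall>t. (Rep_c0 r has_real_derivative Rep_c0 ((q + of_real c) * ?n) t - avg g * Rep_c0 r t) (at t))"
    by blast
  show thesis
  proof
    show "0 \<le> norm ?w * C" using C(1) by simp
    fix q
    obtain r c where r: "norm r \<le> C * norm q" "\<And>t. (Rep_c0 r has_real_derivative
        Rep_c0 ((q + of_real c) * ?n) t - avg g * Rep_c0 r t) (at t)"
      using C(2) by blast
    have "norm (?w * r) \<le> norm ?w * C * norm q"
      using order_trans[OF norm_mult_ineq mult_left_mono[OF r(1) norm_ge_zero]]
      by (simp add: mult.assoc)
    then show "\<exists>p c. norm p \<le> norm ?w * C * norm q \<and>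
        (\<forall>t. (Rep_c0 p has_real_derivative Rep_c0 q t + c - Rep_c0 (g * p) t) (at t))"
      using red[OF r(2)] by blast
  qed
qed

text \<open>\<open>Y\<close> serves to correct averages. Off resonance take c = 1: a solution of
  average zero would have a zero, and then \<open>c0_crossing\<close> would force c = 0.\<close>

lemma linear_ode_kernel:
  obtains Y c where "avg Y \<noteq> 0"
    and "\<And>t. (Rep_c0 Y has_real_derivative c - Rep_c0 (g * Y) t) (at t)"
proof (cases "avg g = 0")
  case True
  show thesis
  proof
    show "avg (c0_exp (- k1 g)) \<noteq> 0" using avg_pos[of "c0_exp (- k1 g)"] by simp
    show "(Rep_c0 (c0_exp (- k1 g)) has_real_derivative 0 - Rep_c0 (g * c0_exp (- k1 g)) t) (at t)" for t
      using exp_minus_k1_deriv[of g t] by (simp add: True)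
  qed
next
  case False
  let ?w = "c0_exp (- k1 g)" and ?n = "c0_exp (k1 g)"
  obtain r where r: "\<And>t. (Rep_c0 r has_real_derivative Rep_c0 ?n t - avg g * Rep_c0 r t) (at t)"
    using damped_solution[OF False] by blast
  have d: "(Rep_c0 (?w * r) has_real_derivative 1 - Rep_c0 (g * (?w * r)) t) (at t)" for t
    by (rule DERIV_cong[OF c0_mult_deriv[OF exp_minus_k1_deriv[of g t] r[of t]]])
       (use arg_cong[OF exp_minus_k1_mult[of g], of "\<lambda>z. Rep_c0 z t"]
         in \<open>simp add: algebra_simps del: Rep_c0_exp\<close>)
  have "avg (?w * r) \<noteq> 0"
  proof
    assume "avg (?w * r) = 0"
    then obtain t0 where "Rep_c0 (?w * r) t0 = 0" by (rule avg_0_has_zero)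
    then show False using c0_crossing(2)[OF d] by simp
  qed
  then show thesis using d by (rule that)
qed

text \<open>Writing h = y + z, the unknown z must have average zero and satisfy z' = c - g (y + z)
  for some constant c. It is a particular solution plus a multiple of \<open>Y\<close>.\<close>

lemma linz_solvable:
  obtains C where "0 \<le> C" and "\<And>y. \<exists>h. linz g h = y \<and> norm h \<le> C * norm y"
proof -
  obtain Y cY where Y: "avg Y \<noteq> 0"
    "\<And>t. (Rep_c0 Y has_real_derivative cY - Rep_c0 (g * Y) t) (at t)"
    using linear_ode_kernel[of g] by blast
  obtain C where C: "0 \<le> C" "\<And>q. \<exists>p c. norm p \<le> C * norm q \<and>
    (\<forall>t. (Rep_c0 p has_real_derivative Rep_c0 q t + c - Rep_c0 (g * p) t) (at t))"
    using linear_ode_particular[of g] by blast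
  \<comment> \<open>The 1 accounts for y; the rest bounds z through the norm of p and \<bar>a\<bar>
    \<le> norm p / \<bar>avg Y\<bar>.\<close>
  define C' where "C' = 1 + (1 + norm Y / \<bar>avg Y\<bar>) * (C * norm g)"
  show thesis
  proof
    show "0 \<le> C'" using C(1) by (simp add: C'_def)
    fix y
    obtain p c where p: "norm p \<le> C * norm (- (g * y))"
      "\<And>t. (Rep_c0 p has_real_derivative Rep_c0 (- (g * y)) t + c - Rep_c0 (g * p) t) (at t)"
      using C(2) by blast
    \<comment> \<open>This multiple of \<open>Y\<close> cancels the average of p.\<close>
    define a where "a = - (avg p / avg Y)"
    define z where "z = p + of_real a * Y"
    have avg_z: "avg z = 0" using Y(1) by (simp add: z_def avg_add a_def del: of_real_minus of_real_divide)
    have dz: "(Rep_c0 z has_real_derivative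
        Rep_c0 (of_real (c + a * cY) - g * (y + z)) t) (at t)" for t
      unfolding z_def
      by (rule DERIV_cong[OF c0_add_scaled_deriv[OF p(2) Y(2)]]) 
         (simp add: algebra_simps del: of_real_add of_real_mult)
    have "z = - k1 (g * (y + z))"
      using c0_eq_avg_plus_k1[OF dz] avg_z by (simp add: k1_diff del: of_real_add of_real_mult)
    then have "linz g (y + z) = y" by (simp add: linz_def add.assoc) (metis add.left_inverse)
    moreover have "norm (y + z) \<le> C' * norm y"
    proof -
      have "C * norm (g * y) \<le> C * (norm g * norm y)"
        by (intro mult_left_mono norm_mult_ineq C)
      then have np: "norm p \<le> C * norm g * norm y" using p(1) by (simp add: mult.assoc)
      have "norm (of_real a * Y) \<le> \<bar>a\<bar> * norm Y" by (metis norm_mult_ineq norm_of_real)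
      also have "\<bar>a\<bar> \<le> norm p / \<bar>avg Y\<bar>"
        unfolding a_def abs_minus abs_divide by (intro divide_right_mono avg_abs_le) simp
      finally have "norm (of_real a * Y) \<le> norm p * (norm Y / \<bar>avg Y\<bar>)"
        by (simp add: mult_right_mono)
      then have "norm z \<le> norm p * (1 + norm Y / \<bar>avg Y\<bar>)"
        unfolding z_def using norm_triangle_ineq[of p "of_real a * Y"] by (simp add: distrib_left)
      also have "\<dots> \<le> C * norm g * norm y * (1 + norm Y / \<bar>avg Y\<bar>)"
        by (intro mult_right_mono np) simp
      finally show ?thesis
        using norm_triangle_ineq[of y z] by (simp add: C'_def algebra_simps)
    qed
    ultimately show "\<exists>h. linz g h = y \<and> norm h \<le> C' * norm y" by blast
  qed
qed

section \<open>The inverse of the linearization and its dependence on the coefficient\<close>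

definition linz_inv :: "c0 \<Rightarrow> c0 \<Rightarrow> c0" where
  "linz_inv g = inv (linz g)"

lemma linz_linz_inv [simp]: "linz g (linz_inv g y) = y"
  unfolding linz_inv_def using linz_solvable[of g] by (intro f_inv_into_f) (metis rangeI)

lemma linz_inv_linz [simp]: "linz_inv g (linz g h) = h"
  unfolding linz_inv_def by (rule inv_f_f[OF inj_linz])

lemma linz_inv_eqI: "linz g h = y \<Longrightarrow> linz_inv g y = h"
  by auto

lemma linz_inv_bound:
  obtains C where "0 \<le> C" and "\<And>y. norm (linz_inv g y) \<le> C * norm y"
  using linz_solvable[of g] by (metis linz_inv_eqI)

lemma linear_linz: "linear (linz g)"
  by (rule bounded_linear.linear[OF bounded_linear_linz])

lemma bounded_linear_linz_inv: "bounded_linear (linz_inv g)"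
proof -
  obtain C where "\<And>y. norm (linz_inv g y) \<le> C * norm y"
    using linz_inv_bound by metis
  then show ?thesis
    by (intro bounded_linear_intro[where K = C] linz_inv_eqI)
       (simp_all add: linear_add[OF linear_linz] linear_scale[OF linear_linz] mult.commute)
qed

lemma has_derivative_k1 [derivative_intros]:
  "(A has_derivative D) F \<Longrightarrow> ((\<lambda>x. k1 (A x)) has_derivative (\<lambda>h. k1 (D h))) F"
  by (rule bounded_linear.has_derivative[OF bounded_linear_k1])

lemma linz_minus_linz: "linz g h - linz g' h = k1 ((g - g') * h)"
  by (simp add: linz_def left_diff_distrib k1_diff)

text \<open>Resolvent estimate: the increment N of the solution is bounded by data plus C * norm (g'
  - g) * N. The last term is absorbed once its factor is at most 1/2, hence the 2.\<close>

lemma continuous_linz_inv: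
  "continuous (at (g, y)) (\<lambda>(g, y). linz_inv g y)"
proof -
  obtain C where C: "0 \<le> C" "\<And>z. norm (linz_inv g z) \<le> C * norm z"
    using linz_inv_bound by metis
  let ?h = "linz_inv g y"
  have diff: "norm (linz_inv g' y' - ?h) \<le> 2 * C * (norm (y' - y) + norm (g' - g) * norm ?h)"
    if small: "C * norm (g' - g) \<le> 1 / 2" for g' y'
  proof -
    let ?h' = "linz_inv g' y'"
    let ?N = "norm (?h' - ?h)"
    have "linz g (?h' - ?h) = y' - y - k1 ((g' - g) * ?h')"
      using linz_minus_linz[of g' ?h' g] by (simp add: linear_diff[OF linear_linz] algebra_simps)
    then have "?h' - ?h = linz_inv g (y' - y - k1 ((g' - g) * ?h'))"
      by (metis linz_inv_linz)
    then have "?N \<le> C * norm (y' - y - k1 ((g' - g) * ?h'))" using C(2) by metis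
    also have "\<dots> \<le> C * (norm (y' - y) + norm (g' - g) * (norm ?h + ?N))"
    proof (rule mult_left_mono[OF _ C(1)])
      have "norm (k1 ((g' - g) * ?h')) \<le> norm (g' - g) * norm ?h'"
        by (rule order_trans[OF norm_k1_le norm_mult_ineq])
      also have "\<dots> \<le> norm (g' - g) * (norm ?h + ?N)"
        using norm_triangle_sub[of ?h' ?h] by (intro mult_left_mono) auto
      finally show "norm (y' - y - k1 ((g' - g) * ?h')) \<le> norm (y' - y) + norm (g' - g) * (norm ?h + ?N)"
        using norm_triangle_ineq4[of "y' - y" "k1 ((g' - g) * ?h')"] by linarith
    qed
    also have "\<dots> = C * (norm (y' - y) + norm (g' - g) * norm ?h) + C * norm (g' - g) * ?N"
      by (simp add: algebra_simps)
    also have "\<dots> \<le> C * (norm (y' - y) + norm (g' - g) * norm ?h) + 1 / 2 * ?N"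
      using small by (intro add_left_mono mult_right_mono) auto
    finally show ?thesis by (simp add: algebra_simps)
  qed
  have "((\<lambda>z. 2 * C * (norm (snd z - y) + norm (fst z - g) * norm ?h)) \<longlongrightarrow>
      2 * C * (norm (snd (g, y) - y) + norm (fst (g, y) - g) * norm ?h)) (at (g, y))"
    by (intro tendsto_intros)
  then have lim: "((\<lambda>z. 2 * C * (norm (snd z - y) + norm (fst z - g) * norm ?h)) \<longlongrightarrow> 0) (at (g, y))"
    by simp
  have "((\<lambda>z. C * norm (fst z - g)) \<longlongrightarrow> C * norm (fst (g, y) - g)) (at (g, y))"
    by (intro tendsto_intros)
  then have ev: "\<forall>\<^sub>F z in at (g, y). C * norm (fst z - g) < 1 / 2"
    by (rule order_tendstoD) simp
  have "((\<lambda>z. linz_inv (fst z) (snd z) - ?h) \<longlongrightarrow> 0) (at (g, y))"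
    by (rule Lim_null_comparison[OF eventually_mono[OF ev diff] lim]) simp
  then show ?thesis
    by (simp add: continuous_at case_prod_unfold LIM_zero_iff)
qed

text \<open>Carrying g along turns the family of inverses into the inverse of a single map (g, h)
  \<mapsto> (g, linz g h), whose derivative is triangular. Joint continuity makes the inverse
  differentiable.\<close>

lemma has_derivative_linz_inv:
  "((\<lambda>(g, y). linz_inv g y) has_derivative
    (\<lambda>(\<gamma>, \<eta>). linz_inv g (\<eta> - k1 (\<gamma> * linz_inv g y)))) (at (g, y))"
proof -
  let ?h = "linz_inv g y"
  let ?H = "\<lambda>z. (fst z, linz (fst z) (snd z))"
  let ?I = "\<lambda>z. (fst z, linz_inv (fst z) (snd z))"
  have "(?I has_derivative (\<lambda>z. (fst z, linz_inv g (snd z - k1 (fst z * ?h))))) (at (g, y))"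
  proof (rule has_derivative_inverse_basic[where T = UNIV])
    show "(?H has_derivative (\<lambda>z. (fst z, linz g (snd z) + k1 (fst z * ?h)))) (at (?I (g, y)))"
      unfolding linz_def
      by (auto intro!: derivative_eq_intros simp: algebra_simps k1_add)
    show "bounded_linear (\<lambda>z. (fst z, linz_inv g (snd z - k1 (fst z * ?h))))"
      by (intro bounded_linear_Pair bounded_linear_fst bounded_linear_sub bounded_linear_snd
          bounded_linear_compose[OF bounded_linear_linz_inv]
          bounded_linear_compose[OF bounded_linear_k1] bounded_linear_mult_const)
    show "continuous (at (g, y)) ?I"
      using continuous_linz_inv[of g y] by (intro continuous_intros) (simp add: case_prod_unfold)
  qed (auto simp: fun_eq_iff)
  from has_derivative_snd[OF this] show ?thesis
    by (simp add: case_prod_unfold)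
qed

subsection \<open>Local inversion\<close>

text \<open>Newton iteration with the derivative frozen at \<open>u0\<close>. A left inverse
  \<open>S\<close> suffices, since injectivity of \<open>S\<close> turns fixed points into
  solutions.\<close>

lemma local_surjectivity:
  fixes G :: "'a::banach \<Rightarrow> 'b::real_normed_vector"
  assumes G: "\<And>u. (G has_derivative D u) (at u)"
    and S: "bounded_linear S" "\<And>h. S (D u0 h) = h" "inj S"
    and cont: "\<And>e. 0 < e \<Longrightarrow> \<exists>d>0. \<forall>u. norm (u - u0) < d \<longrightarrow> (\<forall>h. norm (D u h - D u0 h) \<le> e * norm h)"
    and "0 < e"
  shows "\<exists>r>0. ball (G u0) r \<subseteq> G ` cball u0 e"
proof -
  obtain C where C: "0 < C" "\<And>y. norm (S y) \<le> norm y * C"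
    using bounded_linear.pos_bounded[OF S(1)] by blast
  \<comment> \<open>The tolerance 1 / (2 * C) makes the iteration map a contraction with factor
    1/2.\<close>
  obtain d where d: "d > 0"
    "\<And>u h. norm (u - u0) < d \<Longrightarrow> norm (D u h - D u0 h) \<le> 1 / (2 * C) * norm h"
    using cont[of "1 / (2 * C)"] C(1) by auto
  define \<rho> where "\<rho> = min e (d / 2)"
  have \<rho>: "0 < \<rho>" "\<rho> \<le> e" "\<rho> < d" using \<open>0 < e\<close> d(1) by (auto simp: \<rho>_def)
  \<comment> \<open>This radius moves the centre by at most \<rho>/2; the contraction contributes
    the other \<rho>/2.\<close>
  have "ball (G u0) (\<rho> / (2 * C)) \<subseteq> G ` cball u0 e"
  proof
    fix y assume "y \<in> ball (G u0) (\<rho> / (2 * C))"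
    then have y: "norm (y - G u0) < \<rho> / (2 * C)" by (simp add: dist_norm norm_minus_commute)
    let ?T = "\<lambda>u. u + S (y - G u)"
    interpret S: bounded_linear S by (rule S(1))
    have lip: "norm (?T u - ?T v) \<le> 1 / 2 * norm (u - v)" if "u \<in> cball u0 \<rho>" "v \<in> cball u0 \<rho>" for u v
    proof (rule differentiable_bound[OF convex_cball _ _ that])
      fix u assume "u \<in> cball u0 \<rho>"
      then have u: "norm (u - u0) < d" using \<rho>(3) by (simp add: dist_norm norm_minus_commute)
      show "(?T has_derivative (\<lambda>h. h - S (D u h))) (at u within cball u0 \<rho>)"
        by (rule has_derivative_at_withinI)
           (auto intro!: derivative_eq_intros S.has_derivative G simp: S.neg)
      show "onorm (\<lambda>h. h - S (D u h)) \<le> 1 / 2"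
      proof (rule onorm_bound)
        fix h
        have "h - S (D u h) = S (D u0 h - D u h)" by (simp add: S.diff S(2))
        then have "norm (h - S (D u h)) \<le> norm (D u h - D u0 h) * C"
          using C(2) by (simp add: norm_minus_commute)
        also have "\<dots> \<le> 1 / (2 * C) * norm h * C"
          using d(2)[OF u] C(1) by (intro mult_right_mono) auto
        finally show "norm (h - S (D u h)) \<le> 1 / 2 * norm h" using C(1) by simp
      qed simp
    qed
    have "\<exists>!u\<in>cball u0 \<rho>. ?T u = u"
    proof (rule Banach_fix)
      show "complete (cball u0 \<rho>)" by (simp add: complete_eq_closed)
      show "cball u0 \<rho> \<noteq> {}" using \<rho>(1) by simp
      show "?T ` cball u0 \<rho> \<subseteq> cball u0 \<rho>"
      proof
        fix v assume "v \<in> ?T ` cball u0 \<rho>"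
        then obtain u where u: "u \<in> cball u0 \<rho>" "v = ?T u" by blast
        have "norm (?T u0 - u0) \<le> norm (y - G u0) * C" using C(2) by simp
        also have "\<dots> \<le> \<rho> / (2 * C) * C" using y C(1) by (intro mult_right_mono) auto
        finally have "norm (?T u0 - u0) \<le> \<rho> / 2" using C(1) by simp
        moreover have "norm (?T u - ?T u0) \<le> 1 / 2 * norm (u - u0)"
          using \<rho>(1) by (intro lip u(1)) simp
        moreover have "norm (u - u0) \<le> \<rho>"
          using u(1) by (simp add: dist_norm norm_minus_commute)
        ultimately have "norm (?T u - u0) \<le> \<rho>"
          using norm_triangle_ineq[of "?T u - ?T u0" "?T u0 - u0"] by simp
        then show "v \<in> cball u0 \<rho>" by (simp add: u(2) dist_norm norm_minus_commute)
      qed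
      show "dist (?T u) (?T v) \<le> 1 / 2 * dist u v" if "u \<in> cball u0 \<rho>" "v \<in> cball u0 \<rho>" for u v
        using lip[OF that] by (simp only: dist_norm)
    qed simp_all
    then obtain u where u: "u \<in> cball u0 \<rho>" "?T u = u" by blast
    then have "S (y - G u) = S 0" by (simp add: S.zero)
    then have "y - G u = 0" by (rule injD[OF S(3)])
    then have "G u = y" by simp
    then show "y \<in> G ` cball u0 e" using u(1) \<rho>(2) by auto
  qed
  then show ?thesis using \<rho>(1) C(1) by (intro exI[of _ "\<rho> / (2 * C)"]) auto
qed

text \<open>Applied to arbitrarily small balls, \<open>local_surjectivity\<close> gives both
  openness of the range and continuity of the inverse; differentiability of the inverse
  follows.\<close>

lemma
  fixes G :: "'a::banach \<Rightarrow> 'b::real_normed_vector"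
  assumes G: "\<And>u. (G has_derivative D u) (at u)" and "inj G"
    and S: "\<And>u. bounded_linear (S u)" "\<And>u h. S u (D u h) = h" "\<And>u. inj (S u)"
    and cont: "\<And>u e. 0 < e \<Longrightarrow>
      \<exists>d>0. \<forall>v. norm (v - u) < d \<longrightarrow> (\<forall>h. norm (D v h - D u h) \<le> e * norm h)"
  shows open_range_diffeo: "open (range G)"
    and has_derivative_inv_diffeo: "(inv G has_derivative S u) (at (G u))"
proof -
  have surj: "\<exists>r>0. ball (G u) r \<subseteq> G ` cball u e" if "0 < e" for u e
    by (rule local_surjectivity[OF G S(1) S(2) S(3) cont that])
  show op: "open (range G)"
    unfolding open_contains_ball using surj[of 1] by (force simp: image_iff)
  have "continuous (at (G u)) (inv G)"
    unfolding continuous_at_eps_delta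
  proof (intro allI impI)
    fix e :: real assume "0 < e"
    then obtain r where r: "r > 0" "ball (G u) r \<subseteq> G ` cball u (e / 2)"
      using surj[of "e / 2" u] by auto
    have "dist (inv G y) (inv G (G u)) < e" if y: "dist y (G u) < r" for y
    proof -
      have "y \<in> ball (G u) r" using y by (simp add: dist_commute)
      then obtain v where "v \<in> cball u (e / 2)" "y = G v" using r(2) by blast
      then show ?thesis using \<open>0 < e\<close> by (simp add: inv_f_f[OF \<open>inj G\<close>] dist_commute)
    qed
    then show "\<exists>d>0. \<forall>y. dist y (G u) < d \<longrightarrow> dist (inv G y) (inv G (G u)) < e"
      using r(1) by blast
  qed
  then show "(inv G has_derivative S u) (at (G u))"
    by (intro has_derivative_inverse_basic[OF _ S(1) _ _ op, where f' = "D u"])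
       (auto simp: inv_f_f[OF \<open>inj G\<close>] G S(2) fun_eq_iff)
qed

subsection \<open>An algebra of smooth operators\<close>

text \<open>All derivatives in the second variable are carried along, so that differentiating
  superposition with \<open>q j\<close> only raises the index.\<close>

definition smooth_family :: "(nat \<Rightarrow> real \<Rightarrow> real \<Rightarrow> real) \<Rightarrow> bool" where
  "smooth_family q \<longleftrightarrow> (\<forall>j. circle_fun (q j)) \<and>
     (\<forall>j t x. (q j t has_real_derivative q (Suc j) t x) (at x))"

lemma smooth_family_exp: "smooth_family (\<lambda>j t. exp)"
  by (simp add: smooth_family_def circle_fun_exp)

text \<open>
  A syntactic substitute for smoothness of maps on a Banach space: each generator has a derivative
  that is again expressed by the generators, so no higher derivatives have to be iterated.
\<close>

inductive smooth_op :: "(c0 \<Rightarrow> c0) \<Rightarrow> bool" where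
  ident: "smooth_op (\<lambda>u. u)"
| const: "smooth_op (\<lambda>u. c)"
| add: "smooth_op A \<Longrightarrow> smooth_op B \<Longrightarrow> smooth_op (\<lambda>u. A u + B u)"
| mult: "smooth_op A \<Longrightarrow> smooth_op B \<Longrightarrow> smooth_op (\<lambda>u. A u * B u)"
| lin: "bounded_linear L \<Longrightarrow> smooth_op A \<Longrightarrow> smooth_op (\<lambda>u. L (A u))"
| nemytskii: "smooth_family q \<Longrightarrow> smooth_op A \<Longrightarrow> smooth_op (\<lambda>u. nemytskii (q j) (A u))"
| recip: "smooth_op A \<Longrightarrow> (\<And>u. avg (A u) \<noteq> 0) \<Longrightarrow> smooth_op (\<lambda>u. of_real (inverse (avg (A u))))"
| linz_inv: "smooth_op A \<Longrightarrow> smooth_op B \<Longrightarrow> smooth_op (\<lambda>u. linz_inv (A u) (B u))"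

lemma smooth_op_minus: "smooth_op A \<Longrightarrow> smooth_op (\<lambda>u. - A u)"
  by (intro smooth_op.lin[of "\<lambda>u. - u"] bounded_linear_minus bounded_linear_ident)

lemma smooth_op_diff: "smooth_op A \<Longrightarrow> smooth_op B \<Longrightarrow> smooth_op (\<lambda>u. A u - B u)"
  using smooth_op.add[OF _ smooth_op_minus, of A B] by simp

lemma smooth_op_k1: "smooth_op A \<Longrightarrow> smooth_op (\<lambda>u. k1 (A u))"
  by (rule smooth_op.lin[OF bounded_linear_k1])

lemma smooth_op_avg: "smooth_op A \<Longrightarrow> smooth_op (\<lambda>u. of_real (avg (A u)))"
  by (rule smooth_op.lin[OF bounded_linear_compose[OF bounded_linear_of_real bounded_linear_avg]])

text \<open>Structural induction. Smoothness of the derivative is only asserted along smooth fields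
  X, which is what iterated Lie derivatives consume.\<close>

lemma smooth_op_deriv:
  assumes "smooth_op A"
  shows "\<exists>D. (\<forall>u. (A has_derivative D u) (at u)) \<and>
    (\<forall>X. smooth_op X \<longrightarrow> smooth_op (\<lambda>u. D u (X u)))"
  using assms
proof induction
  case ident
  show ?case by (intro exI[of _ "\<lambda>u h. h"]) (auto intro: has_derivative_ident)
next
  case (const c)
  show ?case by (intro exI[of _ "\<lambda>u h. 0"]) (auto intro: has_derivative_const smooth_op.const)
next
  case (add A B)
  from add.IH obtain DA DB where
    "\<And>u. (A has_derivative DA u) (at u)" "\<And>X. smooth_op X \<Longrightarrow> smooth_op (\<lambda>u. DA u (X u))"
    "\<And>u. (B has_derivative DB u) (at u)" "\<And>X. smooth_op X \<Longrightarrow> smooth_op (\<lambda>u. DB u (X u))"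
    by blast
  then show ?case
    by (intro exI[of _ "\<lambda>u h. DA u h + DB u h"]) (auto intro: has_derivative_add smooth_op.add)
next
  case (mult A B)
  from mult.IH obtain DA DB where
    "\<And>u. (A has_derivative DA u) (at u)" "\<And>X. smooth_op X \<Longrightarrow> smooth_op (\<lambda>u. DA u (X u))"
    "\<And>u. (B has_derivative DB u) (at u)" "\<And>X. smooth_op X \<Longrightarrow> smooth_op (\<lambda>u. DB u (X u))"
    by blast
  then show ?case
    by (intro exI[of _ "\<lambda>u h. A u * DB u h + DA u h * B u"] conjI allI impI
        has_derivative_mult smooth_op.add smooth_op.mult mult.hyps) auto
next
  case (lin L A)
  from lin.IH obtain DA where
    "\<And>u. (A has_derivative DA u) (at u)" "\<And>X. smooth_op X \<Longrightarrow> smooth_op (\<lambda>u. DA u (X u))"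
    by blast
  then show ?case
    by (intro exI[of _ "\<lambda>u h. L (DA u h)"])
       (auto intro: bounded_linear.has_derivative[OF lin.hyps(1)] smooth_op.lin[OF lin.hyps(1)])
next
  case (nemytskii q A j)
  from nemytskii.IH obtain DA where DA:
    "\<And>u. (A has_derivative DA u) (at u)" "\<And>X. smooth_op X \<Longrightarrow> smooth_op (\<lambda>u. DA u (X u))"
    by blast
  have "((\<lambda>u. nemytskii (q j) (A u)) has_derivative
      (\<lambda>h. nemytskii (q (Suc j)) (A u) * DA u h)) (at u)" for u
    using nemytskii.hyps(1) by (intro has_derivative_compose[OF DA(1) has_derivative_nemytskii])
      (auto simp: smooth_family_def)
  then show ?case
    using DA(2) nemytskii.hyps
    by (intro exI[of _ "\<lambda>u h. nemytskii (q (Suc j)) (A u) * DA u h"])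
       (auto intro: smooth_op.mult smooth_op.nemytskii)
next
  case (recip A)
  from recip.IH obtain DA where DA:
    "\<And>u. (A has_derivative DA u) (at u)" "\<And>X. smooth_op X \<Longrightarrow> smooth_op (\<lambda>u. DA u (X u))"
    by blast
  let ?i = "\<lambda>u. inverse (avg (A u))"
  let ?D = "\<lambda>u h. of_real (- (?i u * avg (DA u h) * ?i u)) :: c0"
  have "((\<lambda>u. of_real (?i u) :: c0) has_derivative ?D u) (at u)" for u
  proof -
    have "((\<lambda>u. avg (A u)) has_derivative (\<lambda>h. avg (DA u h))) (at u)"
      by (rule bounded_linear.has_derivative[OF bounded_linear_avg DA(1)])
    from recip.hyps(2)[of u] this
    have "((\<lambda>u. ?i u) has_derivative (\<lambda>h. - (?i u * avg (DA u h) * ?i u))) (at u)"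
      by (rule Deriv.has_derivative_inverse)
    then show ?thesis
      by (rule bounded_linear.has_derivative[OF bounded_linear_of_real])
  qed
  moreover have "smooth_op (\<lambda>u. ?D u (X u))" if "smooth_op X" for X
    unfolding of_real_minus of_real_mult
    using smooth_op.recip[OF recip.hyps] smooth_op_avg[OF DA(2)[OF that]]
    by (intro smooth_op_minus smooth_op.mult)
  ultimately show ?case by (intro exI[of _ ?D] conjI allI impI)
next
  case (linz_inv A B)
  from linz_inv.IH obtain DA DB where D:
    "\<And>u. (A has_derivative DA u) (at u)" "\<And>X. smooth_op X \<Longrightarrow> smooth_op (\<lambda>u. DA u (X u))"
    "\<And>u. (B has_derivative DB u) (at u)" "\<And>X. smooth_op X \<Longrightarrow> smooth_op (\<lambda>u. DB u (X u))"
    by blast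
  let ?D = "\<lambda>u h. linz_inv (A u) (DB u h - k1 (DA u h * linz_inv (A u) (B u)))"
  have "((\<lambda>u. linz_inv (A u) (B u)) has_derivative ?D u) (at u)" for u
    using has_derivative_compose[OF has_derivative_Pair[OF D(1,3)] has_derivative_linz_inv, of u]
    by simp
  moreover have "smooth_op (\<lambda>u. ?D u (X u))" if "smooth_op X" for X
    by (intro smooth_op.linz_inv smooth_op_diff smooth_op_k1 smooth_op.mult D that linz_inv.hyps)
  ultimately show ?case by (intro exI[of _ ?D] conjI allI impI)
qed

text \<open>Real functions are viewed as operators with constant values, so that one inductive class
  suffices; \<open>avg\<close> reads the number back.\<close>

definition smooth_fun :: "(c0 \<Rightarrow> real) \<Rightarrow> bool" where
  "smooth_fun \<rho> \<longleftrightarrow> smooth_op (\<lambda>u. of_real (\<rho> u))"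

lemma smooth_fun_const: "smooth_fun (\<lambda>u. c)"
  by (simp add: smooth_fun_def smooth_op.const)

lemma smooth_fun_add: "smooth_fun \<rho> \<Longrightarrow> smooth_fun \<sigma> \<Longrightarrow> smooth_fun (\<lambda>u. \<rho> u + \<sigma> u)"
  by (simp add: smooth_fun_def smooth_op.add)

lemma smooth_fun_mult: "smooth_fun \<rho> \<Longrightarrow> smooth_fun \<sigma> \<Longrightarrow> smooth_fun (\<lambda>u. \<rho> u * \<sigma> u)"
  by (simp add: smooth_fun_def smooth_op.mult)

lemma smooth_fun_avg: "smooth_op A \<Longrightarrow> smooth_fun (\<lambda>u. avg (A u))"
  by (simp add: smooth_fun_def smooth_op_avg)

lemma smooth_fun_divide_avg:
  "smooth_fun \<rho> \<Longrightarrow> smooth_op A \<Longrightarrow> (\<And>u. avg (A u) \<noteq> 0) \<Longrightarrow> smooth_fun (\<lambda>u. \<rho> u / avg (A u))"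
  using smooth_op.mult[OF _ smooth_op.recip, of "\<lambda>u. of_real (\<rho> u)" A]
  by (simp add: smooth_fun_def divide_inverse)

lemma smooth_fun_deriv:
  assumes "smooth_fun \<rho>"
  shows "(\<rho> has_derivative frechet_derivative \<rho> (at u)) (at u)"
    and "smooth_op X \<Longrightarrow> smooth_fun (lie X \<rho>)"
proof -
  obtain D where D: "\<And>u. ((\<lambda>u. of_real (\<rho> u) :: c0) has_derivative D u) (at u)"
    "\<And>X. smooth_op X \<Longrightarrow> smooth_op (\<lambda>u. D u (X u))"
    using smooth_op_deriv[OF assms[unfolded smooth_fun_def]] by blast
  have d: "(\<rho> has_derivative (\<lambda>h. avg (D u h))) (at u)" for u
    using bounded_linear.has_derivative[OF bounded_linear_avg D(1)[of u]] by simp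
  then show "(\<rho> has_derivative frechet_derivative \<rho> (at u)) (at u)"
    using frechet_derivative_at by metis
  have "lie X \<rho> u = avg (D u (X u))" for u
    unfolding lie_def using fun_cong[OF frechet_derivative_at[OF d]] by simp
  then show "smooth_fun (lie X \<rho>)" if "smooth_op X"
    using smooth_fun_avg[OF D(2)[OF that]] by (simp add: smooth_fun_def)
qed

lemma lie_eqI: "(\<rho> has_derivative D) (at u) \<Longrightarrow> lie X \<rho> u = D (X u)"
  unfolding lie_def using frechet_derivative_at by metis

lemma lie_add:
  assumes "smooth_fun \<rho>" "smooth_fun \<sigma>"
  shows "lie X (\<lambda>u. \<rho> u + \<sigma> u) = (\<lambda>u. lie X \<rho> u + lie X \<sigma> u)"
  by (rule ext, rule lie_eqI[OF has_derivative_add[OF smooth_fun_deriv(1)[OF assms(1)]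
        smooth_fun_deriv(1)[OF assms(2)]], THEN trans]) (simp add: lie_def)

lemma lie_mult:
  assumes "smooth_fun \<rho>" "smooth_fun \<sigma>"
  shows "lie X (\<lambda>u. \<rho> u * \<sigma> u) = (\<lambda>u. \<rho> u * lie X \<sigma> u + lie X \<rho> u * \<sigma> u)"
  by (rule ext, rule lie_eqI[OF has_derivative_mult[OF smooth_fun_deriv(1)[OF assms(1)]
        smooth_fun_deriv(1)[OF assms(2)]], THEN trans]) (simp add: lie_def)

lemma lie_linear_combination:
  assumes "smooth_fun \<rho>" and "X u = of_real a * Y u + of_real b * Z u"
  shows "lie X \<rho> u = a * lie Y \<rho> u + b * lie Z \<rho> u"
proof -
  have "linear (frechet_derivative \<rho> (at u))"
    using smooth_fun_deriv(1)[OF assms(1)] has_derivative_linear by blast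
  then show ?thesis
    using assms(2) by (simp add: lie_def of_real_def linear_add linear_scale)
qed

lemma smooth_fun_lie_funpow:
  "smooth_fun \<rho> \<Longrightarrow> smooth_op X \<Longrightarrow> smooth_fun ((lie X ^^ j) \<rho>)"
  by (induction j) (simp_all add: smooth_fun_deriv(2))

subsection \<open>Ideals generated by iterated Lie derivatives\<close>

text \<open>The ideal over the ring of smooth functions. Indices start at 1, so \<theta> 0 = \<Phi>
  is no generator and for n = 0 only the zero function remains.\<close>

inductive lie_ideal :: "(nat \<Rightarrow> c0 \<Rightarrow> real) \<Rightarrow> nat \<Rightarrow> (c0 \<Rightarrow> real) \<Rightarrow> bool" for \<theta> n where
  gen: "1 \<le> i \<Longrightarrow> i \<le> n \<Longrightarrow> lie_ideal \<theta> n (\<theta> i)"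
| zero: "lie_ideal \<theta> n (\<lambda>u. 0)"
| plus: "lie_ideal \<theta> n \<rho> \<Longrightarrow> lie_ideal \<theta> n \<sigma> \<Longrightarrow> lie_ideal \<theta> n (\<lambda>u. \<rho> u + \<sigma> u)"
| times: "smooth_fun c \<Longrightarrow> lie_ideal \<theta> n \<rho> \<Longrightarrow> lie_ideal \<theta> n (\<lambda>u. c u * \<rho> u)"

lemma lie_ideal_mono: "lie_ideal \<theta> n \<rho> \<Longrightarrow> n \<le> m \<Longrightarrow> lie_ideal \<theta> m \<rho>"
  by (induction rule: lie_ideal.induct) (auto intro: lie_ideal.intros)

lemma lie_ideal_smooth:
  "lie_ideal \<theta> n \<rho> \<Longrightarrow> (\<And>i. smooth_fun (\<theta> i)) \<Longrightarrow> smooth_fun \<rho>"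
  by (induction rule: lie_ideal.induct)
     (auto intro: smooth_fun_const smooth_fun_add smooth_fun_mult)

lemma lie_ideal_zero:
  "lie_ideal \<theta> n \<rho> \<Longrightarrow> (\<And>i. 1 \<le> i \<Longrightarrow> i \<le> n \<Longrightarrow> \<theta> i u = 0) \<Longrightarrow> \<rho> u = 0"
  by (induction rule: lie_ideal.induct) auto

text \<open>At a common zero of the generators the Leibniz terms containing an undifferentiated
  member of the ideal vanish.\<close>

lemma lie_ideal_deriv:
  assumes "lie_ideal \<theta> n \<rho>" and sm: "\<And>i. smooth_fun (\<theta> i)"
    and z: "\<And>i. 1 \<le> i \<Longrightarrow> i \<le> n \<Longrightarrow> \<theta> i u = 0"
  shows "\<exists>a. \<forall>h. frechet_derivative \<rho> (at u) h = (\<Sum>i=1..n. a i * frechet_derivative (\<theta> i) (at u) h)"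
  using assms(1)
proof induction
  case (gen i)
  have "(\<Sum>l=1..n. (if l = i then 1 else 0) * frechet_derivative (\<theta> l) (at u) h)
      = frechet_derivative (\<theta> i) (at u) h" for h
    using gen by (simp add: if_distrib[of "\<lambda>x. x * _"] cong: if_cong)
  then show ?case by (intro exI[of _ "\<lambda>l. if l = i then 1 else 0"]) simp
next
  case zero
  show ?case by (intro exI[of _ "\<lambda>i. 0"]) simp
next
  case (plus \<rho> \<sigma>)
  obtain a where
    "\<forall>h. frechet_derivative \<rho> (at u) h = (\<Sum>i=1..n. a i * frechet_derivative (\<theta> i) (at u) h)"
    using plus.IH(1) by (rule exE)
  moreover obtain b where
    "\<forall>h. frechet_derivative \<sigma> (at u) h = (\<Sum>i=1..n. b i * frechet_derivative (\<theta> i) (at u) h)"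
    using plus.IH(2) by (rule exE)
  moreover have "frechet_derivative (\<lambda>u. \<rho> u + \<sigma> u) (at u) =
      (\<lambda>h. frechet_derivative \<rho> (at u) h + frechet_derivative \<sigma> (at u) h)"
    by (intro frechet_derivative_at[symmetric] has_derivative_add smooth_fun_deriv(1)
        lie_ideal_smooth[OF plus.hyps(1) sm] lie_ideal_smooth[OF plus.hyps(2) sm])
  ultimately show ?case
    by (intro exI[of _ "\<lambda>i. a i + b i"]) (simp add: distrib_right sum.distrib)
next
  case (times c \<rho>)
  obtain a where
    "\<forall>h. frechet_derivative \<rho> (at u) h = (\<Sum>i=1..n. a i * frechet_derivative (\<theta> i) (at u) h)"
    using times.IH by (rule exE)
  moreover have "frechet_derivative (\<lambda>u. c u * \<rho> u) (at u) =
      (\<lambda>h. c u * frechet_derivative \<rho> (at u) h + frechet_derivative c (at u) h * \<rho> u)"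
    by (intro frechet_derivative_at[symmetric] has_derivative_mult smooth_fun_deriv(1)
        times.hyps(1) lie_ideal_smooth[OF times.hyps(2) sm])
  moreover have "\<rho> u = 0" using lie_ideal_zero[OF times.hyps(2)] z by blast
  ultimately show ?case
    by (intro exI[of _ "\<lambda>i. c u * a i"]) (simp add: sum_distrib_left mult.assoc)
qed

text \<open>The coefficient of Z carries the factor V\<Phi>, the first generator of the ideal, so Z
  contributes only ideal terms. The formula for w\<Phi> is a separate assumption because
  \<open>w_eq\<close> alone yields the factor m + b Z\<Phi>, which is not visibly nonzero.\<close>

locale proportional_fields =
  fixes w V Z :: "c0 \<Rightarrow> c0" and \<Phi> m b :: "c0 \<Rightarrow> real"
  assumes V: "smooth_op V" and Z: "smooth_op Z" and w: "smooth_op w"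
    and \<Phi>: "smooth_fun \<Phi>" and m: "smooth_fun m" "\<And>u. m u \<noteq> 0"
    and b: "smooth_fun b" "\<And>u. b u \<noteq> 0"
    and w_eq: "\<And>u. w u = of_real (m u) * V u + of_real (b u * lie V \<Phi> u) * Z u"
    and w_\<Phi>: "\<And>u. lie w \<Phi> u = m u * b u * lie V \<Phi> u"
begin

abbreviation \<theta> :: "nat \<Rightarrow> c0 \<Rightarrow> real" where
  "\<theta> j \<equiv> (lie V ^^ j) \<Phi>"

lemma smooth_\<theta>: "smooth_fun (\<theta> j)"
  by (rule smooth_fun_lie_funpow[OF \<Phi> V])

text \<open>On a generator, w produces the next generator and, through Z, a multiple of the first;
  the Leibniz rule does the rest.\<close>

lemma lie_w_ideal:
  assumes "lie_ideal \<theta> n \<rho>"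
  shows "lie_ideal \<theta> (Suc n) (lie w \<rho>)"
  using assms
proof induction
  case (gen i)
  have "lie w (\<theta> i) = (\<lambda>u. m u * \<theta> (Suc i) u + (b u * lie Z (\<theta> i) u) * \<theta> 1 u)"
  proof
    fix u
    show "lie w (\<theta> i) u = m u * \<theta> (Suc i) u + (b u * lie Z (\<theta> i) u) * \<theta> 1 u"
      using lie_linear_combination[where X = w and Y = V and Z = Z, OF smooth_\<theta> w_eq] by simp
  qed
  moreover have "smooth_fun (\<lambda>u. b u * lie Z (\<theta> i) u)"
    by (intro smooth_fun_mult b smooth_fun_deriv(2) smooth_\<theta> Z)
  moreover have "lie_ideal \<theta> (Suc n) (\<theta> (Suc i))" "lie_ideal \<theta> (Suc n) (\<theta> 1)"
    using gen by (intro lie_ideal.gen; simp)+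
  ultimately show ?case
    using m(1) by (simp only:) (intro lie_ideal.plus lie_ideal.times)
next
  case zero
  have "lie w (\<lambda>u. 0) = (\<lambda>u. 0)"
    by (rule ext, rule lie_eqI[OF has_derivative_const])
  then show ?case by (simp add: lie_ideal.zero)
next
  case (plus \<rho> \<sigma>)
  moreover have "smooth_fun \<rho>" "smooth_fun \<sigma>"
    by (rule lie_ideal_smooth[OF plus.hyps(1) smooth_\<theta>], rule lie_ideal_smooth[OF plus.hyps(2) smooth_\<theta>])
  ultimately show ?case by (simp add: lie_add lie_ideal.plus)
next
  case (times c \<rho>)
  have "lie_ideal \<theta> (Suc n) (\<lambda>u. lie w c u * \<rho> u)"
    by (intro lie_ideal.times smooth_fun_deriv(2) w times.hyps(1) lie_ideal_mono[OF times.hyps(2)]) simp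
  moreover have "lie_ideal \<theta> (Suc n) (\<lambda>u. c u * lie w \<rho> u)"
    using times by (intro lie_ideal.times)
  moreover have "smooth_fun \<rho>"
    by (rule lie_ideal_smooth[OF times.hyps(2) smooth_\<theta>])
  ultimately show ?case
    using times.hyps(1) by (simp add: lie_mult lie_ideal.plus)
qed

lemma lie_w_funpow:
  assumes "1 \<le> j"
  shows "\<exists>\<mu> \<rho>. smooth_fun \<mu> \<and> (\<forall>u. \<mu> u \<noteq> 0) \<and> lie_ideal \<theta> (j - 1) \<rho> \<and>
    (lie w ^^ j) \<Phi> = (\<lambda>u. \<mu> u * \<theta> j u + \<rho> u)"
  using assms
proof (induction j rule: dec_induct)
  case base
  have "lie w \<Phi> = (\<lambda>u. m u * b u * lie V \<Phi> u + 0)" by (simp add: w_\<Phi> fun_eq_iff)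
  moreover have "smooth_fun (\<lambda>u. m u * b u)" by (intro smooth_fun_mult m b)
  ultimately show ?case
    using m b lie_ideal.zero by (intro exI[of _ "\<lambda>u. m u * b u"] exI[of _ "\<lambda>u. 0"]) auto
next
  case (step j)
  then obtain \<mu> \<rho> where \<mu>: "smooth_fun \<mu>" "\<And>u. \<mu> u \<noteq> 0" and \<rho>: "lie_ideal \<theta> (j - 1) \<rho>"
    and eq: "(lie w ^^ j) \<Phi> = (\<lambda>u. \<mu> u * \<theta> j u + \<rho> u)" by blast
  \<comment> \<open>The new remainder: the Z-term is a multiple of \<theta> 1, the derivative of
    \<mu> multiplies \<theta> j, and differentiating \<rho> raises the ideal index by one.\<close>
  let ?\<sigma> = "\<lambda>u. (\<mu> u * (b u * lie Z (\<theta> j) u)) * \<theta> 1 u + (lie w \<mu> u * \<theta> j u + lie w \<rho> u)"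
  have "lie_ideal \<theta> j ?\<sigma>"
  proof (intro lie_ideal.plus lie_ideal.times smooth_fun_mult smooth_fun_deriv(2) \<mu> b Z w smooth_\<theta>)
    show "lie_ideal \<theta> j (\<theta> 1)" "lie_ideal \<theta> j (\<theta> j)"
      using step(1) by (intro lie_ideal.gen; simp)+
    show "lie_ideal \<theta> j (lie w \<rho>)"
      using lie_w_ideal[OF \<rho>] step(1) by simp
  qed
  moreover have "(lie w ^^ Suc j) \<Phi> = (\<lambda>u. \<mu> u * m u * \<theta> (Suc j) u + ?\<sigma> u)"
  proof
    fix u
    have "smooth_fun \<rho>" by (rule lie_ideal_smooth[OF \<rho> smooth_\<theta>])
    then have "(lie w ^^ Suc j) \<Phi> u = \<mu> u * lie w (\<theta> j) u + lie w \<mu> u * \<theta> j u + lie w \<rho> u"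
      using \<mu>(1) smooth_\<theta>[of j] by (simp add: eq lie_add lie_mult smooth_fun_mult)
    also have "lie w (\<theta> j) u = m u * \<theta> (Suc j) u + b u * lie V \<Phi> u * lie Z (\<theta> j) u"
      using lie_linear_combination[where X = w and Y = V and Z = Z, OF smooth_\<theta> w_eq] by simp
    finally show "(lie w ^^ Suc j) \<Phi> u = \<mu> u * m u * \<theta> (Suc j) u + ?\<sigma> u"
      by (simp add: algebra_simps)
  qed
  moreover have "smooth_fun (\<lambda>u. \<mu> u * m u)" by (intro smooth_fun_mult \<mu> m)
  ultimately show ?case
    using \<mu>(2) m(2) by (intro exI[of _ "\<lambda>u. \<mu> u * m u"] exI[of _ ?\<sigma>]) simp
qed

end

text \<open>The systems differ by a lower triangular matrix with nonzero diagonal: prescribed values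
  are converted by forward substitution in one direction and by direct evaluation in the
  other.\<close>

lemma triangular_surj_iff:
  fixes A B :: "nat \<Rightarrow> 'a \<Rightarrow> real"
  assumes B: "\<And>i h. i \<in> {1..n} \<Longrightarrow> B i h = \<mu> i * A i h + (\<Sum>l=1..i-1. a i l * A l h)"
    and \<mu>: "\<And>i. i \<in> {1..n} \<Longrightarrow> \<mu> i \<noteq> 0"
  shows "(\<forall>y. \<exists>h. \<forall>i\<in>{1..n}. A i h = y i) \<longleftrightarrow> (\<forall>y. \<exists>h. \<forall>i\<in>{1..n}. B i h = y i)"
proof (intro iffI allI)
  fix y :: "nat \<Rightarrow> real"
  assume A: "\<forall>y. \<exists>h. \<forall>i\<in>{1..n}. A i h = y i"
  have "\<exists>x. \<forall>i\<in>{1..m}. \<mu> i * x i + (\<Sum>l=1..i-1. a i l * x l) = y i" if "m \<le> n" for m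
    using that
  proof (induction m)
    case (Suc m)
    then obtain x where x: "\<forall>i\<in>{1..m}. \<mu> i * x i + (\<Sum>l=1..i-1. a i l * x l) = y i" by auto
    define x' where "x' = x(Suc m := (y (Suc m) - (\<Sum>l=1..m. a (Suc m) l * x l)) / \<mu> (Suc m))"
    have sums: "(\<Sum>l=1..i-1. a i l * x' l) = (\<Sum>l=1..i-1. a i l * x l)" if "i \<le> Suc m" for i
      using that by (intro sum.cong) (auto simp: x'_def)
    have "\<mu> i * x' i + (\<Sum>l=1..i-1. a i l * x' l) = y i" if "i \<in> {1..Suc m}" for i
    proof (cases "i = Suc m")
      case True
      then show ?thesis using sums[of i] \<mu>[of i] Suc.prems by (simp add: x'_def)
    next
      case False
      then show ?thesis using sums[of i] x that by (simp add: x'_def)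
    qed
    then show ?case by blast
  qed simp
  then obtain x where x: "\<forall>i\<in>{1..n}. \<mu> i * x i + (\<Sum>l=1..i-1. a i l * x l) = y i" by blast
  obtain h where h: "\<forall>i\<in>{1..n}. A i h = x i" using A by blast
  have "B i h = y i" if i: "i \<in> {1..n}" for i
  proof -
    have "(\<Sum>l=1..i-1. a i l * A l h) = (\<Sum>l=1..i-1. a i l * x l)"
      using h i by (intro sum.cong) auto
    then show ?thesis using B[OF i] h x i by simp
  qed
  then show "\<exists>h. \<forall>i\<in>{1..n}. B i h = y i" by blast
next
  fix y :: "nat \<Rightarrow> real"
  assume surjB: "\<forall>y. \<exists>h. \<forall>i\<in>{1..n}. B i h = y i"
  obtain h where h: "\<forall>i\<in>{1..n}. B i h = \<mu> i * y i + (\<Sum>l=1..i-1. a i l * y l)"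
    using surjB[rule_format, of "\<lambda>i. \<mu> i * y i + (\<Sum>l=1..i-1. a i l * y l)"] by blast
  have "i \<in> {1..n} \<Longrightarrow> A i h = y i" for i
  proof (induction i rule: less_induct)
    case (less i)
    have "(\<Sum>l=1..i-1. a i l * A l h) = (\<Sum>l=1..i-1. a i l * y l)"
      using less by (intro sum.cong) auto
    then have "\<mu> i * A i h = \<mu> i * y i"
      using B[OF less.prems, of h] h less.prems by auto
    then show ?case using \<mu>[OF less.prems] by simp
  qed
  then show "\<exists>h. \<forall>i\<in>{1..n}. A i h = y i" by blast
qed

context proportional_fields
begin

lemma lie_w_zero_iff:
  "(\<forall>j\<in>{1..k}. (lie w ^^ j) \<Phi> u = 0) \<longleftrightarrow> (\<forall>j\<in>{1..k}. \<theta> j u = 0)"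
proof (induction k)
  case (Suc k)
  obtain \<mu> \<rho> where "\<forall>u. \<mu> u \<noteq> 0" "lie_ideal \<theta> k \<rho>"
    "(lie w ^^ Suc k) \<Phi> = (\<lambda>u. \<mu> u * \<theta> (Suc k) u + \<rho> u)"
    using lie_w_funpow[of "Suc k"] unfolding diff_Suc_1 by auto
  then have *: "\<mu> u \<noteq> 0" "lie_ideal \<theta> k \<rho>"
    "(lie w ^^ Suc k) \<Phi> u = \<mu> u * \<theta> (Suc k) u + \<rho> u"
    by (simp_all only: not_False_eq_True)
  have "\<rho> u = 0" if "\<forall>j\<in>{1..k}. \<theta> j u = 0"
    using lie_ideal_zero[OF *(2)] that by auto
  then show ?case
    using Suc.IH * by (auto simp: atLeastAtMostSuc_conv simp del: funpow.simps)
qed simp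

text \<open>At a common zero the two families of derivatives are related triangularly by
  \<open>lie_ideal_deriv\<close>. The map \<open>L\<close> restricts the directions, later to those
  coming from B^1.\<close>

lemma lie_w_surj_iff:
  fixes L :: "'b \<Rightarrow> c0"
  assumes "\<forall>j\<in>{1..n}. \<theta> j u = 0"
  shows "(\<forall>y. \<exists>h. \<forall>j\<in>{1..n}. frechet_derivative (\<theta> j) (at u) (L h) = y j) \<longleftrightarrow>
    (\<forall>y. \<exists>h. \<forall>j\<in>{1..n}. frechet_derivative ((lie w ^^ j) \<Phi>) (at u) (L h) = y j)"
proof -
  define Q where "Q j \<mu> a \<longleftrightarrow> \<mu> \<noteq> 0 \<and> (\<forall>h. frechet_derivative ((lie w ^^ j) \<Phi>) (at u) h
      = \<mu> * frechet_derivative (\<theta> j) (at u) h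
        + (\<Sum>l=1..j-1. a l * frechet_derivative (\<theta> l) (at u) h))" for j \<mu> and a :: "nat \<Rightarrow> real"
  have "\<exists>\<mu> a. Q j \<mu> a"
    if j: "j \<in> {1..n}" for j
  proof -
    obtain \<mu> \<rho> where \<mu>: "smooth_fun \<mu>" "\<mu> u \<noteq> 0" and \<rho>: "lie_ideal \<theta> (j - 1) \<rho>"
      and eq: "(lie w ^^ j) \<Phi> = (\<lambda>u. \<mu> u * \<theta> j u + \<rho> u)"
      using lie_w_funpow[of j] j by auto
    have "\<exists>a. \<forall>h. frechet_derivative \<rho> (at u) h
        = (\<Sum>l=1..j-1. a l * frechet_derivative (\<theta> l) (at u) h)"
      by (rule lie_ideal_deriv[OF \<rho> smooth_\<theta>]) (use assms j in auto)
    then obtain a where a: "\<forall>h. frechet_derivative \<rho> (at u) h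
        = (\<Sum>l=1..j-1. a l * frechet_derivative (\<theta> l) (at u) h)"
      by (rule exE)
    have "frechet_derivative ((lie w ^^ j) \<Phi>) (at u) = (\<lambda>h. (\<mu> u * frechet_derivative (\<theta> j) (at u) h
        + frechet_derivative \<mu> (at u) h * \<theta> j u) + frechet_derivative \<rho> (at u) h)"
      unfolding eq
      by (intro frechet_derivative_at[symmetric] has_derivative_add has_derivative_mult
          smooth_fun_deriv(1) smooth_\<theta> \<mu>(1) lie_ideal_smooth[OF \<rho> smooth_\<theta>])
    then show ?thesis
      unfolding Q_def using a \<mu>(2) assms j by (intro exI[of _ "\<mu> u"] exI[of _ a]) simp
  qed
  then obtain \<mu> a where "\<And>j. j \<in> {1..n} \<Longrightarrow> Q j (\<mu> j) (a j)"
    by metis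
  then show ?thesis
    by (intro triangular_surj_iff[of n _ \<mu> _ a]) (simp_all only: Q_def not_False_eq_True)
qed

end

subsection \<open>The nonlinearity\<close>

lemma circle_fun_bounded:
  assumes "circle_fun q"
  obtains L where "\<And>t x. \<bar>x\<bar> \<le> B \<Longrightarrow> \<bar>q t x\<bar> \<le> L"
proof -
  have "compact ((\<lambda>(t, x). q t x) ` ({0..1} \<times> {-B..B}))"
    using assms by (intro compact_continuous_image compact_Times compact_Icc)
      (auto simp: circle_fun_def elim: continuous_on_subset)
  from compact_imp_bounded[OF this]
  obtain L where L: "\<forall>y\<in>(\<lambda>(t, x). q t x) ` ({0..1} \<times> {-B..B}). norm y \<le> L"
    unfolding bounded_iff by (rule exE)
  show thesis
  proof
    fix t x :: real assume "\<bar>x\<bar> \<le> B"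
    then have *: "q (frac t) x \<in> (\<lambda>(t, x). q t x) ` ({0..1} \<times> {-B..B})"
      using frac_lt_1[of t] by (intro image_eqI[of _ _ "(frac t, x)"]) (auto simp: less_imp_le)
    have "q t = q (frac t)"
      using assms periodic_of_int[of q "frac t" "\<lfloor>t\<rfloor>"] by (simp add: circle_fun_def frac_def)
    then show "\<bar>q t x\<bar> \<le> L" using bspec[OF L *] by simp
  qed
qed

lemma smooth_differentiable: "smooth g \<Longrightarrow> g differentiable at x"
  unfolding smooth_def by (metis Ck.simps(2))

lemma smooth_continuous: "smooth g \<Longrightarrow> continuous_on A g"
  unfolding smooth_def by (metis Ck.simps(1) continuous_on_subset top_greatest)

lemma smooth_frechet: "smooth g \<Longrightarrow> smooth (\<lambda>x. frechet_derivative g (at x) h)"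
  unfolding smooth_def by (metis Ck.simps(2))

text \<open>The partial derivative is the total derivative in the direction (0, 1), so smoothness is
  inherited.\<close>

lemma smooth_D2:
  fixes q :: "real \<Rightarrow> real \<Rightarrow> real"
  assumes "smooth (\<lambda>(t, x). q t x)"
  shows "(q t has_real_derivative D2 q t x) (at x)"
    and "smooth (\<lambda>(t, x). D2 q t x)"
proof -
  let ?g = "\<lambda>(t, x). q t x"
  have d: "(q t has_real_derivative frechet_derivative ?g (at (t, x)) (0, 1)) (at x)" for t x
  proof -
    have g: "(?g has_derivative frechet_derivative ?g (at (t, x))) (at (t, x))"
      using smooth_differentiable[OF assms] frechet_derivative_works by blast
    have "((\<lambda>x. ?g (t, x)) has_derivative (\<lambda>h. frechet_derivative ?g (at (t, x)) (0, h))) (at x)"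
      by (rule has_derivative_compose[OF has_derivative_Pair[OF has_derivative_const has_derivative_ident] g])
    moreover have "(\<lambda>h. frechet_derivative ?g (at (t, x)) (0, h))
        = (*) (frechet_derivative ?g (at (t, x)) (0, 1))"
    proof
      fix h
      show "frechet_derivative ?g (at (t, x)) (0, h) = frechet_derivative ?g (at (t, x)) (0, 1) * h"
        using linear_scale[OF has_derivative_linear[OF g], of h "(0, 1)"] by simp
    qed
    ultimately show ?thesis by (simp only: has_field_derivative_def split_conv)
  qed
  then have D2: "D2 q t x = frechet_derivative ?g (at (t, x)) (0, 1)" for t x
    unfolding D2_def by (rule DERIV_imp_deriv)
  show "(q t has_real_derivative D2 q t x) (at x)" using d by (simp add: D2)
  have "(\<lambda>(t, x). D2 q t x) = (\<lambda>z. frechet_derivative ?g (at z) (0, 1))"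
    by (auto simp: D2)
  then show "smooth (\<lambda>(t, x). D2 q t x)" using smooth_frechet[OF assms] by simp
qed

lemma smooth_family_D2:
  assumes "periodic f" "smooth (\<lambda>(t, x). f t x)"
  shows "smooth_family (\<lambda>j. (D2 ^^ j) f)"
proof -
  have *: "periodic ((D2 ^^ j) f) \<and> smooth (\<lambda>(t, x). (D2 ^^ j) f t x)" for j
  proof (induction j)
    case (Suc j)
    have "periodic (D2 q)" if "periodic q" for q
      using that by (simp add: periodic_def D2_def[abs_def])
    then show ?case using Suc.IH smooth_D2(2)[of "(D2 ^^ j) f"] by simp
  qed (simp add: assms)
  show ?thesis
    unfolding smooth_family_def circle_fun_def
    using * by (auto intro: smooth_D2(1) smooth_continuous)
qed

section \<open>The fields \<open>w\<close>, \<open>V\<close>, \<open>Z\<close> on continuous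
  functions\<close>

locale circle_nonlinearity =
  fixes f :: "real \<Rightarrow> real \<Rightarrow> real"
  assumes family: "smooth_family (\<lambda>j. (D2 ^^ j) f)"
begin

definition g :: "c0 \<Rightarrow> c0" where "g u = nemytskii (D2 f) u"
definition w :: "c0 \<Rightarrow> c0" where "w u = c0_exp (- k1 (g u))"
definition V :: "c0 \<Rightarrow> c0" where "V u = linz_inv (g u) 1"
text \<open>\<open>Z\<close> undoes the term k1(w) in \<open>linz (g u) (w u)\<close>, the only
  obstruction to \<open>w\<close> being a multiple of \<open>V\<close>.\<close>

definition Z :: "c0 \<Rightarrow> c0" where "Z u = linz_inv (g u) (k1 (w u))"
definition \<Phi> :: "c0 \<Rightarrow> real" where "\<Phi> u = avg (nemytskii f u)"
definition G :: "c0 \<Rightarrow> c0" where "G u = u + k1 (nemytskii f u)"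

lemma circle_fun_f: "circle_fun f" and circle_fun_D2: "circle_fun (D2 f)"
  and deriv_f: "(f t has_real_derivative D2 f t x) (at x)"
  using family unfolding smooth_family_def
  by (metis funpow_0, metis One_nat_def funpow_0 funpow_simps_right(2) comp_apply,
      metis funpow.simps comp_apply id_apply)

lemma smooth_g: "smooth_op g"
  using smooth_op.nemytskii[OF family smooth_op.ident, of 1] by (simp add: g_def[abs_def])

lemma smooth_exp: "smooth_op A \<Longrightarrow> smooth_op (\<lambda>u. c0_exp (A u))"
  using smooth_op.nemytskii[OF smooth_family_exp] by simp

lemma smooth_w: "smooth_op w"
  unfolding w_def[abs_def] by (intro smooth_exp smooth_op_minus smooth_op_k1 smooth_g)

lemma smooth_V: "smooth_op V"
  unfolding V_def[abs_def] by (intro smooth_op.linz_inv smooth_op.const smooth_g)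

lemma smooth_Z: "smooth_op Z"
  unfolding Z_def[abs_def] by (intro smooth_op.linz_inv smooth_op_k1 smooth_w smooth_g)

lemma smooth_\<Phi>: "smooth_fun \<Phi>"
  using smooth_fun_avg[OF smooth_op.nemytskii[OF family smooth_op.ident, of 0]]
  by (simp add: \<Phi>_def[abs_def])

lemma nemytskii_f_deriv: "(nemytskii f has_derivative (\<lambda>h. g u * h)) (at u)"
  unfolding g_def by (rule has_derivative_nemytskii[OF circle_fun_f circle_fun_D2 deriv_f])

lemma lie_\<Phi>: "lie X \<Phi> u = avg (g u * X u)"
  using lie_eqI[OF bounded_linear.has_derivative[OF bounded_linear_avg nemytskii_f_deriv]]
  by (simp add: \<Phi>_def[abs_def])

lemma w_deriv: "(Rep_c0 (w u) has_real_derivative Rep_c0 (of_real (avg (g u)) * w u - g u * w u) t) (at t)"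
  unfolding w_def by (rule DERIV_cong[OF exp_minus_k1_deriv]) (simp add: algebra_simps)

lemma avg_w_pos: "0 < avg (w u)"
  unfolding w_def by (rule avg_pos) simp

lemma avg_g_w: "avg (g u * w u) = avg (g u) * avg (w u)"
  using avg_deriv_0[OF w_deriv, of u] by (simp add: avg_diff)

lemma w_decomposition: "w u = of_real (avg (w u)) * V u + of_real (avg (g u)) * Z u"
proof -
  have "w u = of_real (avg (w u)) + k1 (of_real (avg (g u)) * w u - g u * w u)"
    by (rule c0_eq_avg_plus_k1) (rule w_deriv)
  then have "w u = of_real (avg (w u)) + of_real (avg (g u)) * k1 (w u) - k1 (g u * w u)"
    by (simp only: k1_diff k1_of_real_mult add_diff_eq)
  then have "linz (g u) (w u) = of_real (avg (w u)) + of_real (avg (g u)) * k1 (w u)"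
    by (simp only: linz_def eq_diff_eq)
  also have "\<dots> = linz (g u) (of_real (avg (w u)) * V u + of_real (avg (g u)) * Z u)"
    by (simp add: linear_add[OF linear_linz] V_def Z_def of_real_def linear_scale[OF linear_linz])
  finally show ?thesis by (rule injD[OF inj_linz])
qed

lemma V_deriv: "(Rep_c0 (V u) has_real_derivative avg (g u * V u) - Rep_c0 (g u * V u) t) (at t)"
  using linz_deriv[of "g u" "V u" 0 1 t] by (simp add: V_def)

lemma avg_V: "avg (V u) = 1"
  using avg_linz[of "g u" "V u"] by (simp add: V_def)

text \<open>A zero would force \<open>V u = 0\<close> by \<open>c0_crossing\<close>, against average
  1. Without zeros the sign is that of the value 1, which is attained.\<close>

lemma V_pos: "0 < Rep_c0 (V u) t"
proof -
  have nz: "Rep_c0 (V u) t \<noteq> 0" for t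
  proof
    assume "Rep_c0 (V u) t = 0"
    then have "V u = 0" by (rule c0_crossing(1)[OF V_deriv])
    then show False using avg_V[of u] linear_0[OF linear_avg] by simp
  qed
  obtain s where "Rep_c0 (V u) s = Rep_c0 1 s"
    using avg_0_has_zero[of "V u - 1"] by (auto simp: avg_diff avg_V)
  then have s: "Rep_c0 (V u) s = 1" by simp
  show ?thesis
  proof (rule ccontr)
    assume "\<not> 0 < Rep_c0 (V u) t"
    then have "0 \<in> range (Rep_c0 (V u))"
      using s connected_continuous_image[OF continuous_on_c0 connected_UNIV, of "V u"]
      unfolding connected_iff_interval by (metis not_less rangeI zero_le_one)
    then show False using nz by auto
  qed
qed

text \<open>With n = exp(k1 g) one has (V n)' = (V\<Phi>) n - avg(g) V n; integrate over the
  circle.\<close>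

lemma lie_V_\<Phi>:
  "lie V \<Phi> u * avg (c0_exp (k1 (g u))) = avg (g u) * avg (V u * c0_exp (k1 (g u)))"
proof -
  let ?n = "c0_exp (k1 (g u))" and ?c = "avg (g u * V u)"
  have "(Rep_c0 (V u * ?n) has_real_derivative
      Rep_c0 (of_real ?c * ?n - of_real (avg (g u)) * (V u * ?n)) t) (at t)" for t
    by (rule DERIV_cong[OF c0_mult_deriv[OF V_deriv exp_k1_deriv]])
       (simp add: algebra_simps del: Rep_c0_exp)
  from avg_deriv_0[OF this] show ?thesis by (simp add: avg_diff lie_\<Phi>)
qed

lemma avg_V_exp_pos: "0 < avg (V u * c0_exp (k1 (g u)))"
  by (rule avg_pos) (simp add: V_pos)

text \<open>The ratio of \<open>avg (g u)\<close> to V\<Phi>, written as a quotient of positive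
  averages so that it stays smooth where both vanish.\<close>

definition b :: "c0 \<Rightarrow> real" where
  "b u = avg (c0_exp (k1 (g u))) / avg (V u * c0_exp (k1 (g u)))"

lemma b_pos: "0 < b u"
  unfolding b_def using avg_V_exp_pos avg_pos[of "c0_exp (k1 (g u))"] by simp

lemma avg_g_eq: "avg (g u) = b u * lie V \<Phi> u"
  using lie_V_\<Phi>[of u] avg_V_exp_pos[of u] by (simp add: b_def field_simps)

sublocale proportional_fields w V Z \<Phi> "\<lambda>u. avg (w u)" b
proof
  show "smooth_fun b"
    unfolding b_def[abs_def] using avg_V_exp_pos
    by (intro smooth_fun_divide_avg smooth_fun_avg smooth_op.mult smooth_V smooth_exp
        smooth_op_k1 smooth_g) (metis less_irrefl)
  show "w u = of_real (avg (w u)) * V u + of_real (b u * lie V \<Phi> u) * Z u" for u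
    using w_decomposition by (simp only: avg_g_eq)
  show "lie w \<Phi> u = avg (w u) * b u * lie V \<Phi> u" for u
    by (simp add: lie_\<Phi>[of w] avg_g_w avg_g_eq)
  show "avg (w u) \<noteq> 0" "b u \<noteq> 0" for u
    using avg_w_pos[of u] b_pos[of u] by auto
qed (intro smooth_w smooth_V smooth_Z smooth_\<Phi> smooth_fun_avg)+

section \<open>Injectivity and local inversion of \<open>G\<close>\<close>

lemma G_deriv: "(G has_derivative linz (g u)) (at u)"
  unfolding G_def[abs_def] linz_def[abs_def]
  by (intro has_derivative_add has_derivative_ident has_derivative_k1 nemytskii_f_deriv)

text \<open>The difference u - v has average zero, and its derivative deviates from the unknown
  constant \<open>- avg ?d\<close> by at most a Lipschitz multiple of \<bar>u - v\<bar>; so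
  \<open>periodic_crossing\<close> applies to the nonlinear problem as well.\<close>

lemma inj_G: "inj G"
proof (rule injI)
  fix u v assume eq: "G u = G v"
  let ?d = "nemytskii f v - nemytskii f u"
  have uv: "u - v = k1 ?d" using eq by (simp add: G_def k1_diff algebra_simps)
  then have "avg (u - v) = 0" by simp
  then obtain t0 where t0: "Rep_c0 (u - v) t0 = 0" by (rule avg_0_has_zero)
  define B where "B = max (norm u) (norm v)"
  obtain L where L: "\<And>t x. \<bar>x\<bar> \<le> B \<Longrightarrow> \<bar>D2 f t x\<bar> \<le> L"
    using circle_fun_bounded[OF circle_fun_D2] by blast
  have "\<bar>Rep_c0 ?d t - avg ?d - (- avg ?d)\<bar> \<le> L * \<bar>Rep_c0 (u - v) t\<bar>" for t
  proof -
    have "norm (f t (Rep_c0 v t) - f t (Rep_c0 u t)) \<le> L * norm (Rep_c0 v t - Rep_c0 u t)"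
    proof (rule field_differentiable_bound[of "{-B..B}"])
      show "(f t has_field_derivative D2 f t x) (at x within {-B..B})" for x
        by (rule DERIV_subset[OF deriv_f]) simp
      show "norm (D2 f t x) \<le> L" if "x \<in> {-B..B}" for x
        using L[of x t] that by (auto simp: abs_le_iff)
      show "Rep_c0 v t \<in> {-B..B}" "Rep_c0 u t \<in> {-B..B}"
        using c0_le_norm[of v t] c0_le_norm[of u t] by (auto simp: B_def)
    qed simp
    then show ?thesis by (simp add: Rep_nemytskii circle_fun_f abs_minus_commute)
  qed
  moreover have "(Rep_c0 (u - v) has_real_derivative Rep_c0 ?d t - avg ?d) (at t)" for t
    unfolding uv by (rule k1_deriv)
  ultimately have "Rep_c0 (u - v) t = 0" for t
    by (intro periodic_crossing(1)[OF periodic_c0 _ _ t0])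
  then show "u = v" by (intro c0_eqI) simp
qed

text \<open>The derivative \<open>linz (g u)\<close> depends on u only through the continuous map
  \<open>g\<close>, and \<open>norm_k1_le\<close> turns this into continuity in operator
  norm.\<close>

lemma
  shows open_range_G: "open (range G)"
    and inv_G_deriv: "(inv G has_derivative linz_inv (g u)) (at (G u))"
proof -
  have "\<exists>d>0. \<forall>v. norm (v - u) < d \<longrightarrow> (\<forall>h. norm (linz (g v) h - linz (g u) h) \<le> e * norm h)"
    if "0 < e" for u e
  proof -
    obtain D where "(g has_derivative D) (at u)" using smooth_op_deriv[OF smooth_g] by blast
    then have "isCont g u" by (rule has_derivative_continuous)
    then obtain d where "d > 0" and d: "\<And>v. dist v u < d \<Longrightarrow> dist (g v) (g u) < e"
      using \<open>0 < e\<close> unfolding continuous_at_eps_delta by blast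
    have "norm (linz (g v) h - linz (g u) h) \<le> e * norm h" if "norm (v - u) < d" for v h
    proof -
      have "norm (linz (g v) h - linz (g u) h) \<le> norm (g v - g u) * norm h"
        unfolding linz_minus_linz by (rule order_trans[OF norm_k1_le norm_mult_ineq])
      also have "\<dots> \<le> e * norm h"
        using d[of v] that by (intro mult_right_mono) (simp_all add: dist_norm)
      finally show ?thesis .
    qed
    then show ?thesis using \<open>d > 0\<close> by blast
  qed
  moreover have "inj (linz_inv (g u))" for u by (rule inj_on_inverseI[of _ "linz (g u)"]) simp
  ultimately show "open (range G)" "(inv G has_derivative linz_inv (g u)) (at (G u))"
    using open_range_diffeo[OF G_deriv inj_G, of "\<lambda>u. linz_inv (g u)"]
      has_derivative_inv_diffeo[OF G_deriv inj_G, of "\<lambda>u. linz_inv (g u)" u]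
    by (simp_all add: bounded_linear_linz_inv)
qed

end

subsection \<open>Reduction to continuous functions\<close>

lemma surj_deriv_iff:
  assumes "\<And>j. j \<in> {1..n} \<Longrightarrow> (g j has_derivative D j) (at x)"
  shows "surj_deriv g n x \<longleftrightarrow> (\<forall>y :: nat \<Rightarrow> real. \<exists>h. \<forall>j\<in>{1..n}. D j h = y j)"
proof
  assume "surj_deriv g n x"
  then obtain D' where D': "\<forall>j\<in>{1..n}. (g j has_derivative D' j) (at x)"
    and surj: "\<forall>y :: nat \<Rightarrow> real. \<exists>h. \<forall>j\<in>{1..n}. D' j h = y j"
    unfolding surj_deriv_def by (elim exE conjE)
  have "D' j = D j" if "j \<in> {1..n}" for j
    using has_derivative_unique[OF bspec[OF D' that] assms[OF that]] .
  then show "\<forall>y :: nat \<Rightarrow> real. \<exists>h. \<forall>j\<in>{1..n}. D j h = y j"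
    using surj by simp
next
  assume "\<forall>y :: nat \<Rightarrow> real. \<exists>h. \<forall>j\<in>{1..n}. D j h = y j"
  then show "surj_deriv g n x"
    unfolding surj_deriv_def by (intro exI[of _ D] conjI ballI assms)
qed

text \<open>
  \<open>J\<close> is the embedding of \<open>B\<^sup>1\<close> into the continuous functions, \<open>\<iota>\<close> the inclusion of the latter
  into \<open>B\<^sup>0\<close>, and \<open>K\<close> the inverse of \<open>u \<mapsto> u' + \<integral>u\<close>.
\<close>

locale circle_pair_model =
  fixes P :: "('b1::real_normed_vector, 'b0::real_normed_vector) circle_pair"
    and J :: "'b1 \<Rightarrow> c0" and \<iota> :: "c0 \<Rightarrow> 'b0" and K :: "'b0 \<Rightarrow> 'b1"
  assumes J: "bounded_linear J" "inj J" and val: "val P u = Rep_c0 (J u)"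
    and \<iota>: "bounded_linear \<iota>" and incl: "incl P (Rep_c0 c) = \<iota> c"
    and K: "bounded_linear K"
    and K_der: "K (der P u + \<iota> (of_real (avg (J u)))) = u"
    and der_K: "der P (K z) + \<iota> (of_real (avg (J (K z)))) = z"
    and J_K_\<iota>: "J (K (\<iota> c)) = k1 c + of_real (avg c)"
    and mean: "linear (mean P)" and mean_\<iota>: "mean P (\<iota> c) = avg c"
    and mean_der: "mean P (der P u) = 0"

locale circle_ode = circle_nonlinearity f + circle_pair_model P J \<iota> K
  for f and P :: "('b1::real_normed_vector, 'b0::real_normed_vector) circle_pair" and J \<iota> K
begin

lemmas lin_J = bounded_linear.linear[OF J(1)]
lemmas lin_\<iota> = bounded_linear.linear[OF \<iota>]
lemmas lin_K = bounded_linear.linear[OF K]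

lemma val_superposition:
  assumes "circle_fun q"
  shows "(\<lambda>t. q t (val P u t)) = Rep_c0 (nemytskii q (J u))"
  by (rule ext) (simp add: val Rep_nemytskii assms)

lemma cst_eq: "cst P c = \<iota> (of_real c)"
proof -
  have "(\<lambda>_. c) = Rep_c0 (of_real c)" by (simp add: fun_eq_iff)
  then show ?thesis by (simp add: cst_def incl)
qed

lemma F_eq: "F_map P f u = der P u + \<iota> (nemytskii f (J u))"
  unfolding F_map_def val_superposition[OF circle_fun_f] incl ..

lemma mean_F: "mean P (F_map P f u) = \<Phi> (J u)"
  by (simp add: F_eq linear_add[OF mean] mean_der mean_\<iota> \<Phi>_def)

lemma Phi_eq: "Phi_map P f u = \<Phi> (J u)"
  unfolding Phi_map_def val_superposition[OF circle_fun_f] \<Phi>_def avg_def ..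

lemma Psi_eq:
  "Psi_map P f u = (der P u + \<iota> (of_real (avg (J u))))
    + \<iota> (nemytskii f (J u) - of_real (\<Phi> (J u)))"
  unfolding Psi_map_def mean_F
  unfolding cst_eq F_eq val avg_def[symmetric] linear_diff[OF lin_\<iota>]
  by (simp add: algebra_simps)

lemma K_Psi: "K (Psi_map P f u) = u + K (\<iota> (nemytskii f (J u) - of_real (\<Phi> (J u))))"
  by (subst Psi_eq, subst linear_add[OF lin_K]) (simp only: K_der)

lemma J_K_\<iota>_centered: "J (K (\<iota> (c - of_real (avg c)))) = k1 c"
  by (simp add: J_K_\<iota> k1_diff avg_diff)

lemma J_K_Psi: "J (K (Psi_map P f u)) = G (J u)"
  by (simp add: K_Psi linear_add[OF lin_J] G_def \<Phi>_def J_K_\<iota>_centered)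

lemma inj_K: "inj K"
  by (rule inj_on_inverseI[of _ "\<lambda>u. der P u + \<iota> (of_real (avg (J u)))"]) (simp add: der_K)

lemma inj_Psi: "inj (Psi_map P f)"
  using inj_G J(2) J_K_Psi by (metis injD injI)

text \<open>On \<open>U\<close>, which is the range of \<Psi>, \<open>S\<close> is the inverse of
  \<Psi> followed by \<open>J\<close>. Defining it through \<open>G\<close> makes its derivative
  available in the sup norm.\<close>

definition S :: "'b0 \<Rightarrow> c0" where "S z = inv G (J (K z))"
definition U :: "'b0 set" where "U = {z. J (K z) \<in> range G}"

lemma bounded_linear_J_K: "bounded_linear (\<lambda>z. J (K z))"
  by (rule bounded_linear_compose[OF J(1) K])

lemma open_U: "open U"
proof -
  have "U = (\<lambda>z. J (K z)) -` range G" by (auto simp: U_def)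
  then show ?thesis
    using linear_continuous_on[OF bounded_linear_J_K] open_range_G
    by (simp add: open_vimage)
qed

lemma Psi_in_U: "Psi_map P f u \<in> U"
  by (simp add: U_def J_K_Psi)

lemma S_Psi: "S (Psi_map P f u) = J u"
  by (simp add: S_def J_K_Psi inv_f_f[OF inj_G])

text \<open>A priori \<open>S z\<close> is merely continuous. Its equation expresses it through
  \<open>K\<close>, which yields an element of B^1 with the same values.\<close>

lemma J_inv_Psi:
  assumes "z \<in> U"
  shows "J (inv (Psi_map P f) z) = S z"
proof -
  let ?N = "K (\<iota> (nemytskii f (S z) - of_real (\<Phi> (S z))))"
  define u where "u = K z - ?N"
  have "G (S z) = J (K z)" unfolding S_def using assms by (intro f_inv_into_f) (simp add: U_def)
  then have Ju: "J u = S z"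
    by (simp add: u_def linear_diff[OF lin_J] \<Phi>_def J_K_\<iota>_centered G_def flip: eq_diff_eq)
  then have "K (Psi_map P f u) = K z"
    by (simp add: K_Psi u_def)
  then have "Psi_map P f u = z" by (rule injD[OF inj_K])
  then show ?thesis using Ju inv_f_f[OF inj_Psi, of u] by simp
qed

lemma S_deriv:
  assumes "z \<in> U"
  shows "(S has_derivative (\<lambda>\<zeta>. linz_inv (g (S z)) (J (K \<zeta>)))) (at z)"
proof -
  have "G (S z) = J (K z)" unfolding S_def using assms by (intro f_inv_into_f) (simp add: U_def)
  then have "(inv G has_derivative linz_inv (g (S z))) (at (J (K z)))"
    using inv_G_deriv[of "S z"] by simp
  then show ?thesis
    unfolding S_def[abs_def]
    by (rule has_derivative_compose[OF bounded_linear_imp_has_derivative[OF bounded_linear_J_K]])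
qed

lemma \<theta>_S_deriv:
  assumes "z \<in> U"
  shows "((\<lambda>z. \<theta> j (S z)) has_derivative
    (\<lambda>\<zeta>. frechet_derivative (\<theta> j) (at (S z)) (linz_inv (g (S z)) (J (K \<zeta>))))) (at z)"
  by (rule has_derivative_compose[OF S_deriv[OF assms] smooth_fun_deriv(1)[OF smooth_\<theta>]])

text \<open>Since J K maps a constant to itself, the curve s \<mapsto> S (v + s) has velocity
  \<open>V\<close>, and differentiation in s becomes the Lie derivative along
  \<open>V\<close>.\<close>

lemma \<theta>_S_curve_deriv:
  assumes "v + cst P s \<in> U"
  shows "((\<lambda>s. \<theta> j (S (v + cst P s))) has_real_derivative \<theta> (Suc j) (S (v + cst P s))) (at s)"
proof -
  let ?u = "S (v + cst P s)"
  have curve: "((\<lambda>s. v + cst P s) has_derivative cst P) (at s)"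
  proof -
    have "bounded_linear (cst P)"
      unfolding cst_eq[abs_def] by (rule bounded_linear_compose[OF \<iota> bounded_linear_of_real])
    then show ?thesis
      using has_derivative_add[OF has_derivative_const bounded_linear_imp_has_derivative] by fastforce
  qed
  have "frechet_derivative (\<theta> j) (at ?u) (linz_inv (g ?u) (J (K (cst P h)))) = \<theta> (Suc j) ?u * h" for h
  proof -
    have "J (K (cst P h)) = of_real h" by (simp add: cst_eq J_K_\<iota>)
    then have "linz_inv (g ?u) (J (K (cst P h))) = h *\<^sub>R V ?u"
      by (simp only: of_real_def V_def linear_scale[OF bounded_linear.linear[OF bounded_linear_linz_inv]])
    then show ?thesis
      using linear_scale[OF has_derivative_linear[OF smooth_fun_deriv(1)[OF smooth_\<theta>]], of j ?u h "V ?u"]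
      by (simp add: lie_def)
  qed
  then show ?thesis
    using has_derivative_compose[OF curve \<theta>_S_deriv[OF assms], of j]
    by (simp add: has_field_derivative_def)
qed

text \<open>Iterating \<open>deriv\<close> needs the formula on a whole neighbourhood of s, which
  openness of \<open>U\<close> provides.\<close>

lemma D2_phi_eq:
  assumes "v + cst P s \<in> U"
  shows "D2_phi P f j v s = \<theta> j (S (v + cst P s))"
  using assms
proof (induction j arbitrary: s)
  case 0
  then show ?case by (simp add: D2_phi_def phi_def mean_F J_inv_Psi)
next
  case (Suc j)
  have "open {s. v + cst P s \<in> U}"
  proof -
    have "{s. v + cst P s \<in> U} = (\<lambda>s. v + \<iota> (of_real s)) -` U" by (auto simp: cst_eq)
    moreover have "continuous_on UNIV (\<lambda>s. v + \<iota> (of_real s))"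
      by (intro continuous_intros linear_continuous_on[OF bounded_linear_compose[OF \<iota> bounded_linear_of_real]])
    ultimately show ?thesis
      using open_U by (simp add: open_vimage)
  qed
  then have "\<forall>\<^sub>F r in nhds s. D2_phi P f j v r = \<theta> j (S (v + cst P r))"
    using Suc by (auto simp: eventually_nhds)
  then have "deriv (D2_phi P f j v) s = deriv (\<lambda>r. \<theta> j (S (v + cst P r))) s"
    by (intro deriv_cong_ev refl)
  also have "\<dots> = \<theta> (Suc j) (S (v + cst P s))"
    by (rule DERIV_imp_deriv[OF \<theta>_S_curve_deriv[OF Suc.prems]])
  finally show ?case by (simp add: D2_phi_def[abs_def])
qed

lemma D2_phi_split:
  "z \<in> U \<Longrightarrow> D2_phi P f j (tilde P z) (mean P z) = \<theta> j (S z)"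
  using D2_phi_eq[of "tilde P z" "mean P z" j] by (simp add: tilde_def)

text \<open>The derivative of \<open>S\<close> at \<Psi>(u) has exactly the image of
  \<open>J\<close> as its range, so both sides test the same set of directions.\<close>

lemma surj_D2_phi_iff:
  "surj_deriv (\<lambda>j z. D2_phi P f j (tilde P z) (mean P z)) n (Psi_map P f u) \<longleftrightarrow>
    (\<forall>y. \<exists>h. \<forall>j\<in>{1..n}. frechet_derivative (\<theta> j) (at (J u)) (J h) = y j)"
proof -
  let ?x = "Psi_map P f u"
  let ?DS = "\<lambda>\<zeta>. linz_inv (g (J u)) (J (K \<zeta>))"
  have deriv: "((\<lambda>z. D2_phi P f j (tilde P z) (mean P z)) has_derivative
      (\<lambda>\<zeta>. frechet_derivative (\<theta> j) (at (J u)) (?DS \<zeta>))) (at ?x)" for j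
    using has_derivative_transform_within_open[OF \<theta>_S_deriv[OF Psi_in_U] open_U Psi_in_U] D2_phi_split
    by (simp add: S_Psi)
  have JDS: "\<exists>\<zeta>. J h = ?DS \<zeta>" for h
  proof -
    let ?c = "g (J u) * J h"
    \<comment> \<open>Chosen so that J K \<zeta> = linz (g (J u)) (J h): the first summand
      contributes J h, the second k1 of the product.\<close>
    let ?\<zeta> = "(der P h + \<iota> (of_real (avg (J h)))) + \<iota> (?c - of_real (avg ?c))"
    have "J (K ?\<zeta>) = linz (g (J u)) (J h)"
      by (subst linear_add[OF lin_K])
         (simp only: K_der linear_add[OF lin_J] J_K_\<iota>_centered linz_def)
    then show ?thesis by (intro exI[of _ ?\<zeta>]) simp
  qed
  have DSJ: "\<exists>h. ?DS \<zeta> = J h" for \<zeta>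
  proof -
    let ?c = "g (J u) * ?DS \<zeta>"
    have "?DS \<zeta> + k1 ?c = J (K \<zeta>)"
      using linz_linz_inv[of "g (J u)" "J (K \<zeta>)"] unfolding linz_def .
    \<comment> \<open>Regularity recovered from the linear equation: both terms on the right come
      from B^1.\<close>
    then have "?DS \<zeta> = J (K \<zeta> - K (\<iota> (?c - of_real (avg ?c))))"
      unfolding linear_diff[OF lin_J] J_K_\<iota>_centered by (simp only: eq_diff_eq)
    then show ?thesis by blast
  qed
  have "(\<exists>\<zeta>. \<forall>j\<in>{1..n}. frechet_derivative (\<theta> j) (at (J u)) (?DS \<zeta>) = y j) \<longleftrightarrow>
      (\<exists>h. \<forall>j\<in>{1..n}. frechet_derivative (\<theta> j) (at (J u)) (J h) = y j)" (is "?l \<longleftrightarrow> ?r") for y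
  proof
    assume ?l
    then obtain \<zeta> where "\<forall>j\<in>{1..n}. frechet_derivative (\<theta> j) (at (J u)) (?DS \<zeta>) = y j" ..
    moreover obtain h where "?DS \<zeta> = J h" using DSJ ..
    ultimately show ?r by auto
  next
    assume ?r
    then obtain h where "\<forall>j\<in>{1..n}. frechet_derivative (\<theta> j) (at (J u)) (J h) = y j" ..
    moreover obtain \<zeta> where "J h = ?DS \<zeta>" using JDS ..
    ultimately show ?l by auto
  qed
  then show ?thesis
    by (simp only: surj_deriv_iff[OF deriv])
qed

text \<open>\<open>inv (val P)\<close> is meaningful only if the exponential is the value function
  of an element of B^1. With c = w' + avg w, the element K(c) has these values.\<close>

lemma J_wfield: "J (wfield P f u) = w (J u)"
proof -
  let ?e = "of_real (avg (g (J u))) * w (J u) - g (J u) * w (J u)"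
  let ?c = "?e + of_real (avg (w (J u)))"
  have "avg ?c = avg (w (J u))" by (simp add: avg_add avg_diff avg_g_w)
  then have "J (K (\<iota> ?c)) = k1 ?e + of_real (avg (w (J u)))"
    by (simp only: J_K_\<iota> k1_add k1_of_real add_0_right)
  also have "\<dots> = w (J u)"
    by (rule trans[OF add.commute c0_eq_avg_plus_k1[OF w_deriv, symmetric]])
  finally have Jc: "J (K (\<iota> ?c)) = w (J u)" .
  have exp: "(\<lambda>t. exp (- (\<integral>s. kap (s - t) * D2 f s (val P u s) \<partial>circ))) = Rep_c0 (w (J u))"
    by (simp add: fun_eq_iff w_def g_def Rep_c0_k1 Rep_nemytskii circle_fun_D2 val)
  have "inj (val P)"
    using J(2) by (auto simp: inj_def val Rep_c0_inject)
  then have "inv (val P) (val P (K (\<iota> ?c))) = K (\<iota> ?c)" by (rule inv_f_f)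
  then have "wfield P f u = K (\<iota> ?c)"
    unfolding wfield_def exp unfolding val[of "K (\<iota> ?c)"] Jc .
  then show ?thesis using Jc by (simp only:)
qed

lemma lie_pullback_deriv:
  "smooth_fun \<rho> \<Longrightarrow> ((\<lambda>u. \<rho> (J u)) has_derivative (\<lambda>h. frechet_derivative \<rho> (at (J u)) (J h))) (at u)"
  by (rule has_derivative_compose[OF bounded_linear_imp_has_derivative[OF J(1)] smooth_fun_deriv(1)])

lemma lie_wfield_funpow:
  "(lie (wfield P f) ^^ j) (Phi_map P f) = (\<lambda>u. (lie w ^^ j) \<Phi> (J u))"
proof (induction j)
  case (Suc j)
  have "lie (wfield P f) (\<lambda>u. (lie w ^^ j) \<Phi> (J u)) u = lie w ((lie w ^^ j) \<Phi>) (J u)" for u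
    using lie_eqI[OF lie_pullback_deriv[OF smooth_fun_lie_funpow[OF smooth_\<Phi> smooth_w]]]
    by (simp add: J_wfield lie_def)
  then show ?case by (auto simp: Suc.IH)
qed (simp add: Phi_eq fun_eq_iff)

lemma surj_lie_wfield_iff:
  "surj_deriv (\<lambda>j. (lie (wfield P f) ^^ j) (Phi_map P f)) n u \<longleftrightarrow>
    (\<forall>y. \<exists>h. \<forall>j\<in>{1..n}. frechet_derivative ((lie w ^^ j) \<Phi>) (at (J u)) (J h) = y j)"
  unfolding lie_wfield_funpow
  by (rule surj_deriv_iff) (rule lie_pullback_deriv[OF smooth_fun_lie_funpow[OF smooth_\<Phi> smooth_w]])

lemma morin_iff:
  assumes "1 \<le> k"
  shows "morin P f k u \<longleftrightarrow>
    (\<forall>j\<in>{1..k}. (lie (wfield P f) ^^ j) (Phi_map P f) u = 0) \<and>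
    (lie (wfield P f) ^^ (k + 1)) (Phi_map P f) u \<noteq> 0 \<and>
    surj_deriv (\<lambda>j. (lie (wfield P f) ^^ j) (Phi_map P f)) (k - 1) u"
proof -
  have "morin P f k u \<longleftrightarrow> (\<forall>j\<in>{1..k}. \<theta> j (J u) = 0) \<and> \<theta> (k + 1) (J u) \<noteq> 0 \<and>
      (\<forall>y. \<exists>h. \<forall>j\<in>{1..k-1}. frechet_derivative (\<theta> j) (at (J u)) (J h) = y j)"
    unfolding morin_def Let_def D2_phi_split[OF Psi_in_U] S_Psi surj_D2_phi_iff ..
  also have "\<dots> \<longleftrightarrow> (\<forall>j\<in>{1..k}. (lie w ^^ j) \<Phi> (J u) = 0) \<and> (lie w ^^ (k + 1)) \<Phi> (J u) \<noteq> 0 \<and>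
      (\<forall>y. \<exists>h. \<forall>j\<in>{1..k-1}. frechet_derivative ((lie w ^^ j) \<Phi>) (at (J u)) (J h) = y j)"
  proof (cases "\<forall>j\<in>{1..k}. \<theta> j (J u) = 0")
    case True
    \<comment> \<open>Given vanishing up to k, the equivalence for k + 1 reduces to its last term
      and settles the nonvanishing condition. In the other case both sides fail at their first
      condition.\<close>
    have "{1..k + 1} = insert (k + 1) {1..k}" by auto
    from lie_w_zero_iff[of "k + 1" "J u", unfolded this ball_simps] lie_w_zero_iff[of k "J u"] True
    have "(lie w ^^ (k + 1)) \<Phi> (J u) = 0 \<longleftrightarrow> \<theta> (k + 1) (J u) = 0" by argo
    moreover have "\<forall>j\<in>{1..k-1}. \<theta> j (J u) = 0" using True by auto
    from lie_w_surj_iff[OF this, of J] lie_w_zero_iff[of k "J u"] True calculation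
    show ?thesis by (simp only:)
  qed (simp only: lie_w_zero_iff simp_thms)
  finally show ?thesis
    unfolding lie_wfield_funpow[of "k + 1"] surj_lie_wfield_iff by (simp only: lie_wfield_funpow)
qed

end

subsection \<open>The pair \<open>(C\<^sup>1, C\<^sup>0)\<close>\<close>

lemma k1_plus_const_deriv:
  "(Rep_c0 (k1 z + of_real c) has_real_derivative Rep_c0 (z - of_real (avg z)) t) (at t)"
  using DERIV_add[OF k1_deriv[of z t] DERIV_const[of c]] by (simp add: plus_c0.rep_eq[abs_def])

definition c1_prim :: "c0 \<Rightarrow> c1" where
  "c1_prim z = Abs_c1 (Rep_c0 (k1 z + of_real (avg z)))"

lemma Rep_c1_prim: "Rep_c1 (c1_prim z) = Rep_c0 (k1 z + of_real (avg z))"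
proof -
  have "Rep_c0 (k1 z + of_real (avg z)) \<in> {u. periodic u \<and> (\<forall>t. u differentiable at t) \<and>
      continuous_on UNIV (deriv u)}"
    unfolding mem_Collect_eq
    by (rule c1I[OF periodic_c0 k1_plus_const_deriv continuous_on_c0])
  then show ?thesis unfolding c1_prim_def by (rule Abs_c1_inverse)
qed

lemma c1_c0_prim: "c1_c0 (c1_prim z) = k1 z + of_real (avg z)"
  by (rule c0_eqI) (simp add: c1_c0.rep_eq Rep_c1_prim)

lemma c1_deriv_prim: "c1_deriv (c1_prim z) = z - of_real (avg z)"
  by (rule c1_deriv_eqI) (simp only: Rep_c1_prim k1_plus_const_deriv)

lemma inj_c1_c0: "inj c1_c0"
  by (rule injI) (simp add: Rep_c1_inject[symmetric] c1_c0.rep_eq[symmetric] fun_eq_iff)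

lemma avg_c1_deriv: "avg (c1_deriv u) = 0"
  by (rule avg_deriv_0[of "c1_c0 u"]) (use c1_has_deriv[of u] in \<open>simp add: c1_c0.rep_eq\<close>)

lemma c1_prim_deriv: "c1_prim (c1_deriv u + of_real (avg (c1_c0 u))) = u"
proof (rule injD[OF inj_c1_c0])
  have "c1_c0 u = of_real (avg (c1_c0 u)) + k1 (c1_deriv u)"
    by (rule c0_eq_avg_plus_k1) (use c1_has_deriv[of u] in \<open>simp add: c1_c0.rep_eq\<close>)
  then show "c1_c0 (c1_prim (c1_deriv u + of_real (avg (c1_c0 u)))) = c1_c0 u"
    by (simp add: c1_c0_prim avg_add avg_c1_deriv k1_add add.commute)
qed

lemma bounded_linear_c1_c0: "bounded_linear c1_c0"
  by (rule bounded_linear_intro[where K = 1]) (simp_all add: c1_c0_add c1_c0_scaleR norm_c1_def)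

lemma norm_of_real_avg_le: "norm (of_real (avg z) :: c0) \<le> norm z"
  by (simp add: avg_abs_le)

lemma bounded_linear_c1_prim: "bounded_linear c1_prim"
\<comment> \<open>One unit each for \<open>k1 z\<close> and the average, two for the derivative z -
  avg z.\<close>
proof (rule bounded_linear_intro[where K = 4])
  show "c1_prim (y + z) = c1_prim y + c1_prim z" for y z
    by (rule injD[OF inj_c1_c0]) (simp add: c1_c0_add c1_c0_prim k1_add avg_add)
  show "c1_prim (r *\<^sub>R z) = r *\<^sub>R c1_prim z" for r z
    by (rule injD[OF inj_c1_c0])
       (simp add: c1_c0_scaleR c1_c0_prim scaleR_conv_of_real k1_of_real_mult distrib_left)
  show "norm (c1_prim z) \<le> norm z * 4" for z
    using norm_triangle_ineq[of "k1 z" "of_real (avg z)"] norm_triangle_ineq4[of z "of_real (avg z)"]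
      norm_k1_le[of z] norm_of_real_avg_le[of z]
    unfolding norm_c1_def c1_c0_prim c1_deriv_prim by linarith
qed

interpretation classical: circle_pair_model classical_pair c1_c0 "\<lambda>c. c" c1_prim
proof (rule circle_pair_model.intro)
  show "val classical_pair u = Rep_c0 (c1_c0 u)" for u
    by (simp add: classical_pair_def c1_c0.rep_eq)
  show "incl classical_pair (Rep_c0 c) = c" for c
    by (simp add: classical_pair_def Rep_c0_inverse)
  show "c1_prim (der classical_pair u + of_real (avg (c1_c0 u))) = u" for u
    by (simp add: classical_pair_def c1_prim_deriv)
  show "der classical_pair (c1_prim z) + of_real (avg (c1_c0 (c1_prim z))) = z" for z
    by (simp add: classical_pair_def c1_deriv_prim c1_c0_prim avg_add)
  have mean: "mean classical_pair = avg" by (simp add: classical_pair_def avg_def[abs_def])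
  show "linear (mean classical_pair)" by (simp add: mean linear_avg)
  show "mean classical_pair c = avg c" for c by (simp add: mean)
  show "mean classical_pair (der classical_pair u) = 0" for u
    unfolding mean by (simp add: classical_pair_def avg_c1_deriv)
qed (rule bounded_linear_c1_c0 inj_c1_c0 bounded_linear_ident bounded_linear_c1_prim c1_c0_prim)+

subsection \<open>The pair \<open>(H\<^sup>1, L\<^sup>2)\<close>\<close>

lemma l2rel_refl: "l2rel h h \<longleftrightarrow> square_integrable h"
  by (simp add: l2rel_def)

lemma square_integrable_continuous:
  assumes "continuous_on {0..1} h"
  shows "square_integrable h"
  unfolding square_integrable_def
  using continuous_integrable_circ[OF assms]
  by (auto intro!: borel_measurable_integrable continuous_integrable_circ continuous_intros assms)

definition c0_l2 :: "c0 \<Rightarrow> l2" where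
  "c0_l2 g = abs_l2 (Rep_c0 g)"

lemma l2rel_c0: "l2rel (Rep_c0 g) (Rep_c0 g)"
  by (simp add: l2rel_refl square_integrable_continuous continuous_on_c0)

lemma c0_l2_add: "c0_l2 (g + h) = c0_l2 g + c0_l2 h"
  unfolding c0_l2_def plus_l2.abs_eq[OF l2rel_c0 l2rel_c0] by (simp add: plus_c0.rep_eq[abs_def])

lemma c0_l2_scaleR: "c0_l2 (r *\<^sub>R g) = r *\<^sub>R c0_l2 g"
  unfolding c0_l2_def scaleR_l2.abs_eq[OF l2rel_c0] by (simp add: scaleR_c0.rep_eq[abs_def])

lemma inner_c0_l2: "inner (c0_l2 g) (c0_l2 h) = avg (g * h)"
  unfolding c0_l2_def inner_l2.abs_eq[OF l2rel_c0 l2rel_c0] by (simp add: avg_def)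

lemma l2_mean_c0_l2: "l2_mean (c0_l2 g) = avg g"
  unfolding c0_l2_def l2_mean.abs_eq[OF l2rel_c0] by (simp add: avg_def)

lemma norm_c0_l2_le: "norm (c0_l2 g) \<le> norm g"
proof -
  have "avg (g * g) \<le> norm g * norm g"
    using avg_abs_le[of "g * g"] norm_mult_ineq[of g g] by linarith
  then have "(norm (c0_l2 g))\<^sup>2 \<le> (norm g)\<^sup>2"
    unfolding power2_norm_eq_inner inner_c0_l2 by (simp add: power2_eq_square)
  then show ?thesis by (rule power2_le_imp_le) simp
qed

lemma bounded_linear_c0_l2: "bounded_linear c0_l2"
  by (rule bounded_linear_intro[where K = 1]) (simp_all add: c0_l2_add c0_l2_scaleR norm_c0_l2_le)

lemma linear_c0_l2: "linear c0_l2"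
  by (rule bounded_linear.linear[OF bounded_linear_c0_l2])

lemma norm_c0_l2_1: "norm (c0_l2 1) = 1"
  by (simp add: norm_eq_sqrt_inner inner_c0_l2)

text \<open>Writing the functional as an inner product gives linearity and, by Cauchy-Schwarz, the
  bound.\<close>

lemma l2_mean_inner: "l2_mean v = inner (c0_l2 1) v"
proof -
  obtain h where h: "v = abs_l2 h" "l2rel h h"
    using Quotient3_abs_rep[OF Quotient3_l2] Quotient3_rep_reflp[OF Quotient3_l2] by metis
  show ?thesis
    unfolding h(1) c0_l2_def inner_l2.abs_eq[OF l2rel_c0 h(2)] l2_mean.abs_eq[OF h(2)] by simp
qed

lemma linear_l2_mean: "linear l2_mean"
  by (rule linearI) (simp_all add: l2_mean_inner inner_add_right)

lemma abs_l2_mean_le: "\<bar>l2_mean v\<bar> \<le> norm v"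
  using Cauchy_Schwarz_ineq2[of "c0_l2 1" v] by (simp add: l2_mean_inner norm_c0_l2_1)

text \<open>The Riesz representative of evaluating the primitive at t. Distances between these steps
  are square roots, hence Hoelder-1/2 continuity of primitives.\<close>

definition l2_step :: "real \<Rightarrow> l2" where
  "l2_step t = abs_l2 (indicator {0..<t})"

lemma l2rel_step: "l2rel (indicator {0..<t}) (indicator {0..<t} :: real \<Rightarrow> real)"
proof -
  have [measurable]: "(indicator {0..<t} :: real \<Rightarrow> real) \<in> borel_measurable circ"
    by (rule borel_measurable_circ) simp
  have "integrable circ (\<lambda>s. (indicator {0..<t} s :: real)\<^sup>2)"
  proof (rule circ.integrable_const_bound[where B = 1])
    show "AE s in circ. norm ((indicator {0..<t} s :: real)\<^sup>2) \<le> 1" by (simp add: indicator_def)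
  qed measurable
  then show ?thesis by (simp add: l2rel_refl square_integrable_def)
qed

lemma l2_primitive_inner: "l2_primitive v t = inner (l2_step t) v"
proof -
  obtain h where h: "v = abs_l2 h" "l2rel h h"
    using Quotient3_abs_rep[OF Quotient3_l2] Quotient3_rep_reflp[OF Quotient3_l2] by metis
  show ?thesis
    unfolding h(1) l2_step_def inner_l2.abs_eq[OF l2rel_step h(2)] l2_primitive.abs_eq[OF h(2)] ..
qed

lemma inner_l2_step:
  assumes "s \<in> {0..1}" "t \<in> {0..1}"
  shows "inner (l2_step s) (l2_step t) = min s t"
proof -
  have "inner (l2_step s) (l2_step t) = (\<integral>r. indicator {0..<min s t} r * 1 \<partial>circ)"
    unfolding l2_step_def inner_l2.abs_eq[OF l2rel_step l2rel_step]
    by (rule Bochner_Integration.integral_cong) (auto simp: indicator_def)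
  also have "\<dots> = min s t - 0"
    using assms by (intro integral_circ_indicator_FTC) (auto intro!: derivative_eq_intros)
  finally show ?thesis by simp
qed

lemma norm_l2_step_diff:
  assumes "s \<in> {0..1}" "t \<in> {0..1}"
  shows "norm (l2_step s - l2_step t) = sqrt \<bar>s - t\<bar>"
  unfolding norm_eq_sqrt_inner inner_diff_left inner_diff_right
  using assms by (simp add: inner_l2_step min_def)

lemma l2_primitive_diff_le:
  assumes "s \<in> {0..1}" "t \<in> {0..1}"
  shows "\<bar>l2_primitive v s - l2_primitive v t\<bar> \<le> sqrt \<bar>s - t\<bar> * norm v"
  using Cauchy_Schwarz_ineq2[of "l2_step s - l2_step t" v]
  by (simp add: l2_primitive_inner inner_diff_left norm_l2_step_diff[OF assms])

lemma continuous_on_l2_primitive: "continuous_on {0..1} (l2_primitive v)"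
  unfolding continuous_on_def
proof
  fix t :: real assume t: "t \<in> {0..1}"
  have "((\<lambda>s. sqrt \<bar>s - t\<bar> * norm v) \<longlongrightarrow> sqrt \<bar>t - t\<bar> * norm v) (at t within {0..1})"
    by (intro tendsto_intros)
  then have lim: "((\<lambda>s. sqrt \<bar>s - t\<bar> * norm v) \<longlongrightarrow> 0) (at t within {0..1})" by simp
  have "((\<lambda>s. l2_primitive v s - l2_primitive v t) \<longlongrightarrow> 0) (at t within {0..1})"
    by (rule Lim_null_comparison[OF _ lim])
       (use l2_primitive_diff_le[OF _ t] in \<open>auto simp: eventually_at_filter\<close>)
  then show "(l2_primitive v \<longlongrightarrow> l2_primitive v t) (at t within {0..1})"
    by (rule LIM_zero_cancel)
qed

text \<open>Only integers are in question; gluing the shifted copy on [-1,0] to [0,1] makes 0 an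
  interior point.\<close>

lemma periodic_continuous:
  fixes u :: "real \<Rightarrow> real"
  assumes per: "periodic u" and cont: "continuous_on {0..1} u"
  shows "continuous_on UNIV u"
proof -
  have shift: "isCont u t" if "isCont u (t + of_int n)" for t n
  proof -
    have "isCont (\<lambda>s. u (s + of_int n)) t"
      using that by (rule isCont_o2[where f = "\<lambda>s. s + of_int n" and g = u, rotated]) simp
    then show ?thesis by (simp add: periodic_of_int[OF per])
  qed
  have "continuous_on {-1..0} (\<lambda>s. u (s + of_int 1))"
    by (rule continuous_on_compose2[OF cont]) (auto intro!: continuous_intros)
  then have "continuous_on {-1..0} u" by (simp only: periodic_of_int[OF per])
  then have "continuous_on ({-1..0} \<union> {0..1}) u"
    using cont by (intro continuous_on_closed_Un) auto
  moreover have "{-1..0} \<union> {0..1} = {-1..1::real}" by auto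
  ultimately have "continuous_on {-1..1} u" by simp
  then have "isCont u (frac t)" for t
    by (rule continuous_on_interior) (simp add: frac_lt_1 less_le_trans[OF _ frac_ge_0])
  then have "isCont u t" for t
    using shift[of t "- \<lfloor>t\<rfloor>"] by (simp add: frac_def)
  then show ?thesis by (simp add: continuous_on_eq_continuous_at)
qed

lemma continuous_on_h1: "continuous_on UNIV (Rep_h1 u)"
proof (rule periodic_continuous[OF periodic_h1])
  have "continuous_on {0..1} (\<lambda>t. Rep_h1 u 0 + l2_primitive (h1_deriv u) t)"
    by (intro continuous_intros continuous_on_l2_primitive)
  then show "continuous_on {0..1} (Rep_h1 u)"
    by (rule continuous_on_eq) (simp add: h1_deriv[symmetric])
qed

section \<open>The embedding of H^1 into the continuous functions\<close>

definition h1_c0 :: "h1 \<Rightarrow> c0" where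
  "h1_c0 u = Abs_c0 (Rep_h1 u)"

lemma Rep_h1_c0 [simp]: "Rep_c0 (h1_c0 u) = Rep_h1 u"
  unfolding h1_c0_def by (rule Rep_Abs_c0[OF periodic_h1 continuous_on_h1])

lemma inj_h1_c0: "inj h1_c0"
  by (rule injI) (metis Rep_h1_c0 Rep_h1_inject)

lemma h1_c0_add: "h1_c0 (u + v) = h1_c0 u + h1_c0 v"
  by (rule c0_eqI) (simp add: plus_h1.rep_eq)

lemma h1_c0_scaleR: "h1_c0 (r *\<^sub>R u) = r *\<^sub>R h1_c0 u"
  by (rule c0_eqI) (simp add: scaleR_h1.rep_eq)

lemma l2_mean_eq_primitive: "l2_mean v = l2_primitive v 1"
proof -
  have "c0_l2 1 = l2_step 1"
    unfolding c0_l2_def l2_step_def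
    by (rule Quotient3_rel_abs[OF Quotient3_l2])
       (use l2rel_c0[of 1] l2rel_step[of 1] in \<open>auto simp: l2rel_def indicator_def intro!: AE_I2\<close>)
  then show ?thesis by (simp add: l2_mean_inner l2_primitive_inner)
qed

lemma l2_mean_h1_deriv: "l2_mean (h1_deriv u) = 0"
  using h1_deriv[of 1 u] c0_plus_1[of "h1_c0 u" 0] by (simp add: l2_mean_eq_primitive)

lemma h1_oscillation: "\<bar>Rep_h1 u s - Rep_h1 u t\<bar> \<le> norm (h1_deriv u)"
proof -
  have *: "\<bar>Rep_h1 u s - Rep_h1 u t\<bar> \<le> norm (h1_deriv u)" if "s \<in> {0..1}" "t \<in> {0..1}" for s t
  proof -
    have "sqrt \<bar>s - t\<bar> * norm (h1_deriv u) \<le> 1 * norm (h1_deriv u)"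
      using that by (intro mult_right_mono) (auto simp: abs_le_iff)
    then show ?thesis
      using l2_primitive_diff_le[OF that, of "h1_deriv u"] h1_deriv[OF that(1), of u] h1_deriv[OF that(2), of u]
      by simp
  qed
  have "Rep_h1 u (frac r) = Rep_h1 u r" for r
    using periodic_of_int[OF periodic_h1, of u "frac r" "\<lfloor>r\<rfloor>"] by (simp add: frac_def)
  then show ?thesis
    using *[of "frac s" "frac t"] frac_lt_1[of s] frac_lt_1[of t] by (simp add: less_imp_le)
qed

text \<open>The average is attained somewhere, and from there the oscillation is bounded by the norm
  of the derivative.\<close>

lemma norm_h1_c0_le: "norm (h1_c0 u) \<le> \<bar>avg (h1_c0 u)\<bar> + norm (h1_deriv u)"
proof (rule c0_norm_le)
  fix t
  have "avg (h1_c0 u - of_real (avg (h1_c0 u))) = 0" by (simp add: avg_diff)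
  then obtain s where "Rep_c0 (h1_c0 u - of_real (avg (h1_c0 u))) s = 0" by (rule avg_0_has_zero)
  then show "\<bar>Rep_c0 (h1_c0 u) t\<bar> \<le> \<bar>avg (h1_c0 u)\<bar> + norm (h1_deriv u)"
    using h1_oscillation[of u t s] by simp
qed

lemma norm_h1_squared: "(norm u)\<^sup>2 = (norm (c0_l2 (h1_c0 u)))\<^sup>2 + (norm (h1_deriv u))\<^sup>2"
  unfolding power2_norm_eq_inner inner_c0_l2 by (simp add: inner_h1_def avg_def)

lemma bounded_linear_h1_c0: "bounded_linear h1_c0"
\<comment> \<open>One unit for the average, bounded by the L^2 norm, and one for the
  derivative.\<close>
proof (rule bounded_linear_intro[where K = 2])
  fix u
  have "norm (h1_deriv u) \<le> norm u" "norm (c0_l2 (h1_c0 u)) \<le> norm u"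
    by (rule power2_le_imp_le; simp add: norm_h1_squared)+
  moreover have "\<bar>avg (h1_c0 u)\<bar> \<le> norm (c0_l2 (h1_c0 u))"
    using abs_l2_mean_le[of "c0_l2 (h1_c0 u)"] by (simp add: l2_mean_c0_l2)
  ultimately show "norm (h1_c0 u) \<le> norm u * 2"
    using norm_h1_c0_le[of u] by linarith
qed (simp_all add: h1_c0_add h1_c0_scaleR)

lemma linear_h1_c0: "linear h1_c0"
  by (rule bounded_linear.linear[OF bounded_linear_h1_c0])

lemma linear_h1_deriv: "linear h1_deriv"
  by (rule linearI) (rule h1_deriv_add h1_deriv_scaleR)+

lemma h1_eqI:
  assumes "h1_deriv u = h1_deriv v" and "avg (h1_c0 u) = avg (h1_c0 v)"
  shows "u = v"
proof -
  have "h1_deriv (u - v) = 0"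
    by (simp add: linear_diff[OF linear_h1_deriv] assms(1))
  moreover have "avg (h1_c0 (u - v)) = 0"
    by (simp add: linear_diff[OF linear_h1_c0] avg_diff assms(2))
  ultimately have "h1_c0 (u - v) = 0" using norm_h1_c0_le[of "u - v"] by simp
  then have "h1_c0 (u - v) = h1_c0 0"
    by (simp add: linear_0[OF linear_h1_c0])
  then have "u - v = 0" by (rule injD[OF inj_h1_c0])
  then show ?thesis by simp
qed

section \<open>Periodic primitives of square-integrable classes\<close>

lemma h1_primitive_exists:
  assumes "periodic u" and "\<And>t. t \<in> {0..1} \<Longrightarrow> u t = u 0 + l2_primitive v t"
  shows "\<exists>e. Rep_h1 e = u \<and> h1_deriv e = v"
proof -
  have "u \<in> {u. periodic u \<and> (\<exists>v::l2. \<forall>t\<in>{0..1}. u t = u 0 + l2_primitive v t)}"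
    using assms by blast
  then have rep: "Rep_h1 (Abs_h1 u) = u" by (rule Abs_h1_inverse)
  moreover have "h1_deriv (Abs_h1 u) = v"
    by (rule h1_deriv_eqI) (use assms(2) in \<open>simp only: rep\<close>)
  ultimately show ?thesis by blast
qed

text \<open>Subtracting the mean makes the primitive periodic; an added constant then adjusts the
  average.\<close>

lemma h1_prim_exists:
  "\<exists>e. h1_deriv e = v - c0_l2 (of_real (l2_mean v)) \<and> avg (h1_c0 e) = l2_mean v"
proof -
  let ?v = "v - c0_l2 (of_real (l2_mean v))"
  have p1: "l2_primitive ?v 1 = 0"
    by (simp add: l2_mean_eq_primitive[symmetric] linear_diff[OF linear_l2_mean] l2_mean_c0_l2)
  \<comment> \<open>Extension through \<open>frac\<close> evaluates at 0 when t = 1, which is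
    consistent because the centred primitive vanishes at both ends.\<close>
  have "periodic (\<lambda>t. l2_primitive ?v (frac t))"
    by (simp add: periodic_def frac_1_eq)
  moreover have "l2_primitive ?v (frac t) = l2_primitive ?v (frac 0) + l2_primitive ?v t"
    if "t \<in> {0..1}" for t
  proof (cases "t = 1")
    case False
    then have "frac t = t" using that by (simp add: frac_eq)
    then show ?thesis by (simp add: l2_primitive_0)
  qed (simp add: p1 l2_primitive_0)
  ultimately obtain e where e: "h1_deriv e = ?v"
    using h1_primitive_exists[of "\<lambda>t. l2_primitive ?v (frac t)" ?v] by blast
  let ?c = "l2_mean v - avg (h1_c0 e)"
  have "periodic (\<lambda>t. Rep_h1 e t + ?c)" using periodic_h1[of e] by (simp add: periodic_def)
  moreover have "Rep_h1 e t + ?c = (Rep_h1 e 0 + ?c) + l2_primitive ?v t" if "t \<in> {0..1}" for t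
    using h1_deriv[OF that, of e] unfolding e by linarith
  ultimately obtain e' where e': "Rep_h1 e' = (\<lambda>t. Rep_h1 e t + ?c)" "h1_deriv e' = ?v"
    using h1_primitive_exists[of "\<lambda>t. Rep_h1 e t + ?c" ?v] by blast
  have "h1_c0 e' = h1_c0 e + of_real ?c"
    by (rule c0_eqI) (simp add: e'(1) del: of_real_diff)
  then have "avg (h1_c0 e') = l2_mean v" by (simp add: avg_add del: of_real_diff)
  then show ?thesis using e'(2) by blast
qed

definition h1_prim :: "l2 \<Rightarrow> h1" where
  "h1_prim v = (SOME e. h1_deriv e = v - c0_l2 (of_real (l2_mean v)) \<and> avg (h1_c0 e) = l2_mean v)"

lemma h1_deriv_prim: "h1_deriv (h1_prim v) = v - c0_l2 (of_real (l2_mean v))"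
  and avg_h1_prim: "avg (h1_c0 (h1_prim v)) = l2_mean v"
  using someI_ex[OF h1_prim_exists[of v]] unfolding h1_prim_def by blast+

lemma h1_prim_eqI:
  assumes "h1_deriv e = v - c0_l2 (of_real (l2_mean v))" and "avg (h1_c0 e) = l2_mean v"
  shows "h1_prim v = e"
  by (rule h1_eqI) (simp_all add: h1_deriv_prim avg_h1_prim assms)

lemma bounded_linear_h1_prim: "bounded_linear h1_prim"
\<comment> \<open>At most 3 for the L^2 part (average plus oscillation) and 2 for the
  derivative.\<close>
proof (rule bounded_linear_intro[where K = 5])
  show "h1_prim (v + v') = h1_prim v + h1_prim v'" for v v'
    by (rule h1_prim_eqI)
       (simp_all add: h1_deriv_add h1_c0_add h1_deriv_prim avg_h1_prim linear_add[OF linear_l2_mean]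
         c0_l2_add avg_add)
  show "h1_prim (r *\<^sub>R v) = r *\<^sub>R h1_prim v" for r v
    by (rule h1_prim_eqI)
       (simp_all add: h1_deriv_scaleR h1_c0_scaleR h1_deriv_prim avg_h1_prim of_real_def
         linear_scale[OF linear_l2_mean] scaleR_diff_right avg_scaleR flip: c0_l2_scaleR)
  fix v
  let ?e = "h1_prim v"
  have "norm (c0_l2 (of_real (l2_mean v))) \<le> norm v"
    using norm_c0_l2_le[of "of_real (l2_mean v)"] abs_l2_mean_le[of v] by simp
  then have d: "norm (h1_deriv ?e) \<le> 2 * norm v"
    unfolding h1_deriv_prim using norm_triangle_ineq4[of v "c0_l2 (of_real (l2_mean v))"] by simp
  have "norm (c0_l2 (h1_c0 ?e)) \<le> 3 * norm v"
    using norm_c0_l2_le[of "h1_c0 ?e"] norm_h1_c0_le[of ?e] d abs_l2_mean_le[of v]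
    by (simp add: avg_h1_prim)
  moreover have "norm ?e \<le> norm (c0_l2 (h1_c0 ?e)) + norm (h1_deriv ?e)"
    by (rule power2_le_imp_le) (simp_all add: norm_h1_squared power2_sum)
  ultimately show "norm ?e \<le> norm v * 5" using d by linarith
qed

lemma h1_c0_prim: "h1_c0 (h1_prim (c0_l2 c)) = k1 c + of_real (avg c)"
proof -
  let ?p = "k1 c + of_real (avg c)" and ?v = "c0_l2 (c - of_real (avg c))"
  have "Rep_c0 ?p t = Rep_c0 ?p 0 + l2_primitive ?v t" if "t \<in> {0..1}" for t
    using integral_circ_indicator_FTC[OF that continuous_on_c0 DERIV_subset[OF k1_plus_const_deriv[of c "avg c"]]]
    unfolding c0_l2_def l2_primitive.abs_eq[OF l2rel_c0] by simp
  then obtain e where e: "Rep_h1 e = Rep_c0 ?p" "h1_deriv e = ?v"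
    using h1_primitive_exists[OF periodic_c0] by blast
  have p: "h1_c0 e = ?p" by (rule c0_eqI) (simp only: Rep_h1_c0 e(1))
  have "h1_prim (c0_l2 c) = e"
    by (rule h1_prim_eqI) (simp_all add: e(2) p l2_mean_c0_l2 avg_add linear_diff[OF linear_c0_l2])
  then show ?thesis using p by simp
qed

interpretation sobolev: circle_pair_model sobolev_pair h1_c0 c0_l2 h1_prim
proof (rule circle_pair_model.intro)
  show "val sobolev_pair u = Rep_c0 (h1_c0 u)" for u
    by (simp add: sobolev_pair_def)
  show "incl sobolev_pair (Rep_c0 c) = c0_l2 c" for c
    by (simp add: sobolev_pair_def c0_l2_def)
  show "h1_prim (der sobolev_pair u + c0_l2 (of_real (avg (h1_c0 u)))) = u" for u
    by (rule h1_prim_eqI)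
       (simp_all add: sobolev_pair_def linear_add[OF linear_l2_mean] l2_mean_h1_deriv l2_mean_c0_l2)
  show "der sobolev_pair (h1_prim z) + c0_l2 (of_real (avg (h1_c0 (h1_prim z)))) = z" for z
    by (simp add: sobolev_pair_def h1_deriv_prim avg_h1_prim)
  show "linear (mean sobolev_pair)" by (simp add: sobolev_pair_def linear_l2_mean)
  show "mean sobolev_pair (c0_l2 c) = avg c" for c
    by (simp add: sobolev_pair_def l2_mean_c0_l2)
  show "mean sobolev_pair (der sobolev_pair u) = 0" for u
    by (simp add: sobolev_pair_def l2_mean_h1_deriv)
qed (rule bounded_linear_h1_c0 inj_h1_c0 bounded_linear_c0_l2 bounded_linear_h1_prim h1_c0_prim)+

theorem proposition2p1:
  fixes f :: "real \<Rightarrow> real \<Rightarrow> real" and k :: nat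
  assumes "periodic f"
    and "smooth (\<lambda>(t, x). f t x)"
    and "tame f"
    and "k \<ge> 1"
  shows "(regular_value (D2_integral sobolev_pair f) 0 \<longrightarrow>
      (\<forall>u. morin sobolev_pair f k u \<longleftrightarrow>
        (let w = lie (wfield sobolev_pair f); \<Phi> = Phi_map sobolev_pair f in
          (\<forall>j\<in>{1..k}. (w ^^ j) \<Phi> u = 0) \<and>
          (w ^^ (k + 1)) \<Phi> u \<noteq> 0 \<and>
          surj_deriv (\<lambda>j. (w ^^ j) \<Phi>) (k - 1) u)))
    \<and> (regular_value (D2_integral classical_pair f) 0 \<longrightarrow>
      (\<forall>u. morin classical_pair f k u \<longleftrightarrow>
        (let w = lie (wfield classical_pair f); \<Phi> = Phi_map classical_pair f in
          (\<forall>j\<in>{1..k}. (w ^^ j) \<Phi> u = 0) \<and>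
          (w ^^ (k + 1)) \<Phi> u \<noteq> 0 \<and>
          surj_deriv (\<lambda>j. (w ^^ j) \<Phi>) (k - 1) u)))"
proof -
  have f: "circle_nonlinearity f"
    using smooth_family_D2[OF assms(1,2)] by unfold_locales
  interpret sob: circle_ode f sobolev_pair h1_c0 c0_l2 h1_prim
    by (intro circle_ode.intro f sobolev.circle_pair_model_axioms)
  interpret cla: circle_ode f classical_pair c1_c0 "\<lambda>c. c" c1_prim
    by (intro circle_ode.intro f classical.circle_pair_model_axioms)
  show ?thesis
    unfolding Let_def using sob.morin_iff[OF assms(4)] cla.morin_iff[OF assms(4)] by blast
qed

end
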